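(* Let $m=2r$ be an even positive integer. Then the coefficients $A_\lambda$ (defined in the context, from the $r$th elementary symmetric function in the squares of the odd Jucys–Murphy elements) satisfy the identity $$\sum_{\lambda\in\mathcal{EP}(m)}A_\lambda P_\lambda(-m)=2(-1)^r.$$
   Context: Partitions: $|\lambda|$ is the sum of the parts of $\lambda$, $\ell(\lambda)$ the number of parts. $\mathcal{EP}$ is the set of partitions all of whose parts are even (including $\emptyset$), and $\mathcal{EP}(m)$ those with $|\lambda|=m$. Polynomials $P_\nu$: for $\nu=(2^{m_2},4^{m_4},6^{m_6},\dots)\in\mathcal{EP}$ (i.e. $m_i$ parts equal to $i$), $$P_\nu(x)=(-1)^{\ell(\nu)}\frac{x(x-1)\cdots(x-(m_2+m_4+m_6+\cdots)+1)}{m_2!\,m_4!\,m_6!\cdots}.$$ Double cover: $\widetilde S_n$ is the group generated by $t_1,\dots,t_{n-1},z$ with relations: $z$ central, $z^2=1$, $t_i^2=z$, $t_it_{i+1}t_i=t_{i+1}t_it_{i+1}$, $t_jt_i=zt_it_j$ for $|i-j|>1$. There are natural embeddings $\widetilde S_n\subset\widetilde S_{n+1}$. Cycles: in $\widetilde S_{n+1}$ put $x_i=t_it_{i+1}\cdots t_{n-1}t_nt_{n-1}\cdots t_{i+1}t_i$ for $1\le i\le n$ (so $x_n=t_n$). For distinct $i_1,\dots,i_k\in\{1,\dots,n\}$ with $k\ge2$ put $[i_1,\dots,i_k]=x_{i_1}x_{i_k}x_{i_{k-1}}\cdots x_{i_2}x_{i_1}$. This element lies in $\widetilde S_n$, does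 not depend on $n$, and maps to the cycle $(i_1,\dots,i_k)$ under $\widetilde S_n\to S_n$, $t_i\mapsto(i,i+1)$, $z\mapsto 1$ (permutations multiplied right to left). Classes: for $\lambda=(\lambda_1,\dots,\lambda_\ell)\in\mathcal{EP}$, $D_\lambda(n)$ is the set of all products of disjoint cycles $[i_1,\dots,i_{\lambda_1+1}][j_1,\dots,j_{\lambda_2+1}]\cdots[k_1,\dots,k_{\lambda_\ell+1}]$ in $\widetilde S_n$; it is empty if $|\lambda|+\ell(\lambda)>n$, and a conjugacy class of $\widetilde S_n$ otherwise. Spin group algebra: $\mathbb ZS_n^-=\mathbb Z\widetilde S_n/\langle z+1\rangle$, a superalgebra with every $t_i$ odd; $\mathcal Z_n$ is its even center (the set of even central elements). $d_\lambda(n)\in\mathbb ZS_n^-$ is the image of the class sum of $D_\lambda(n)$. The $d_\lambda(n)$ with $\lambda\in\mathcal{EP}$, $|\lambda|+\ell(\lambda)\le n$, form a basis of $\mathcal Z_n$. Coefficients $A_\lambda$: let $M_k=\sum_{i=1}^{k-1}[i,k]\in\mathbb ZS_n^-$ for $1\le k\le n$ (odd Jucys–Murphy elements). The element $e_{r;n}=\sum_{1\le i_1<\cdots<i_r\le n}M_{i_1}^2\cdots M_{i_r}^2$ lies in $\mathcal Z_n$. For $\lambda\in\mathcal{EP}(2r)$, $A_\lambda$ denotes the coefficient of $d_\lambda(n)$ in the expansion of $e_{r;n}$ in the basis $\{d_\mu(n) : \mu\in\mathcal{EP},\ |\mu|+\ell(\mu)\le n\}$ of $\mathcal Z_n$,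 for any $n\ge|\lambda|+\ell(\lambda)$; it does not depend on $n$. *)

theory Defs
  imports
    "HOL-Algebra.Algebra"
    "HOL-Library.Multiset"
    "HOL-Computational_Algebra.Polynomial"
begin

section \<open>Partitions and the polynomials \<open>P\<^sub>\<nu>\<close>\<close>

text \<open>A partition is the multiset of its (positive) parts.\<close>

definition even_partitions :: "nat multiset set"  (\<open>\<E>\<P>\<close>) where
  "\<E>\<P> = {\<nu>. \<forall>i\<in>#\<nu>. 0 < i \<and> even i}"

definition even_partitions_of :: "nat \<Rightarrow> nat multiset set" where
  "even_partitions_of m = {\<nu> \<in> \<E>\<P>. sum_mset \<nu> = m}"

definition P_poly :: "nat multiset \<Rightarrow> rat poly" where
  "P_poly \<nu> = smult ((- 1) ^ size \<nu> / (\<Prod>i\<in>set_mset \<nu>. fact (count \<nu> i)))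
     (\<Prod>j<size \<nu>. [:- of_nat j, 1:])"


section \<open>Groups given by generators and relations\<close>

text \<open>Words are over the generators and their formal inverses: the letter \<open>(s, True)\<close> stands for
  \<open>s\<close> and \<open>(s, False)\<close> for its inverse.  A relation \<open>u = v\<close> is given as the pair \<open>(u, v)\<close>.\<close>

type_synonym 's word = "('s \<times> bool) list"

definition words :: "'s set \<Rightarrow> 's word set" where
  "words S = lists (S \<times> UNIV)"

inductive word_step :: "'s set \<Rightarrow> ('s word \<times> 's word) set \<Rightarrow> 's word \<Rightarrow> 's word \<Rightarrow> bool"
  for S R where
  cancel: "\<lbrakk>a \<in> words S; b \<in> words S; s \<in> S\<rbrakk>
     \<Longrightarrow> word_step S R (a @ [(s, e), (s, \<not> e)] @ b) (a @ b)"
| relation: "\<lbrakk>a \<in> words S; b \<in> words S; (u, v) \<in> R; u \<in> words S; v \<in> words S\<rbrakk>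
     \<Longrightarrow> word_step S R (a @ u @ b) (a @ v @ b)"

definition word_rel :: "'s set \<Rightarrow> ('s word \<times> 's word) set \<Rightarrow> ('s word \<times> 's word) set" where
  "word_rel S R = {(u, v). u \<in> words S \<and> v \<in> words S \<and> equivclp (word_step S R) u v}"

definition presented_group :: "'s set \<Rightarrow> ('s word \<times> 's word) set \<Rightarrow> 's word set monoid" where
  "presented_group S R = \<lparr>
     carrier = words S // word_rel S R,
     monoid.mult = (\<lambda>U V. word_rel S R `` {u @ v |u v. u \<in> U \<and> v \<in> V}),
     monoid.one = word_rel S R `` {[]}\<rparr>"

text \<open>The product of a list of elements, from left to right.\<close>

definition list_mult :: "('a, 'b) monoid_scheme \<Rightarrow> 'a list \<Rightarrow> 'a" where
  "list_mult G xs = foldr (\<otimes>\<^bsub>G\<^esub>) xs \<one>\<^bsub>G\<^esub>"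


section \<open>The double covers of the symmetric groups\<close>

datatype gen = T nat | Z

definition cover_gens :: "nat \<Rightarrow> gen set" where
  "cover_gens n = insert Z (T ` {i. 1 \<le> i \<and> i < n})"

definition tw :: "nat \<Rightarrow> gen word" where
  "tw i = [(T i, True)]"

definition zw :: "gen word" where
  "zw = [(Z, True)]"

definition cover_rels :: "nat \<Rightarrow> (gen word \<times> gen word) set" where
  "cover_rels n =
     {(zw @ tw i, tw i @ zw) |i. 1 \<le> i \<and> i < n} \<union>
     {(zw @ zw, [])} \<union>
     {(tw i @ tw i, zw) |i. 1 \<le> i \<and> i < n} \<union>
     {(tw i @ tw (i + 1) @ tw i, tw (i + 1) @ tw i @ tw (i + 1)) |i. 1 \<le> i \<and> i + 1 < n} \<union>
     {(tw j @ tw i, zw @ tw i @ tw j) |i j.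
        1 \<le> i \<and> i < n \<and> 1 \<le> j \<and> j < n \<and> (i + 1 < j \<or> j + 1 < i)}"

definition cover :: "nat \<Rightarrow> gen word set monoid" where
  "cover n = presented_group (cover_gens n) (cover_rels n)"

definition cover_class :: "nat \<Rightarrow> gen word \<Rightarrow> gen word set" where
  "cover_class n w = word_rel (cover_gens n) (cover_rels n) `` {w}"

definition t_elem :: "nat \<Rightarrow> nat \<Rightarrow> gen word set" where
  "t_elem n i = cover_class n (tw i)"

definition z_elem :: "nat \<Rightarrow> gen word set" where
  "z_elem n = cover_class n zw"

text \<open>The natural embedding of \<open>cover n\<close> into \<open>cover (n + 1)\<close>: the class of a word is sent to the
  class of the same word in the larger group.\<close>

definition cover_emb :: "nat \<Rightarrow> gen word set \<Rightarrow> gen word set" where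
  "cover_emb n U = word_rel (cover_gens (n + 1)) (cover_rels (n + 1)) `` U"

text \<open>\<open>x_elem n i\<close> is \<open>x\<^sub>i = t\<^sub>i \<cdots> t\<^sub>n\<^sub>-\<^sub>1 t\<^sub>n t\<^sub>n\<^sub>-\<^sub>1 \<cdots> t\<^sub>i\<close>, an element of \<open>cover (n + 1)\<close>.\<close>

definition x_elem :: "nat \<Rightarrow> nat \<Rightarrow> gen word set" where
  "x_elem n i = list_mult (cover (n + 1)) (map (t_elem (n + 1)) ([i..<n + 1] @ rev [i..<n]))"

text \<open>The cycle \<open>[i\<^sub>1, \<dots>, i\<^sub>k] = x\<^bsub>i\<^sub>1\<^esub> x\<^bsub>i\<^sub>k\<^esub> \<cdots> x\<^bsub>i\<^sub>2\<^esub> x\<^bsub>i\<^sub>1\<^esub>\<close>, for distinct \<open>i\<^sub>1, \<dots>, i\<^sub>k\<close> in \<open>{1..n}\<close> and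
  \<open>k \<ge> 2\<close>.  This product is formed in \<open>cover (n + 1)\<close> but lies in the image of \<open>cover n\<close>;
  the cycle is the corresponding element of \<open>cover n\<close>.\<close>

definition cycle_elem :: "nat \<Rightarrow> nat list \<Rightarrow> gen word set" where
  "cycle_elem n is = (THE g. g \<in> carrier (cover n) \<and>
     cover_emb n g = list_mult (cover (n + 1)) (map (x_elem n) (hd is # rev is)))"

text \<open>The cycles in the product have lengths \<open>\<nu>\<^sub>1 + 1, \<nu>\<^sub>2 + 1, \<dots>\<close> in this order, where
  \<open>\<nu>\<^sub>1 \<ge> \<nu>\<^sub>2 \<ge> \<cdots>\<close> are the parts of \<open>\<nu>\<close>.\<close>

definition D_class :: "nat multiset \<Rightarrow> nat \<Rightarrow> gen word set set" where
  "D_class \<nu> n = {list_mult (cover n) (map (cycle_elem n) cs) |cs.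
     map length cs = map Suc (rev (sorted_list_of_multiset \<nu>)) \<and>
     distinct (concat cs) \<and> set (concat cs) \<subseteq> {1..n}}"


section \<open>Integral group rings and the spin group algebra\<close>

definition group_ring :: "('g, 'b) monoid_scheme \<Rightarrow> ('g \<Rightarrow> int) ring" where
  "group_ring G = \<lparr>
     carrier = {f. finite {g. f g \<noteq> 0} \<and> {g. f g \<noteq> 0} \<subseteq> carrier G},
     monoid.mult = (\<lambda>f h x. \<Sum>(u, v) \<in> {(u, v). f u \<noteq> 0 \<and> h v \<noteq> 0 \<and> u \<otimes>\<^bsub>G\<^esub> v = x}. f u * h v),
     monoid.one = (\<lambda>x. of_bool (x = \<one>\<^bsub>G\<^esub>)),
     ring.zero = (\<lambda>x. 0),
     ring.add = (\<lambda>f h x. f x + h x)\<rparr>"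

text \<open>The formal sum of the elements of a finite subset \<open>A\<close> of the group.\<close>

definition set_sum :: "'g set \<Rightarrow> 'g \<Rightarrow> int" where
  "set_sum A = (\<lambda>g. of_bool (g \<in> A))"

definition spin_ideal :: "nat \<Rightarrow> (gen word set \<Rightarrow> int) set" where
  "spin_ideal n = genideal (group_ring (cover n))
     {set_sum {z_elem n} \<oplus>\<^bsub>group_ring (cover n)\<^esub> \<one>\<^bsub>group_ring (cover n)\<^esub>}"

definition spin_algebra :: "nat \<Rightarrow> (gen word set \<Rightarrow> int) set ring" where
  "spin_algebra n = group_ring (cover n) Quot spin_ideal n"

definition spin_proj :: "nat \<Rightarrow> (gen word set \<Rightarrow> int) \<Rightarrow> (gen word set \<Rightarrow> int) set" where
  "spin_proj n f = spin_ideal n +>\<^bsub>group_ring (cover n)\<^esub> f"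

definition d_elem :: "nat multiset \<Rightarrow> nat \<Rightarrow> (gen word set \<Rightarrow> int) set" where
  "d_elem \<nu> n = spin_proj n (set_sum (D_class \<nu> n))"


section \<open>Odd Jucys--Murphy elements and the coefficients \<open>A\<^sub>\<nu>\<close>\<close>

definition odd_JM :: "nat \<Rightarrow> nat \<Rightarrow> (gen word set \<Rightarrow> int) set" where
  "odd_JM n k = (\<Oplus>\<^bsub>spin_algebra n\<^esub>i\<in>{1..<k}. spin_proj n (set_sum {cycle_elem n [i, k]}))"

definition e_elem :: "nat \<Rightarrow> nat \<Rightarrow> (gen word set \<Rightarrow> int) set" where
  "e_elem r n = (\<Oplus>\<^bsub>spin_algebra n\<^esub>I\<in>{I. I \<subseteq> {1..n} \<and> card I = r}.
     list_mult (spin_algebra n)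
       (map (\<lambda>k. odd_JM n k [^]\<^bsub>spin_algebra n\<^esub> (2::nat)) (sorted_list_of_set I)))"

definition basis_index :: "nat \<Rightarrow> nat multiset set" where
  "basis_index n = {\<mu> \<in> \<E>\<P>. sum_mset \<mu> + size \<mu> \<le> n}"

text \<open>The coordinates of an element of the even center with respect to the basis \<open>d\<^sub>\<mu>(n)\<close>,
  \<open>\<mu> \<in> basis_index n\<close>.\<close>

definition d_coeff :: "nat \<Rightarrow> (gen word set \<Rightarrow> int) set \<Rightarrow> nat multiset \<Rightarrow> int" where
  "d_coeff n f = (THE c. (\<forall>\<mu>. \<mu> \<notin> basis_index n \<longrightarrow> c \<mu> = 0) \<and>
     f = (\<Oplus>\<^bsub>spin_algebra n\<^esub>\<mu>\<in>basis_index n. [c \<mu>] \<cdot>\<^bsub>spin_algebra n\<^esub> d_elem \<mu> n))"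

text \<open>\<open>A\<^sub>\<nu>\<close> is the common value, for all \<open>n \<ge> |\<nu>| + \<ell>(\<nu>)\<close>, of the coefficient of \<open>d\<^sub>\<nu>(n)\<close> in \<open>e\<^sub>r\<^sub>;\<^sub>n\<close>,
  where \<open>2 r = |\<nu>|\<close>.\<close>

definition A_coeff :: "nat multiset \<Rightarrow> int" where
  "A_coeff \<nu> = (THE a. \<forall>n \<ge> sum_mset \<nu> + size \<nu>.
     d_coeff n (e_elem (sum_mset \<nu> div 2) n) \<nu> = a)"

end

theory Submission
  imports Defs
    "HOL-Combinatorics.Cycles"
    "HOL-Combinatorics.Multiset_Permutations"
    "HOL-Computational_Algebra.Formal_Power_Series"
    "HOL-Library.Function_Algebras"
begin

text \<open>The double cover is faithfully represented in a Clifford algebra with generators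
  \<open>e\<^sub>i\<close>, \<open>e\<^sub>i\<^sup>2 = -1\<close>, by \<open>t\<^sub>i \<mapsto> (e\<^sub>i - e\<^sub>i\<^sub>+\<^sub>1) / \<surd>2\<close> and \<open>z \<mapsto> -1\<close>; then \<open>x\<^sub>i\<close> becomes
  \<open>(e\<^sub>i - e\<^sub>n\<^sub>+\<^sub>1) / \<surd>2\<close> and \<open>[i, j]\<close> becomes \<open>(e\<^sub>j - e\<^sub>i) / \<surd>2\<close>.  The relations
  \<open>t\<^sub>k M\<^sub>k\<^sub>+\<^sub>1 = z M\<^sub>k t\<^sub>k + 1\<close> and \<open>M\<^sub>j M\<^sub>k = z M\<^sub>k M\<^sub>j\<close> show that \<open>e\<^sub>r\<^sub>;\<^sub>n\<close> is central, so that it is a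
  combination of the \<open>d\<^sub>\<mu>(n)\<close>: an element \<open>g\<close> over an even permutation with an even cycle is
  conjugate to \<open>z g\<close>.

  A permutation with \<open>\<Sum>(length - 1) = 2r\<close> arises from \<open>r\<close> factors \<open>[a, k][b, k]\<close> only by minimal
  factorizations.  Removing the factor with the largest \<open>k\<close> splits the cycle of \<open>k\<close> into two shorter
  cycles, both odd, and changes the sign, which is the Catalan recursion:
  \<open>A\<^sub>\<nu> = \<Prod>(- C(\<nu>\<^sub>i / 2))\<close>.  With \<open>C = 1 + t\<^sup>2 C\<^sup>2\<close> the sum over partitions is the coefficient of
  \<open>t\<^sup>2\<^sup>r\<close> in \<open>C\<^sup>-\<^sup>2\<^sup>r\<close>.  Since \<open>1/C\<close> and \<open>t\<^sup>2 C\<close> are the roots of \<open>y\<^sup>2 - y + t\<^sup>2\<close> and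
  \<open>(t\<^sup>2 C)\<^sup>2\<^sup>r\<close> does not contribute, this is the leading coefficient of a Lucas polynomial.\<close>


section \<open>Catalan numbers and the polynomials \<open>P\<^sub>\<nu>\<close>\<close>

unbundle fps_syntax

text \<open>The Clifford ring is a model of the group only, not of its algebra: linear relations
  such as \<open>rtv i j + rtv j k + rtv k i = 0\<close> hold there but not in the spin group
  algebra. Coefficients are therefore kept as functions on the image group, and multiplication by a
  Jucys-Murphy element becomes a sum of translations of such functions. Setting z = -1 retains of a
  function f only the differences f(g) - f(-g); this is why \<open>spin_coeff\<close> is a
  difference.

  The obstacle is that the cover is given by a presentation. The representation shows that it is
  large enough, in particular that z is not 1. That it is not larger, so that the representation is
  faithful, rests on Coxeter's presentation of the symmetric group.

  If a class contained g together with z g, its class sum would vanish in the quotient and have no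
  coefficient. This is excluded by the top coefficient itself, which is constant on the class, odd
  under g -> -g and nonzero. Hence the Catalan computation comes before the independence of the
  \<open>d_elem\<close>, not after it.\<close>

fun catalan :: "nat \<Rightarrow> nat" where
  "catalan 0 = 1"
| "catalan (Suc n) = (\<Sum>i\<le>n. catalan i * catalan (n - i))"

text \<open>The Catalan series is taken in the square of the variable, so that the exponent
  \<open>i\<close> belongs to the part \<open>i\<close> itself and exponents add up to the size of a
  partition.\<close>

definition catalan_fps :: "rat fps" where
  "catalan_fps = Abs_fps (\<lambda>i. if even i then of_nat (catalan (i div 2)) else 0)"

lemma catalan_fps_nth: "catalan_fps $ i = (if even i then of_nat (catalan (i div 2)) else 0)"
  by (simp add: catalan_fps_def)

lemma catalan_fps_eq: "catalan_fps = 1 + fps_X ^ 2 * catalan_fps ^ 2"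
proof (rule fps_ext)
  fix m
  show "catalan_fps $ m = (1 + fps_X ^ 2 * catalan_fps ^ 2) $ m"
  proof (cases "m < 2")
    case True
    then have "m = 0 \<or> m = 1" by auto
    then show ?thesis by (auto simp: catalan_fps_nth fps_X_power_mult_nth)
  next
    case False
    then obtain k where m: "m = k + 2" by (metis add.commute le_iff_add not_less)
    have "(catalan_fps ^ 2) $ k = (if even k then of_nat (catalan (Suc (k div 2))) else 0)"
    proof (cases "even k")
      case True
      then obtain h where k: "k = 2 * h" by blast
      have "(catalan_fps ^ 2) $ k = (\<Sum>i=0..2*h. catalan_fps $ i * catalan_fps $ (2*h - i))"
        by (simp add: power2_eq_square fps_mult_nth k)
      also have "\<dots> = (\<Sum>i\<in>(\<lambda>j. 2 * j) ` {..h}. catalan_fps $ i * catalan_fps $ (2*h - i))"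
        by (rule sum.mono_neutral_right) (auto simp: catalan_fps_nth image_iff elim!: evenE)
      also have "\<dots> = (\<Sum>j\<le>h. of_nat (catalan j * catalan (h - j)))"
        by (subst sum.reindex)
          (auto simp: inj_on_def catalan_fps_nth right_diff_distrib' [symmetric] intro!: sum.cong)
      finally show ?thesis using True k by simp
    next
      case False
      then show ?thesis
        unfolding power2_eq_square fps_mult_nth by (auto simp: catalan_fps_nth intro!: sum.neutral)
    qed
    then show ?thesis using m by (simp add: catalan_fps_nth fps_X_power_mult_nth)
  qed
qed

text \<open>Newton's recursion reads \<open>p (n + 2) = p (n + 1) - X^2 * p n\<close>, so
  \<open>p n\<close> has degree at most \<open>n\<close>, and its coefficient at \<open>n\<close>
  changes sign when \<open>n\<close> grows by 2. The factor 2 of the final formula is the number of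
  roots, \<open>p 0 = 2\<close>.\<close>

lemma power_sum_of_roots:
  fixes \<alpha> \<beta> :: "rat fps"
  assumes "\<alpha> + \<beta> = 1" "\<alpha> * \<beta> = fps_X ^ 2"
  shows "(\<forall>j>n. (\<alpha> ^ n + \<beta> ^ n) $ j = 0) \<and>
    (\<alpha> ^ n + \<beta> ^ n) $ n = (if even n then 2 * (- 1) ^ (n div 2) else 0)"
proof (induction n rule: induct_nat_012)
  case 0
  show ?case by (simp add: fps_numeral_nth)
next
  case 1
  then show ?case using assms by (simp add: fps_one_nth)
next
  case (ge2 n)
  have "\<alpha> ^ Suc (Suc n) + \<beta> ^ Suc (Suc n)
    = (\<alpha> + \<beta>) * (\<alpha> ^ Suc n + \<beta> ^ Suc n) - \<alpha> * \<beta> * (\<alpha> ^ n + \<beta> ^ n)"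
    by (simp add: algebra_simps)
  also have "\<dots> = (\<alpha> ^ Suc n + \<beta> ^ Suc n) - fps_X ^ 2 * (\<alpha> ^ n + \<beta> ^ n)"
    using assms by simp
  finally show ?case
    using ge2 by (auto simp del: power_Suc fps_add_nth simp: fps_X_power_mult_nth) simp
qed

lemma catalan_power_coeff:
  assumes "r > 0"
  shows "(inverse (catalan_fps ^ (2 * r))) $ (2 * r) = 2 * (- 1) ^ r"
proof -
  define \<alpha> \<beta> where "\<alpha> = 1 - fps_X ^ 2 * catalan_fps" and "\<beta> = fps_X ^ 2 * catalan_fps"
  have "\<alpha> * catalan_fps = catalan_fps - fps_X ^ 2 * catalan_fps ^ 2"
    by (simp add: \<alpha>_def algebra_simps power2_eq_square)
  also have "\<dots> = 1" using catalan_fps_eq by (simp add: algebra_simps)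
  finally have inv: "\<alpha> * catalan_fps = 1" .
  have "\<alpha> * \<beta> = fps_X ^ 2 * (\<alpha> * catalan_fps)" by (simp add: \<beta>_def algebra_simps)
  then have "\<alpha> * \<beta> = fps_X ^ 2" using inv by simp
  moreover have "\<alpha> + \<beta> = 1" by (simp add: \<alpha>_def \<beta>_def)
  ultimately have "(\<alpha> ^ (2*r) + \<beta> ^ (2*r)) $ (2*r) = 2 * (- 1) ^ r"
    using power_sum_of_roots[of \<alpha> \<beta> "2*r"] by simp
  moreover have "\<beta> ^ (2*r) = fps_X ^ (4*r) * catalan_fps ^ (2*r)"
    by (simp add: \<beta>_def power_mult_distrib power_mult [symmetric])
  then have "\<beta> ^ (2*r) $ (2*r) = 0" using assms by (simp add: fps_X_power_mult_nth)
  moreover have "inverse (catalan_fps ^ (2 * r)) = \<alpha> ^ (2 * r)"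
    by (rule fps_inverse_unique) (metis inv power_mult_distrib mult.commute power_one)
  ultimately show ?thesis by simp
qed

section \<open>From sums over partitions to sums over compositions\<close>

lemma fps_power_nth_lists:
  fixes a :: "'a::comm_ring_1 fps"
  shows "(a ^ k) $ m = (\<Sum>xs\<in>{xs. length xs = k \<and> sum_list xs = m}. \<Prod>x\<leftarrow>xs. a $ x)"
proof (cases k)
  case 0
  have "{xs::nat list. xs = [] \<and> sum_list xs = m} = (if m = 0 then {[]} else {})" by auto
  then show ?thesis using 0 by (simp add: fps_one_nth)
next
  case (Suc l)
  have "(\<Prod>j\<in>{0..l}. a $ (xs ! j)) = (\<Prod>x\<leftarrow>xs. a $ x)" if "length xs = Suc l" for xs
    using that by (simp add: prod.list_conv_set_nth atLeastLessThanSuc_atLeastAtMost)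
  then show ?thesis
    by (auto simp: Suc fps_power_nth_Suc natpermute_def simp del: power_Suc intro!: sum.cong)
qed

lemma length_le_sum_list:
  "\<forall>x\<in>set xs. 0 < x \<Longrightarrow> length xs \<le> sum_list xs" for xs :: "nat list"
proof (induction xs)
  case (Cons x xs)
  then have "length xs \<le> sum_list xs" "0 < x" by simp_all
  then show ?case by (simp add: Suc_le_eq add_le_less_mono)
qed simp

lemma finite_nat_lists_sum:
  "finite {xs::nat list. (\<forall>x\<in>set xs. 0 < x) \<and> sum_list xs = m}"
proof (rule finite_subset)
  show "{xs::nat list. (\<forall>x\<in>set xs. 0 < x) \<and> sum_list xs = m}
    \<subseteq> {xs. set xs \<subseteq> {..m} \<and> length xs \<le> m}"
    using member_le_sum_list length_le_sum_list by fastforce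
  show "finite {xs. set xs \<subseteq> {..m} \<and> length xs \<le> m}"
    by (simp add: finite_lists_length_le)
qed

text \<open>The multiplicities in the denominator turn the factorial of the length into the number
  of orderings of \<open>\<nu>\<close>; what remains of the falling factorial is a binomial
  coefficient. A sum over partitions thereby becomes one over lists of parts.\<close>

lemma poly_P_poly:
  "poly (P_poly \<nu>) x
    = of_nat (card (permutations_of_multiset \<nu>)) * ((- 1) ^ size \<nu> * (x gchoose size \<nu>))"
proof -
  let ?D = "\<Prod>i\<in>set_mset \<nu>. fact (count \<nu> i) :: nat"
  have D: "(of_nat ?D :: rat) \<noteq> 0" by simp
  have "of_nat (card (permutations_of_multiset \<nu>)) * of_nat ?D = (fact (size \<nu>) :: rat)"
    by (metis card_permutations_of_multiset_aux of_nat_fact of_nat_mult)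
  moreover have "(x gchoose size \<nu>) * fact (size \<nu>) = (\<Prod>j<size \<nu>. x - of_nat j)"
    by (simp add: gbinomial_prod_rev atLeast0LessThan)
  moreover have "poly (P_poly \<nu>) x * of_nat ?D = (- 1) ^ size \<nu> * (\<Prod>j<size \<nu>. x - of_nat j)"
    using D by (simp add: P_poly_def poly_prod field_simps)
  ultimately have "poly (P_poly \<nu>) x * of_nat ?D =
      of_nat (card (permutations_of_multiset \<nu>)) * ((- 1) ^ size \<nu> * (x gchoose size \<nu>)) * of_nat ?D"
    by (simp add: algebra_simps)
  then show ?thesis using D by (metis mult_right_cancel)
qed

text \<open>The sign of \<open>P_poly\<close> cancels the signs of the Catalan factors. Over the
  lists with \<open>k\<close> parts the sum is the coefficient of \<open>b ^ k\<close> times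
  \<open>x gchoose k\<close>, where \<open>b\<close> is the Catalan series without its constant
  term; summing over \<open>k\<close> gives the binomial series of \<open>1 + b\<close> with
  exponent \<open>x = - m\<close>.\<close>

lemma even_partition_sum:
  assumes m: "m = 2 * r" and pos: "0 < m"
  shows "(\<Sum>\<nu>\<in>even_partitions_of m.
      of_int (\<Prod>i\<in>#\<nu>. - int (catalan (i div 2))) * poly (P_poly \<nu>) (- of_nat m)) = 2 * (- 1) ^ r"
proof -
  define b :: "rat fps" where "b = catalan_fps - 1"
  define L where "L = {xs::nat list. (\<forall>x\<in>set xs. 0 < x) \<and> sum_list xs = m}"
  define Le where "Le = {xs \<in> L. \<forall>x\<in>set xs. even x}"
  define x :: rat where "x = - of_nat m"
  have finL: "finite L" unfolding L_def by (rule finite_nat_lists_sum)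
  have finLe: "finite Le" unfolding Le_def using finL by simp
  have b_nth: "b $ i = (if even i \<and> 0 < i then of_nat (catalan (i div 2)) else 0)" for i
    by (auto simp: b_def catalan_fps_nth fps_one_nth)
  have mset_Le: "mset ` Le = even_partitions_of m"
  proof
    show "mset ` Le \<subseteq> even_partitions_of m"
      by (auto simp: Le_def L_def even_partitions_of_def even_partitions_def sum_mset_sum_list)
    show "even_partitions_of m \<subseteq> mset ` Le"
    proof
      fix \<nu> assume "\<nu> \<in> even_partitions_of m"
      moreover obtain xs where "mset xs = \<nu>" by (meson ex_mset)
      ultimately show "\<nu> \<in> mset ` Le"
        by (auto simp: Le_def L_def even_partitions_of_def even_partitions_def sum_mset_sum_list)
    qed
  qed
  have fibre: "{xs \<in> Le. mset xs = \<nu>} = permutations_of_multiset \<nu>" if "\<nu> \<in> even_partitions_of m" for \<nu>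
    using that
    by (auto simp: Le_def L_def even_partitions_of_def even_partitions_def permutations_of_multiset_def
        sum_mset_sum_list [symmetric] set_mset_mset [symmetric] simp del: set_mset_mset)
  have sign: "of_int (\<Prod>i\<in>#\<nu>. - int (catalan (i div 2))) * (- 1) ^ size \<nu>
      = (of_nat (\<Prod>i\<in>#\<nu>. catalan (i div 2)) :: rat)" for \<nu>
    by (induction \<nu>) (auto simp: algebra_simps)
  have "(\<Sum>\<nu>\<in>even_partitions_of m.
      of_int (\<Prod>i\<in>#\<nu>. - int (catalan (i div 2))) * poly (P_poly \<nu>) x)
    = (\<Sum>\<nu>\<in>even_partitions_of m. \<Sum>xs\<in>{xs \<in> Le. mset xs = \<nu>}.
        (x gchoose length xs) * of_nat (\<Prod>i\<leftarrow>xs. catalan (i div 2)))"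
  proof (rule sum.cong [OF refl])
    fix \<nu> assume \<nu>: "\<nu> \<in> even_partitions_of m"
    have "(\<Sum>xs\<in>{xs \<in> Le. mset xs = \<nu>}. (x gchoose length xs) * of_nat (\<Prod>i\<leftarrow>xs. catalan (i div 2)))
      = (\<Sum>xs\<in>permutations_of_multiset \<nu>. (x gchoose size \<nu>) * of_nat (\<Prod>i\<in>#\<nu>. catalan (i div 2)))"
      unfolding fibre[OF \<nu>]
      by (rule sum.cong [OF refl])
        (auto simp: permutations_of_multiset_def prod_mset_prod_list [symmetric] simp flip: mset_map)
    also have "\<dots> = of_int (\<Prod>i\<in>#\<nu>. - int (catalan (i div 2))) * poly (P_poly \<nu>) x"
      unfolding poly_P_poly sign [symmetric] by simp
    finally show "of_int (\<Prod>i\<in>#\<nu>. - int (catalan (i div 2))) * poly (P_poly \<nu>) x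
      = (\<Sum>xs\<in>{xs \<in> Le. mset xs = \<nu>}. (x gchoose length xs) * of_nat (\<Prod>i\<leftarrow>xs. catalan (i div 2)))"
      by (rule sym)
  qed
  also have "\<dots> = (\<Sum>xs\<in>Le. (x gchoose length xs) * of_nat (\<Prod>i\<leftarrow>xs. catalan (i div 2)))"
    unfolding mset_Le [symmetric] by (rule sum.group) (use finLe in auto)
  also have "\<dots> = (\<Sum>xs\<in>Le. (x gchoose length xs) * (\<Prod>i\<leftarrow>xs. b $ i))"
  proof (rule sum.cong [OF refl])
    fix xs assume "xs \<in> Le"
    then have "\<forall>x\<in>set xs. even x \<and> 0 < x" by (auto simp: Le_def L_def)
    then have "(\<Prod>i\<leftarrow>xs. b $ i) = of_nat (\<Prod>i\<leftarrow>xs. catalan (i div 2))"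
      by (induction xs) (auto simp: b_nth)
    then show "(x gchoose length xs) * of_nat (\<Prod>i\<leftarrow>xs. catalan (i div 2))
        = (x gchoose length xs) * (\<Prod>i\<leftarrow>xs. b $ i)" by simp
  qed
  also have "\<dots> = (\<Sum>k=0..m. \<Sum>xs\<in>{xs \<in> Le. length xs = k}. (x gchoose length xs) * (\<Prod>i\<leftarrow>xs. b $ i))"
  proof (rule sum.group [symmetric])
    show "length ` Le \<subseteq> {0..m}" by (auto simp: Le_def L_def dest: length_le_sum_list)
  qed (use finLe in auto)
  also have "\<dots> = (\<Sum>k=0..m. (x gchoose k) * (b ^ k) $ m)"
  proof (rule sum.cong [OF refl])
    fix k
    have "(b ^ k) $ m = (\<Sum>xs\<in>{xs \<in> Le. length xs = k}. \<Prod>i\<leftarrow>xs. b $ i)"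
      unfolding fps_power_nth_lists
    proof (rule sum.mono_neutral_right)
      have "{xs. length xs = k \<and> sum_list xs = m} \<subseteq> {xs. set xs \<subseteq> {..m} \<and> length xs = k}"
        using member_le_sum_list by fastforce
      then show "finite {xs. length xs = k \<and> sum_list xs = m}"
        using finite_lists_length_eq[of "{..m}" k] finite_subset by blast
      \<comment> \<open>\<open>b\<close> has neither a constant nor an odd term, so a list with a
        zero or an odd entry contributes nothing.\<close>
      show "\<forall>xs\<in>{xs. length xs = k \<and> sum_list xs = m} - {xs \<in> Le. length xs = k}. (\<Prod>i\<leftarrow>xs. b $ i) = 0"
        by (auto simp: Le_def L_def prod_list_zero_iff b_nth image_iff)
    qed (auto simp: Le_def L_def)
    then show "(\<Sum>xs\<in>{xs \<in> Le. length xs = k}. (x gchoose length xs) * (\<Prod>i\<leftarrow>xs. b $ i))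
        = (x gchoose k) * (b ^ k) $ m"
      by (simp add: sum_distrib_left)
  qed
  also have "\<dots> = (fps_binomial x oo b) $ m"
    by (simp add: fps_compose_nth)
  also have "fps_binomial x oo b = inverse (catalan_fps ^ m)"
  proof -
    have b0: "b $ 0 = 0" by (simp add: b_nth)
    have "fps_binomial x oo b = inverse ((1 + fps_X) ^ m) oo b"
      unfolding x_def by (simp only: fps_binomial_minus_of_nat)
    also have "\<dots> = inverse ((1 + fps_X) ^ m oo b)"
      by (rule fps_inverse_compose [OF b0]) simp
    also have "(1 + fps_X) ^ m oo b = ((1 + fps_X) oo b) ^ m"
      by (rule fps_compose_power [OF b0, symmetric])
    also have "(1 + fps_X) oo b = 1 + b"
      by (simp add: fps_compose_add_distrib fps_X_fps_compose_startby0 b0)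
    finally show ?thesis by (simp add: b_def)
  qed
  also have "\<dots> $ m = 2 * (- 1) ^ r"
    using catalan_power_coeff m pos by simp
  finally show ?thesis unfolding x_def .
qed

unbundle no fps_syntax


section \<open>A Clifford algebra\<close>

text \<open>Additive operators under composition satisfy the ring laws for free, and scalars are
  operators as well. Infinitely many generators fit into this one ring, so the covers for all
  \<open>n\<close> are represented at once and their embeddings become inclusions.\<close>

typedef clif = "{f :: (nat set \<Rightarrow> real) \<Rightarrow> nat set \<Rightarrow> real.
    \<forall>u v. f (\<lambda>S. u S + v S) = (\<lambda>S. f u S + f v S)}"
  morphisms app Clif
  by (rule exI[of _ "\<lambda>u. u"]) simp

setup_lifting type_definition_clif

instantiation clif :: ring_1
begin

lift_definition zero_clif :: clif is "\<lambda>u S. 0" by simp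
lift_definition one_clif :: clif is "\<lambda>u. u" by simp
lift_definition plus_clif :: "clif \<Rightarrow> clif \<Rightarrow> clif" is "\<lambda>f g u S. f u S + g u S"
  by (simp add: algebra_simps)
lift_definition uminus_clif :: "clif \<Rightarrow> clif" is "\<lambda>f u S. - f u S" by simp
lift_definition minus_clif :: "clif \<Rightarrow> clif \<Rightarrow> clif" is "\<lambda>f g u S. f u S - g u S"
  by (simp add: algebra_simps)
lift_definition times_clif :: "clif \<Rightarrow> clif \<Rightarrow> clif" is "\<lambda>f g u. f (g u)" by simp

instance
proof
  show "(0::clif) \<noteq> 1"
    by transfer (auto simp: fun_eq_iff intro!: exI[of _ "\<lambda>S. 1"])
qed (transfer; auto simp: algebra_simps fun_eq_iff)+

end

text \<open>Clifford multiplication on an exterior algebra, with basis vectors indexed by sets.\<close>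

lift_definition cg :: "nat \<Rightarrow> clif" is
  "\<lambda>i u S. (- 1) ^ card {j \<in> S. j \<le> i} * u (sym_diff S {i})"
  by (simp add: algebra_simps)

lift_definition sqrt_half :: clif is "\<lambda>u S. (1 / sqrt 2) * u S"
  by (simp add: add_divide_distrib)

text \<open>The weak inequality in the sign of \<open>cg\<close> is what matters:
  \<open>i \<le> i\<close> always holds, which gives the square -1, and for
  \<open>i \<noteq> j\<close> exactly one of \<open>i \<le> j\<close> and \<open>j \<le> i\<close>
  holds, which gives anticommutation.\<close>

lemma card_toggle:
  fixes i j :: nat
  shows "(- 1 :: real) ^ card {l \<in> sym_diff S {i}. l \<le> j}
    = (if i \<le> j then - 1 else 1) * (- 1) ^ card {l \<in> S. l \<le> j}"
proof -
  have fin: "finite {l \<in> S. l \<le> j}" for S by (rule finite_subset[of _ "{..j}"]) auto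
  consider "i > j" | "i \<le> j" "i \<in> S" | "i \<le> j" "i \<notin> S" by linarith
  then show ?thesis
  proof cases
    case 1
    then have "{l \<in> sym_diff S {i}. l \<le> j} = {l \<in> S. l \<le> j}" by auto
    then show ?thesis using 1 by simp
  next
    case 2
    then have eq: "{l \<in> S. l \<le> j} = insert i {l \<in> sym_diff S {i}. l \<le> j}" by auto
    have "card {l \<in> S. l \<le> j} = Suc (card {l \<in> sym_diff S {i}. l \<le> j})"
      unfolding eq by (rule card_insert_disjoint) (use fin 2 in auto)
    then show ?thesis using 2 by simp
  next
    case 3
    then have eq: "{l \<in> sym_diff S {i}. l \<le> j} = insert i {l \<in> S. l \<le> j}" by auto
    have "card {l \<in> sym_diff S {i}. l \<le> j} = Suc (card {l \<in> S. l \<le> j})"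
      unfolding eq by (rule card_insert_disjoint) (use fin 3 in auto)
    then show ?thesis using 3 by simp
  qed
qed

lemma cg_square: "cg i * cg i = - 1"
proof transfer
  fix i :: nat
  have "sym_diff (sym_diff S {i}) {i} = S" for S :: "nat set" by auto
  then show "(\<lambda>u S. (- 1) ^ card {j \<in> S. j \<le> i} *
      ((- 1) ^ card {j \<in> sym_diff S {i}. j \<le> i} * u (sym_diff (sym_diff S {i}) {i})))
    = (\<lambda>(u::nat set \<Rightarrow> real) S. - u S)"
    unfolding card_toggle by (simp add: fun_eq_iff flip: power_mult_distrib mult.assoc)
qed

lemma cg_anticommute:
  assumes "i \<noteq> j"
  shows "cg i * cg j = - (cg j * cg i)"
  using assms
proof transfer
  fix i j :: nat
  assume "i \<noteq> j"
  moreover have "sym_diff (sym_diff S {i}) {j} = sym_diff (sym_diff S {j}) {i}" for S :: "nat set" by auto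
  ultimately show "(\<lambda>u S. (- 1) ^ card {k \<in> S. k \<le> i} *
      ((- 1) ^ card {k \<in> sym_diff S {i}. k \<le> j} * u (sym_diff (sym_diff S {i}) {j})))
    = (\<lambda>(u::nat set \<Rightarrow> real) S. - ((- 1) ^ card {k \<in> S. k \<le> j} *
      ((- 1) ^ card {k \<in> sym_diff S {j}. k \<le> i} * u (sym_diff (sym_diff S {j}) {i}))))"
    unfolding card_toggle by (auto simp: fun_eq_iff)
qed

lemma sqrt_half_central: "sqrt_half * cg i = cg i * sqrt_half"
  by transfer (simp add: fun_eq_iff)

lemma sqrt_half_square: "sqrt_half * sqrt_half + sqrt_half * sqrt_half = 1"
  by transfer (auto simp: fun_eq_iff field_simps)

text \<open>The square of \<open>sqrt_half\<close> is one half, so there is no 2-torsion. This is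
  what separates 1 from -1, and hence the identity of the cover from z.\<close>

lemma clif_double: 
  fixes a :: clif
  assumes "a = - a"
  shows "a = 0"
proof -
  have "a + a = 0" using assms by (metis add.right_inverse)
  have "a = (sqrt_half * sqrt_half + sqrt_half * sqrt_half) * a" by (simp add: sqrt_half_square)
  also have "\<dots> = sqrt_half * sqrt_half * (a + a)" by (simp add: algebra_simps)
  finally show ?thesis using \<open>a + a = 0\<close> by simp
qed

text \<open>A normalised root vector, oriented so that \<open>rtv i j\<close> is the image of the
  cycle \<open>[i, j]\<close>. In this notation \<open>t_i\<close> is \<open>rtv (Suc i) i\<close>
  and \<open>x_i\<close> is \<open>rtv (n + 1) i\<close>.\<close>

definition rtv :: "nat \<Rightarrow> nat \<Rightarrow> clif" where
  "rtv i j = sqrt_half * (cg j - cg i)"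

lemma rtv_swap: "rtv j i = - rtv i j"
  by (simp add: rtv_def algebra_simps)

lemma rtv_sqrt_half: "rtv i j * sqrt_half = sqrt_half * rtv i j"
proof -
  have "(cg j - cg i) * sqrt_half = sqrt_half * (cg j - cg i)"
    by (simp add: left_diff_distrib right_diff_distrib sqrt_half_central)
  then show ?thesis by (simp add: rtv_def mult.assoc)
qed

lemma rtv_square:
  assumes "i \<noteq> j"
  shows "rtv i j * rtv i j = - 1"
proof -
  have "(cg j - cg i) * sqrt_half = sqrt_half * (cg j - cg i)"
    by (simp add: left_diff_distrib right_diff_distrib sqrt_half_central)
  then have "rtv i j * rtv i j = sqrt_half * sqrt_half * ((cg j - cg i) * (cg j - cg i))"
    unfolding rtv_def by (metis mult.assoc)
  also have "(cg j - cg i) * (cg j - cg i) = - 1 - 1"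
    using cg_anticommute[OF assms] by (simp add: algebra_simps cg_square)
  also have "sqrt_half * sqrt_half * (- 1 - 1) = - 1"
    using arg_cong[OF sqrt_half_square, of uminus] by (simp only: right_diff_distrib) simp
  finally show ?thesis .
qed

text \<open>Conjugation by a unit vector is minus the reflection in it, and the reflection in the
  difference of two generators exchanges these two.\<close>

lemma rtv_cg: "rtv i j * cg k = - cg (transpose i j k) * rtv i j"
proof -
  have *: "(cg j - cg i) * cg k = - cg (transpose i j k) * (cg j - cg i)"
    by (cases "k = i"; cases "k = j")
      (auto simp: algebra_simps cg_square transpose_def cg_anticommute[of j k] cg_anticommute[of i k])
  have "rtv i j * cg k = sqrt_half * ((cg j - cg i) * cg k)"
    by (simp add: rtv_def mult.assoc)
  also have "\<dots> = - ((sqrt_half * cg (transpose i j k)) * (cg j - cg i))"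
    by (simp add: * mult.assoc)
  also have "\<dots> = - cg (transpose i j k) * rtv i j"
    by (simp add: sqrt_half_central rtv_def mult.assoc)
  finally show ?thesis .
qed

text \<open>\<open>g\<close> lies over \<open>\<sigma>\<close>: conjugation by \<open>g\<close> permutes the generators, up to the sign \<open>s\<close> of \<open>\<sigma>\<close>.\<close>

definition lifts :: "clif \<Rightarrow> clif \<Rightarrow> (nat \<Rightarrow> nat) \<Rightarrow> bool" where
  "lifts g s \<sigma> \<longleftrightarrow> (s = 1 \<or> s = - 1) \<and> (\<exists>h. g * h = 1 \<and> h * g = 1) \<and> g * sqrt_half = sqrt_half * g \<and> (\<forall>k. g * cg k = s * cg (\<sigma> k) * g)"

lemma lifts_one: "lifts 1 1 id"
  by (auto simp: lifts_def)

lemma sign_central: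
  fixes s :: "'a::ring_1"
  assumes "s = 1 \<or> s = - 1"
  shows "a * s = s * a"
  using assms by auto

lemma lifts_sign: "lifts g s \<sigma> \<Longrightarrow> s = 1 \<or> s = - 1"
  by (simp add: lifts_def)

lemma lifts_mult:
  assumes "lifts g s \<sigma>" "lifts h s' \<tau>"
  shows "lifts (g * h) (s * s') (\<sigma> \<circ> \<tau>)"
proof -
  obtain g' h' where "g * g' = 1" "g' * g = 1" "h * h' = 1" "h' * h = 1"
    using assms by (auto simp: lifts_def)
  then have "g * (h * h') * g' = 1" "h' * (g' * g) * h = 1" by simp_all
  then have "(g * h) * (h' * g') = 1" "(h' * g') * (g * h) = 1" by (simp_all only: mult.assoc)
  moreover have "g * h * cg k = s * s' * cg (\<sigma> (\<tau> k)) * (g * h)" for k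
  proof -
    have "g * h * cg k = g * (s' * cg (\<tau> k) * h)"
      using assms(2) by (simp add: lifts_def mult.assoc)
    also have "\<dots> = (g * s') * (cg (\<tau> k) * h)"
      by (simp only: mult.assoc)
    also have "\<dots> = s' * (g * cg (\<tau> k)) * h"
      by (simp only: sign_central[OF lifts_sign[OF assms(2)], of g] mult.assoc)
    also have "\<dots> = s' * (s * cg (\<sigma> (\<tau> k)) * g) * h"
      using assms(1) by (simp add: lifts_def)
    also have "\<dots> = (s' * s) * cg (\<sigma> (\<tau> k)) * (g * h)"
      by (simp only: mult.assoc)
    finally show ?thesis
      by (simp only: sign_central[OF lifts_sign[OF assms(2)], of s])
  qed
  moreover have "g * h * sqrt_half = sqrt_half * (g * h)"
    using assms by (metis lifts_def mult.assoc)
  moreover have "s * s' = 1 \<or> s * s' = - 1"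
    using assms by (auto simp: lifts_def)
  ultimately show ?thesis unfolding lifts_def comp_def by blast
qed

lemma lifts_uminus: "lifts g s \<sigma> \<Longrightarrow> lifts (- g) s \<sigma>"
  unfolding lifts_def by (metis minus_mult_minus minus_mult_left minus_mult_right)

lemma lifts_rtv: "i \<noteq> j \<Longrightarrow> lifts (rtv i j) (- 1) (transpose i j)"
  unfolding lifts_def
  using rtv_square[of i j] rtv_cg[of i j] rtv_sqrt_half[of i j]
  by (auto intro!: exI[of _ "- rtv i j"])

lemma lifts_inverse_cancel: "lifts g s \<sigma> \<Longrightarrow> a * g = b * g \<Longrightarrow> a = b"
  unfolding lifts_def by (metis mult.assoc mult_1_right)

text \<open>This rule replaces calculation with generators: nearly all later identities between
  products of root vectors are instances of it with \<open>g\<close> a root vector, a cycle, or a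
  product of cycles.\<close>

lemma lifts_rtv_conj:
  assumes "lifts g s \<sigma>"
  shows "g * rtv i j = s * rtv (\<sigma> i) (\<sigma> j) * g"
proof -
  have ghs: "g * sqrt_half = sqrt_half * g" and gcg: "g * cg k = s * cg (\<sigma> k) * g" for k
    using assms by (auto simp: lifts_def)
  have "g * rtv i j = (g * sqrt_half) * (cg j - cg i)"
    by (simp add: rtv_def mult.assoc)
  also have "\<dots> = sqrt_half * (g * cg j - g * cg i)"
    by (simp add: ghs mult.assoc right_diff_distrib)
  also have "\<dots> = (sqrt_half * s) * ((cg (\<sigma> j) - cg (\<sigma> i)) * g)"
    by (simp add: gcg mult.assoc right_diff_distrib left_diff_distrib)
  also have "sqrt_half * s = s * sqrt_half"
    by (rule sign_central[OF lifts_sign[OF assms]])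
  also have "s * sqrt_half * ((cg (\<sigma> j) - cg (\<sigma> i)) * g) = s * rtv (\<sigma> i) (\<sigma> j) * g"
    by (simp add: rtv_def mult.assoc)
  finally show ?thesis .
qed

text \<open>Generators that agree up to sign would commute; being invertible and anticommuting, they
  cannot.\<close>

lemma cg_neq:
  assumes "i \<noteq> j"
  shows "cg i \<noteq> cg j" "cg i \<noteq> - cg j"
proof -
  have "cg i * cg j \<noteq> cg j * cg i"
  proof
    assume "cg i * cg j = cg j * cg i"
    then have "cg i * cg j = 0"
      using cg_anticommute[OF assms] clif_double by metis
    then have "(cg i * cg i) * (cg j * cg j) = 0" by (metis mult.assoc mult_zero_left mult_zero_right)
    then show False by (simp add: cg_square)
  qed
  then show "cg i \<noteq> cg j" "cg i \<noteq> - cg j" by auto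
qed

text \<open>Cancelling the invertible \<open>g\<close> leaves equations between signed generators,
  and these are all different. So permutation and sign are functions of the element alone.\<close>

lemma lifts_unique:
  assumes "lifts g s \<sigma>" "lifts g s' \<tau>"
  shows "\<sigma> = \<tau>" "s = s'"
proof -
  have eq: "s * cg (\<sigma> k) = s' * cg (\<tau> k)" for k
    using assms lifts_inverse_cancel[OF assms(1), of "s * cg (\<sigma> k)" "s' * cg (\<tau> k)"]
    by (simp add: lifts_def)
  have cgn: "cg k \<noteq> - cg k" for k
    using clif_double[of "cg k"] cg_square[of k] by auto
  show "\<sigma> = \<tau>"
  proof
    fix k show "\<sigma> k = \<tau> k"
      using eq[of k] cg_neq[of "\<sigma> k" "\<tau> k"] lifts_sign[OF assms(1)] lifts_sign[OF assms(2)]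
      by (metis minus_minus mult_1_left mult_minus_left)
  qed
  then show "s = s'"
    using eq[of 0] cgn[of "\<tau> 0"] lifts_sign[OF assms(1)] lifts_sign[OF assms(2)]
    by (metis mult_1_left mult_minus_left)
qed

text \<open>Both sides are equal to \<open>rtv i k\<close>.\<close>

lemma rtv_braid:
  assumes "i \<noteq> j" "j \<noteq> k" "i \<noteq> k"
  shows "rtv i j * rtv j k * rtv i j = rtv j k * rtv i j * rtv j k"
proof -
  have 1: "rtv i j * rtv j k = - rtv i k * rtv i j"
    using lifts_rtv_conj[OF lifts_rtv[OF assms(1)], of j k] assms by (simp add: transpose_def)
  have 2: "rtv j k * rtv i j = - rtv i k * rtv j k"
    using lifts_rtv_conj[OF lifts_rtv[OF assms(2)], of i j] assms by (simp add: transpose_def)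
  show ?thesis unfolding 1 2
    using rtv_square[OF assms(1)] rtv_square[OF assms(2)] by (simp add: mult.assoc)
qed

lemma rtv_disjoint:
  assumes "{i, j} \<inter> {k, l} = {}" "i \<noteq> j"
  shows "rtv i j * rtv k l = - (rtv k l * rtv i j)"
  using lifts_rtv_conj[OF lifts_rtv[OF assms(2)], of k l] assms by (auto simp: transpose_def)


section \<open>Presented groups and Coxeter's relations\<close>

lemma words_Nil [simp]: "[] \<in> words S"
  and words_Cons [simp]: "x # w \<in> words S \<longleftrightarrow> fst x \<in> S \<and> w \<in> words S"
  and words_append [simp]: "u @ v \<in> words S \<longleftrightarrow> u \<in> words S \<and> v \<in> words S"
  by (cases x; auto simp: words_def)+

lemma word_step_context:
  assumes "word_step S R u v" "a \<in> words S" "b \<in> words S"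
  shows "word_step S R (a @ u @ b) (a @ v @ b)"
  using assms(1)
proof cases
  case (cancel a' b' s e)
  then show ?thesis
    using word_step.cancel[of "a @ a'" S "b' @ b" s R e] assms(2,3) by simp
next
  case (relation a' b' u' v')
  then show ?thesis
    using word_step.relation[of "a @ a'" S "b' @ b" u' v' R] assms(2,3) by simp
qed

lemma word_rel_context:
  assumes "(u, v) \<in> word_rel S R" "a \<in> words S" "b \<in> words S"
  shows "(a @ u @ b, a @ v @ b) \<in> word_rel S R"
proof -
  have "equivclp (word_step S R) u v" using assms by (simp add: word_rel_def)
  then have "equivclp (word_step S R) (a @ u @ b) (a @ v @ b)"
  proof (induction rule: equivclp_induct)
    case (step y z)
    then have "word_step S R (a @ y @ b) (a @ z @ b) \<or> word_step S R (a @ z @ b) (a @ y @ b)"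
      using word_step_context assms by blast
    then show ?case using step.IH by (metis equivclp_into_equivclp)
  qed simp
  then show ?thesis using assms by (simp add: word_rel_def)
qed

lemma equiv_word_rel: "equiv (words S) (word_rel S R)"
  by (rule equivI)
    (auto simp: word_rel_def refl_on_def sym_def trans_def intro: equivclp_sym equivclp_trans)

lemma word_rel_append:
  assumes "(u, u') \<in> word_rel S R" "(v, v') \<in> word_rel S R"
  shows "(u @ v, u' @ v') \<in> word_rel S R"
proof -
  have "u \<in> words S" "u' \<in> words S" "v \<in> words S" "v' \<in> words S" using assms by (auto simp: word_rel_def)
  then have "(u @ v, u' @ v) \<in> word_rel S R" "(u' @ v, u' @ v') \<in> word_rel S R"
    using word_rel_context[OF assms(1), of "[]" v] word_rel_context[OF assms(2), of u' "[]"] by simp_all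
  then show ?thesis using equiv_word_rel[of S R] by (meson equivE transE)
qed

abbreviation word_class :: "'s set \<Rightarrow> ('s word \<times> 's word) set \<Rightarrow> 's word \<Rightarrow> 's word set" where
  "word_class S R w \<equiv> word_rel S R `` {w}"

lemma word_class_eq_iff:
  "u \<in> words S \<Longrightarrow> v \<in> words S \<Longrightarrow> word_class S R u = word_class S R v \<longleftrightarrow> (u, v) \<in> word_rel S R"
  using equiv_word_rel eq_equiv_class_iff by fastforce

lemma word_class_mult:
  assumes "u \<in> words S" "v \<in> words S"
  shows "word_class S R u \<otimes>\<^bsub>presented_group S R\<^esub> word_class S R v = word_class S R (u @ v)"
proof -
  have uv: "(u, u) \<in> word_rel S R" "(v, v) \<in> word_rel S R"
    using assms by (auto simp: word_rel_def)
  have "(u @ v, w) \<in> word_rel S R" if "(u, u') \<in> word_rel S R" "(v, v') \<in> word_rel S R"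
    "(u' @ v', w) \<in> word_rel S R" for u' v' w
    using that word_rel_append[OF that(1,2)] equiv_word_rel[of S R] by (meson equivE transE)
  then have "word_rel S R `` {u' @ v' |u' v'. u' \<in> word_class S R u \<and> v' \<in> word_class S R v}
    = word_class S R (u @ v)"
    using uv by auto
  then show ?thesis by (simp add: presented_group_def)
qed

lemma carrier_presented_group: "carrier (presented_group S R) = word_class S R ` words S"
  by (auto simp: presented_group_def quotient_def)

lemma one_presented_group: "\<one>\<^bsub>presented_group S R\<^esub> = word_class S R []"
  by (simp add: presented_group_def)

lemma word_inverse:
  assumes "w \<in> words S"
  shows "\<exists>w'\<in>words S. (w' @ w, []) \<in> word_rel S R"
  using assms
proof (induction w)
  case Nil
  then show ?case by (auto simp: word_rel_def intro!: bexI[of _ "[]"])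
next
  case (Cons x w)
  obtain s e where x: "x = (s, e)" by fastforce
  then obtain w' where w': "w' \<in> words S" "(w' @ w, []) \<in> word_rel S R" using Cons by auto
  have "word_step S R (w' @ [(s, \<not> e), (s, \<not> \<not> e)] @ w) (w' @ w)"
    using Cons.prems x w' by (intro word_step.cancel) auto
  then have "(w' @ [(s, \<not> e)] @ x # w, w' @ w) \<in> word_rel S R"
    using Cons.prems x w' by (auto simp: word_rel_def)
  then have "((w' @ [(s, \<not> e)]) @ x # w, []) \<in> word_rel S R"
    using w'(2) equiv_word_rel[of S R] by (simp, meson equivE transE)
  then show ?case using w' Cons.prems x by (intro bexI[of _ "w' @ [(s, \<not> e)]"]) auto
qed

lemma group_presented_group: "group (presented_group S R)"
proof (rule groupI)
  fix x assume "x \<in> carrier (presented_group S R)"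
  then obtain w where w: "w \<in> words S" "x = word_class S R w" by (auto simp: carrier_presented_group)
  obtain w' where w': "w' \<in> words S" "(w' @ w, []) \<in> word_rel S R" using word_inverse[OF w(1)] by blast
  then have "word_class S R w' \<otimes>\<^bsub>presented_group S R\<^esub> x = \<one>\<^bsub>presented_group S R\<^esub>"
    using w by (simp add: word_class_mult one_presented_group word_class_eq_iff)
  then show "\<exists>y\<in>carrier (presented_group S R). y \<otimes>\<^bsub>presented_group S R\<^esub> x = \<one>\<^bsub>presented_group S R\<^esub>"
    using w' by (auto simp: carrier_presented_group)
qed (auto simp: carrier_presented_group word_class_mult one_presented_group)

lemma word_rel_relation:
  "(u, v) \<in> R \<Longrightarrow> u \<in> words S \<Longrightarrow> v \<in> words S \<Longrightarrow> (u, v) \<in> word_rel S R"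
  using word_step.relation[of "[]" S "[]" u v R] by (auto simp: word_rel_def)

lemma word_rel_cancel: "s \<in> S \<Longrightarrow> ([(s, e), (s, \<not> e)], []) \<in> word_rel S R"
  using word_step.cancel[of "[]" S "[]" s R e] by (auto simp: word_rel_def)

section \<open>Coxeter's presentation of the symmetric group\<close>

inductive coxeter :: "nat \<Rightarrow> nat list \<Rightarrow> nat list \<Rightarrow> bool" for n where
  reflexive: "set a \<subseteq> {1..<n} \<Longrightarrow> coxeter n a a"
| symmetric: "coxeter n a b \<Longrightarrow> coxeter n b a"
| transitive: "coxeter n a b \<Longrightarrow> coxeter n b c \<Longrightarrow> coxeter n a c"
| square: "set (a @ [i] @ b) \<subseteq> {1..<n} \<Longrightarrow> coxeter n (a @ [i, i] @ b) (a @ b)"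
| braid: "set (a @ [i, Suc i] @ b) \<subseteq> {1..<n} \<Longrightarrow>
    coxeter n (a @ [i, Suc i, i] @ b) (a @ [Suc i, i, Suc i] @ b)"
| commute: "set (a @ [i, j] @ b) \<subseteq> {1..<n} \<Longrightarrow> Suc i < j \<Longrightarrow>
    coxeter n (a @ [i, j] @ b) (a @ [j, i] @ b)"

declare coxeter.transitive [trans]

lemma coxeter_context:
  "coxeter n u v \<Longrightarrow> set a \<subseteq> {1..<n} \<Longrightarrow> set b \<subseteq> {1..<n} \<Longrightarrow> coxeter n (a @ u @ b) (a @ v @ b)"
proof (induction rule: coxeter.induct)
  case (square a' i b')
  then show ?case using coxeter.square[of "a @ a'" i "b' @ b"] by simp
next
  case (braid a' i b')
  then show ?case using coxeter.braid[of "a @ a'" i "b' @ b"] by simp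
next
  case (commute a' i j b')
  then show ?case using coxeter.commute[of "a @ a'" i j "b' @ b"] by simp
next
  case (reflexive a')
  then show ?case by (intro coxeter.reflexive) auto
qed (auto intro: coxeter.symmetric coxeter.transitive)

lemma coxeter_mono: "coxeter k u v \<Longrightarrow> k \<le> n \<Longrightarrow> coxeter n u v"
proof (induction rule: coxeter.induct)
  case (reflexive a) then show ?case by (intro coxeter.reflexive) auto
next
  case (symmetric a b) then show ?case by (auto intro: coxeter.symmetric)
next
  case (transitive a b c) then show ?case by (auto intro: coxeter.transitive)
next
  case (square a i b) then show ?case by (intro coxeter.square) auto
next
  case (braid a i b) then show ?case by (intro coxeter.braid) auto
next
  case (commute a i j b) then show ?case by (intro coxeter.commute) auto
qed

fun simple_perm :: "nat list \<Rightarrow> nat \<Rightarrow> nat" where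
  "simple_perm [] = id"
| "simple_perm (i # w) = transpose (Suc i) i \<circ> simple_perm w"

lemma simple_perm_append: "simple_perm (u @ v) = simple_perm u \<circ> simple_perm v"
  by (induction u) (simp_all add: comp_assoc)

lemma coxeter_simple_perm: "coxeter n u v \<Longrightarrow> simple_perm u = simple_perm v"
proof (induction rule: coxeter.induct)
  case (square a i b) 
  have "simple_perm [i, i] = id" by (auto simp: transpose_def)
  then show ?case by (simp only: simple_perm_append) simp
next
  case (braid a i b)
  have "simple_perm [i, Suc i, i] = simple_perm [Suc i, i, Suc i]" by (auto simp: transpose_def)
  then show ?case by (simp only: simple_perm_append)
next
  case (commute a i j b)
  then have "simple_perm [i, j] = simple_perm [j, i]" by (auto simp: transpose_def)
  then show ?case by (simp only: simple_perm_append)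
qed auto

lemma simple_perm_fixes: "set w \<subseteq> {1..<n} \<Longrightarrow> j \<notin> {1..n} \<Longrightarrow> simple_perm w j = j"
  by (induction w) (auto simp: transpose_def)

lemma coxeter_move_left:
  assumes "\<forall>m\<in>set w. Suc i < m \<or> Suc m < i" "set w \<subseteq> {1..<n}" "i \<in> {1..<n}"
  shows "coxeter n (w @ [i]) (i # w)"
  using assms
proof (induction w)
  case Nil
  then show ?case by (auto intro: coxeter.reflexive)
next
  case (Cons m w)
  have "coxeter n ([m] @ (w @ [i]) @ []) ([m] @ (i # w) @ [])"
    using Cons by (intro coxeter_context) auto
  also have "coxeter n ([m] @ (i # w) @ []) (i # m # w)"
  proof (cases "Suc i < m")
    case True
    then show ?thesis using coxeter.symmetric[OF coxeter.commute[of "[]" i m w n]] Cons.prems by simp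
  next
    case False
    then show ?thesis using coxeter.commute[of "[]" m i w n] Cons.prems by simp
  qed
  finally show ?case by simp
qed

text \<open>The words \<open>rev [j..<Suc k]\<close>, that is \<open>k, k - 1, ..., j\<close>,
  represent the right cosets of the subgroup without the letter \<open>k\<close>. A further letter
  \<open>i\<close> shortens the representative if \<open>i = j\<close>, prolongs it if
  \<open>Suc i = j\<close>, and commutes past it if it is smaller still. If \<open>j < i\<close>, it
  moves left up to the pair \<open>i, i - 1\<close>, where the braid relation turns it into
  \<open>i - 1\<close>, which then commutes with everything further left.\<close>

lemma coxeter_coset_step:
  assumes "1 \<le> j" "j \<le> Suc k" "1 \<le> i" "i \<le> k"
  shows "\<exists>w j'. set w \<subseteq> {1..<k} \<and> 1 \<le> j' \<and> j' \<le> Suc k \<and>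
    coxeter (Suc k) (rev [j..<Suc k] @ [i]) (w @ rev [j'..<Suc k])"
proof -
  consider "i = j" | "Suc i = j" | "Suc i < j" | "j < i" by linarith
  then show ?thesis
  proof cases
    case 1
    then have "rev [j..<Suc k] @ [i] = rev [Suc j..<Suc k] @ [i, i] @ []"
      using assms by (simp add: upt_conv_Cons del: upt_Suc)
    then have "coxeter (Suc k) (rev [j..<Suc k] @ [i]) (rev [Suc j..<Suc k])"
      using coxeter.square[of "rev [Suc j..<Suc k]" i "[]" "Suc k"] assms by (simp del: upt_Suc)
    then show ?thesis using 1 assms by (intro exI[of _ "[]"] exI[of _ "Suc j"]) auto
  next
    case 2
    then have "rev [j..<Suc k] @ [i] = rev [i..<Suc k]"
      using assms by (simp add: upt_conv_Cons del: upt_Suc)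
    moreover have "set (rev [i..<Suc k]) \<subseteq> {1..<Suc k}" using assms by auto
    ultimately show ?thesis using assms coxeter.reflexive
      by (intro exI[of _ "[]"] exI[of _ i]) (auto simp del: upt_Suc)
  next
    case 3
    then have "coxeter (Suc k) (rev [j..<Suc k] @ [i]) (i # rev [j..<Suc k])"
      using assms by (intro coxeter_move_left) (auto simp del: upt_Suc)
    then show ?thesis using assms 3 by (intro exI[of _ "[i]"] exI[of _ j]) (auto simp del: upt_Suc)
  next
    case 4
    then obtain h where h: "i = Suc h" "j \<le> h" by (cases i) auto
    define A B where "A = rev [Suc i..<Suc k]" and "B = rev [j..<h]"
    have AB: "set A \<subseteq> {Suc i..k}" "set B \<subseteq> {j..<h}" by (auto simp: A_def B_def)
    have "[j..<Suc k] = [j..<h] @ [h..<Suc k]"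
      using upt_add_eq_append[of j h "Suc k - h"] h assms by (simp del: upt_Suc)
    also have "[h..<Suc k] = h # i # [Suc i..<Suc k]"
      using h assms by (simp add: upt_conv_Cons del: upt_Suc)
    finally have split: "rev [j..<Suc k] = A @ [i, h] @ B" by (simp add: A_def B_def del: upt_Suc)
    have range: "set (A @ [i, h, i] @ B) \<subseteq> {1..<Suc k}"
      using AB h assms by auto
    have "coxeter (Suc k) (B @ [i]) (i # B)"
      using AB h assms by (intro coxeter_move_left) auto
    then have "coxeter (Suc k) ((A @ [i, h]) @ (B @ [i]) @ []) ((A @ [i, h]) @ (i # B) @ [])"
      using range by (intro coxeter_context) auto
    also have "coxeter (Suc k) ((A @ [i, h]) @ (i # B) @ []) (A @ [h, i, h] @ B)"
      using coxeter.symmetric[OF coxeter.braid[of A h B "Suc k"]] range h by simp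
    also have "coxeter (Suc k) (A @ [h, i, h] @ B) (h # A @ [i, h] @ B)"
    proof -
      have "coxeter (Suc k) (A @ [h]) (h # A)"
        using AB h assms by (intro coxeter_move_left) auto
      then have "coxeter (Suc k) ([] @ (A @ [h]) @ ([i, h] @ B)) ([] @ (h # A) @ ([i, h] @ B))"
        using range by (intro coxeter_context) auto
      then show ?thesis by simp
    qed
    finally have "coxeter (Suc k) (rev [j..<Suc k] @ [i]) ([h] @ rev [j..<Suc k])"
      by (simp only: split append.simps append.assoc append_Nil2)
    then show ?thesis using assms h by (intro exI[of _ "[h]"] exI[of _ j]) (auto simp del: upt_Suc)
  qed
qed

lemma coxeter_coset:
  assumes "set w \<subseteq> {1..<Suc k}"
  shows "\<exists>u j. set u \<subseteq> {1..<k} \<and> 1 \<le> j \<and> j \<le> Suc k \<and> coxeter (Suc k) w (u @ rev [j..<Suc k])"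
  using assms
proof (induction w rule: rev_induct)
  case Nil
  then show ?case by (intro exI[of _ "[]"] exI[of _ "Suc k"]) (auto intro: coxeter.reflexive)
next
  case (snoc i w)
  then obtain u j where u: "set u \<subseteq> {1..<k}" "1 \<le> j" "j \<le> Suc k"
    "coxeter (Suc k) w (u @ rev [j..<Suc k])" by auto
  obtain v j' where v: "set v \<subseteq> {1..<k}" "1 \<le> j'" "j' \<le> Suc k"
    "coxeter (Suc k) (rev [j..<Suc k] @ [i]) (v @ rev [j'..<Suc k])"
    using coxeter_coset_step[of j k i] u snoc.prems by auto
  have uk: "set u \<subseteq> {1..<Suc k}" using u by auto
  have "coxeter (Suc k) ([] @ w @ [i]) ([] @ (u @ rev [j..<Suc k]) @ [i])"
    using snoc.prems u by (intro coxeter_context) auto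
  also have "coxeter (Suc k) ([] @ (u @ rev [j..<Suc k]) @ [i]) (u @ (v @ rev [j'..<Suc k]) @ [])"
    using coxeter_context[OF v(4), of u "[]"] uk by simp
  finally show ?case using u v by (intro exI[of _ "u @ v"] exI[of _ j']) auto
qed

lemma simple_perm_descending:
  assumes "1 \<le> j" "j \<le> k"
  shows "simple_perm (rev [j..<k]) j = k"
  using assms(2)
proof (induction k rule: dec_induct)
  case (step m)
  then show ?case by (simp add: transpose_def)
qed simp

text \<open>By enumeration of the cosets of the subgroup generated by all but the last generator.\<close>

theorem coxeter_complete:
  "set w \<subseteq> {1..<n} \<Longrightarrow> simple_perm w = id \<Longrightarrow> coxeter n w []"
proof (induction n arbitrary: w)
  case 0
  then show ?case by (auto intro: coxeter.reflexive)
next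
  case (Suc n)
  show ?case
  proof (cases n)
    case 0
    then show ?thesis using Suc.prems by (auto intro: coxeter.reflexive)
  next
    case (Suc k)
    then obtain u j where u: "set u \<subseteq> {1..<n}" "1 \<le> j" "j \<le> Suc n"
      and w: "coxeter (Suc n) w (u @ rev [j..<Suc n])"
      using coxeter_coset[of w n] Suc.prems by auto
    \<comment> \<open>The representative sends \<open>j\<close> to \<open>Suc n\<close>, which
      \<open>u\<close> fixes. As the whole word is the identity, \<open>j = Suc n\<close> and the
      representative is empty.\<close>
    have "simple_perm u (simple_perm (rev [j..<Suc n]) j) = j"
      using coxeter_simple_perm[OF w] Suc.prems by (simp add: simple_perm_append fun_eq_iff del: upt_Suc)
    then have "simple_perm u (Suc n) = j"
      using simple_perm_descending[OF u(2,3)] by simp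
    then have j: "j = Suc n" using simple_perm_fixes[OF u(1), of "Suc n"] by simp
    then have wu: "coxeter (Suc n) w u" using w by simp
    then have "simple_perm u = id" using coxeter_simple_perm Suc.prems by metis
    then have "coxeter n u []" using Suc.IH u by simp
    then show ?thesis using wu coxeter_mono coxeter.transitive le_SucI order_refl by metis
  qed
qed


section \<open>The double cover inside the Clifford algebra\<close>

fun ev_letter :: "gen \<times> bool \<Rightarrow> clif" where
  "ev_letter (T i, b) = (if b then rtv (Suc i) i else - rtv (Suc i) i)"
| "ev_letter (Z, b) = - 1"

definition ev :: "gen word \<Rightarrow> clif" where
  "ev w = prod_list (map ev_letter w)"

lemma ev_simps [simp]:
  "ev [] = 1" "ev (x # w) = ev_letter x * ev w" "ev (u @ v) = ev u * ev v"
  by (simp_all add: ev_def)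

definition simple_word :: "nat list \<Rightarrow> gen word" where
  "simple_word is = map (\<lambda>i. (T i, True)) is"

lemma simple_word_simps [simp]:
  "simple_word [] = []" "simple_word (i # is) = (T i, True) # simple_word is"
  "simple_word (u @ v) = simple_word u @ simple_word v"
  by (simp_all add: simple_word_def)

lemma simple_word_in_words [simp]:
  "simple_word is \<in> words (cover_gens n) \<longleftrightarrow> set is \<subseteq> {1..<n}"
  by (induction "is") (auto simp: cover_gens_def)

lemma Z_in_cover_gens [simp]: "Z \<in> cover_gens n"
  and T_in_cover_gens [simp]: "T i \<in> cover_gens n \<longleftrightarrow> 1 \<le> i \<and> i < n"
  by (auto simp: cover_gens_def)

lemma ev_cancel: "ev [(s, e), (s, \<not> e)] = 1"
  using rtv_square[of "Suc i" i for i] by (cases s) auto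

lemma ev_relation:
  assumes "(u, v) \<in> cover_rels n"
  shows "ev u = ev v"
proof -
  have sq: "rtv (Suc i) i * rtv (Suc i) i = - 1" for i by (simp add: rtv_square)
  have br: "rtv (Suc i) i * (rtv (Suc (Suc i)) (Suc i) * rtv (Suc i) i)
      = rtv (Suc (Suc i)) (Suc i) * (rtv (Suc i) i * rtv (Suc (Suc i)) (Suc i))" for i
    using rtv_braid[of "Suc (Suc i)" "Suc i" i] by (simp add: mult.assoc)
  have cm: "rtv (Suc j) j * rtv (Suc i) i = - (rtv (Suc i) i * rtv (Suc j) j)"
    if "Suc i < j \<or> Suc j < i" for i j
    using rtv_disjoint[of "Suc j" j "Suc i" i] that by auto
  show ?thesis
    using assms unfolding cover_rels_def Un_iff
    by (elim disjE) (auto simp: tw_def zw_def sq br intro: cm)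
qed

lemma ev_word_step: "word_step (cover_gens n) (cover_rels n) u v \<Longrightarrow> ev u = ev v"
proof (induction rule: word_step.induct)
  case (cancel a b s e)
  have "ev (a @ [(s, e), (s, \<not> e)] @ b) = ev a * (ev [(s, e), (s, \<not> e)] * ev b)"
    by (simp only: ev_simps(3))
  then show ?case by (simp only: ev_cancel) simp
next
  case (relation a b u v)
  then show ?case by (simp add: ev_relation)
qed

lemma ev_word_rel: "(u, v) \<in> word_rel (cover_gens n) (cover_rels n) \<Longrightarrow> ev u = ev v"
proof -
  assume "(u, v) \<in> word_rel (cover_gens n) (cover_rels n)"
  then have "equivclp (word_step (cover_gens n) (cover_rels n)) u v" by (simp add: word_rel_def)
  then show ?thesis
    by (induction rule: equivclp_induct) (auto dest: ev_word_step)
qed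

lemma lifts_simple_word: "\<exists>s. lifts (ev (simple_word is)) s (simple_perm is)"
proof (induction "is")
  case Nil
  then show ?case using lifts_one by (auto simp: id_def)
next
  case (Cons i "is")
  then obtain s where "lifts (ev (simple_word is)) s (simple_perm is)" by blast
  then have "lifts (rtv (Suc i) i * ev (simple_word is)) (- 1 * s) (transpose (Suc i) i \<circ> simple_perm is)"
    by (intro lifts_mult lifts_rtv) auto
  then show ?case unfolding simple_word_simps simple_perm.simps by (auto simp del: comp_apply)
qed

lemma simple_perm_permutes: "set is \<subseteq> {1..<n} \<Longrightarrow> simple_perm is permutes {1..n}"
  by (induction "is") (auto intro!: permutes_compose permutes_swap_id permutes_id)

section \<open>Faithfulness: words of the cover up to the central element\<close>

locale spin_cover = fixes n :: nat
begin

lemma group_cover: "group (cover n)"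
  unfolding cover_def by (rule group_presented_group)

sublocale group "cover n" by (rule group_cover)

abbreviation "W \<equiv> words (cover_gens n)"
abbreviation "cl \<equiv> cover_class n"

lemma cl_eq_iff: "u \<in> W \<Longrightarrow> v \<in> W \<Longrightarrow> cl u = cl v \<longleftrightarrow> (u, v) \<in> word_rel (cover_gens n) (cover_rels n)"
  unfolding cover_class_def by (rule word_class_eq_iff)

lemma cl_mult: "u \<in> W \<Longrightarrow> v \<in> W \<Longrightarrow> cl u \<otimes>\<^bsub>cover n\<^esub> cl v = cl (u @ v)"
  unfolding cover_class_def cover_def by (rule word_class_mult)

lemma carrier_cover: "carrier (cover n) = cl ` W"
  unfolding cover_class_def cover_def by (rule carrier_presented_group)

lemma cl_closed [simp]: "u \<in> W \<Longrightarrow> cl u \<in> carrier (cover n)"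
  by (simp add: carrier_cover)

lemma cl_Nil: "cl [] = \<one>\<^bsub>cover n\<^esub>"
  unfolding cover_class_def cover_def by (rule one_presented_group [symmetric])

lemma zw_in_W [simp]: "zw \<in> W" by (simp add: zw_def)

lemma z_closed [simp]: "z_elem n \<in> carrier (cover n)"
  by (simp add: z_elem_def)

lemma cl_relation: "(u, v) \<in> cover_rels n \<Longrightarrow> u \<in> W \<Longrightarrow> v \<in> W \<Longrightarrow> cl u = cl v"
  by (simp add: cl_eq_iff word_rel_relation)

lemma z_square: "z_elem n \<otimes>\<^bsub>cover n\<^esub> z_elem n = \<one>\<^bsub>cover n\<^esub>"
  unfolding z_elem_def by (simp add: cl_mult flip: cl_Nil) (rule cl_relation; auto simp: cover_rels_def zw_def)

lemma cl_letter_inverse: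
  assumes "s \<in> cover_gens n"
  shows "cl [(s, False)] = inv\<^bsub>cover n\<^esub> cl [(s, True)]"
proof -
  have "cl [(s, False)] \<otimes>\<^bsub>cover n\<^esub> cl [(s, True)] = \<one>\<^bsub>cover n\<^esub>"
    using assms word_rel_cancel[of s "cover_gens n" False "cover_rels n"]
    by (simp add: cl_mult cl_eq_iff flip: cl_Nil)
  then show ?thesis using assms by (intro inv_equality [symmetric]) auto
qed

lemma z_commutes_letter:
  assumes "s \<in> cover_gens n"
  shows "z_elem n \<otimes>\<^bsub>cover n\<^esub> cl [(s, True)] = cl [(s, True)] \<otimes>\<^bsub>cover n\<^esub> z_elem n"
proof (cases s)
  case (T i)
  then have "cl (zw @ [(s, True)]) = cl ([(s, True)] @ zw)"
    using assms by (intro cl_relation) (auto simp: cover_rels_def tw_def)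
  then show ?thesis using assms by (simp add: z_elem_def cl_mult)
next
  case Z
  then show ?thesis by (simp add: z_elem_def zw_def)
qed

lemma z_central: "x \<in> carrier (cover n) \<Longrightarrow> z_elem n \<otimes>\<^bsub>cover n\<^esub> x = x \<otimes>\<^bsub>cover n\<^esub> z_elem n"
proof -
  have inv: "z_elem n \<otimes>\<^bsub>cover n\<^esub> inv\<^bsub>cover n\<^esub> a = inv\<^bsub>cover n\<^esub> a \<otimes>\<^bsub>cover n\<^esub> z_elem n"
    if "a \<in> carrier (cover n)" "z_elem n \<otimes>\<^bsub>cover n\<^esub> a = a \<otimes>\<^bsub>cover n\<^esub> z_elem n" for a
  proof -
    have "z_elem n \<otimes>\<^bsub>cover n\<^esub> inv\<^bsub>cover n\<^esub> a
      = inv\<^bsub>cover n\<^esub> a \<otimes>\<^bsub>cover n\<^esub> (a \<otimes>\<^bsub>cover n\<^esub> z_elem n) \<otimes>\<^bsub>cover n\<^esub> inv\<^bsub>cover n\<^esub> a"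
      using that(1) by (simp flip: m_assoc)
    also have "\<dots> = inv\<^bsub>cover n\<^esub> a \<otimes>\<^bsub>cover n\<^esub> (z_elem n \<otimes>\<^bsub>cover n\<^esub> a) \<otimes>\<^bsub>cover n\<^esub> inv\<^bsub>cover n\<^esub> a"
      by (simp only: that(2))
    also have "\<dots> = inv\<^bsub>cover n\<^esub> a \<otimes>\<^bsub>cover n\<^esub> z_elem n"
      using that(1) by (simp add: m_assoc)
    finally show ?thesis .
  qed
  have letter: "z_elem n \<otimes>\<^bsub>cover n\<^esub> cl [x] = cl [x] \<otimes>\<^bsub>cover n\<^esub> z_elem n" if x: "fst x \<in> cover_gens n" for x
  proof -
    obtain s b where "x = (s, b)" by fastforce
    then show ?thesis
      using x inv[of "cl [(s, True)]"] z_commutes_letter[of s] cl_letter_inverse[of s] by (cases b) auto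
  qed
  have "z_elem n \<otimes>\<^bsub>cover n\<^esub> cl w = cl w \<otimes>\<^bsub>cover n\<^esub> z_elem n" if "w \<in> W" for w
    using that
  proof (induction w)
    case Nil
    then show ?case by (simp add: cl_Nil)
  next
    case (Cons x w)
    then have w: "w \<in> W" "[x] \<in> W" by simp_all
    then have xw: "cl (x # w) = cl [x] \<otimes>\<^bsub>cover n\<^esub> cl w" by (simp add: cl_mult)
    show ?case
    proof -
      have x: "cl [x] \<in> carrier (cover n)" "cl w \<in> carrier (cover n)" using w by simp_all
      have "z_elem n \<otimes>\<^bsub>cover n\<^esub> (cl [x] \<otimes>\<^bsub>cover n\<^esub> cl w)
        = (z_elem n \<otimes>\<^bsub>cover n\<^esub> cl [x]) \<otimes>\<^bsub>cover n\<^esub> cl w"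
        using x by (simp add: m_assoc)
      also have "\<dots> = cl [x] \<otimes>\<^bsub>cover n\<^esub> (z_elem n \<otimes>\<^bsub>cover n\<^esub> cl w)"
        using x letter[of x] w by (simp add: m_assoc)
      also have "\<dots> = (cl [x] \<otimes>\<^bsub>cover n\<^esub> cl w) \<otimes>\<^bsub>cover n\<^esub> z_elem n"
        using x Cons.IH[OF w(1)] by (simp add: m_assoc)
      finally show ?thesis by (simp add: xw)
    qed
  qed
  then show "x \<in> carrier (cover n) \<Longrightarrow> ?thesis" by (auto simp: carrier_cover)
qed

definition sim :: "gen word set \<Rightarrow> gen word set \<Rightarrow> bool" where
  "sim x y \<longleftrightarrow> x = y \<or> x = z_elem n \<otimes>\<^bsub>cover n\<^esub> y"

lemma sim_sym: "x \<in> carrier (cover n) \<Longrightarrow> y \<in> carrier (cover n) \<Longrightarrow> sim x y \<Longrightarrow> sim y x"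
  unfolding sim_def by (metis l_one m_assoc z_closed z_square)

lemma sim_trans:
  "z \<in> carrier (cover n) \<Longrightarrow> sim x y \<Longrightarrow> sim y z \<Longrightarrow> sim x z"
  unfolding sim_def by (metis l_one m_assoc z_closed z_square)

lemma sim_context:
  assumes "a \<in> carrier (cover n)" "x \<in> carrier (cover n)" "y \<in> carrier (cover n)"
    "b \<in> carrier (cover n)" "sim x y"
  shows "sim (a \<otimes>\<^bsub>cover n\<^esub> x \<otimes>\<^bsub>cover n\<^esub> b) (a \<otimes>\<^bsub>cover n\<^esub> y \<otimes>\<^bsub>cover n\<^esub> b)"
proof -
  have "a \<otimes>\<^bsub>cover n\<^esub> (z_elem n \<otimes>\<^bsub>cover n\<^esub> y) \<otimes>\<^bsub>cover n\<^esub> b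
    = (a \<otimes>\<^bsub>cover n\<^esub> z_elem n) \<otimes>\<^bsub>cover n\<^esub> y \<otimes>\<^bsub>cover n\<^esub> b"
    using assms by (simp add: m_assoc)
  also have "\<dots> = z_elem n \<otimes>\<^bsub>cover n\<^esub> (a \<otimes>\<^bsub>cover n\<^esub> y \<otimes>\<^bsub>cover n\<^esub> b)"
    using assms by (simp add: m_assoc flip: z_central)
  finally show ?thesis using assms(5) by (auto simp: sim_def)
qed

lemma sim_simple_word:
  assumes "set (a @ u @ b) \<subseteq> {1..<n}" "set (a @ v @ b) \<subseteq> {1..<n}"
    "sim (cl (simple_word u)) (cl (simple_word v))"
  shows "sim (cl (simple_word (a @ u @ b))) (cl (simple_word (a @ v @ b)))"
  using sim_context[of "cl (simple_word a)" _ _ "cl (simple_word b)", OF _ _ _ _ assms(3)] assms(1,2)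
  by (simp add: cl_mult)

text \<open>Each Coxeter relation is a defining relation of the cover with the factor z
  forgotten.\<close>

lemma coxeter_sim: "coxeter n a b \<Longrightarrow>
  set a \<subseteq> {1..<n} \<and> set b \<subseteq> {1..<n} \<and> sim (cl (simple_word a)) (cl (simple_word b))"
proof (induction rule: coxeter.induct)
  case (reflexive a)
  then show ?case by (simp add: sim_def)
next
  case (symmetric a b)
  then show ?case using sim_sym by simp
next
  case (transitive a b c)
  then show ?case using sim_trans[of "cl (simple_word c)"] by auto
next
  case (square a i b)
  have "cl (tw i @ tw i) = cl zw"
    using square by (intro cl_relation) (auto simp: cover_rels_def tw_def)
  then have "cl (simple_word [i, i]) = z_elem n \<otimes>\<^bsub>cover n\<^esub> cl (simple_word [])"
    by (simp add: z_elem_def tw_def cl_Nil)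
  then show ?case using square sim_simple_word[of a "[i, i]" b "[]"] by (auto simp: sim_def)
next
  case (braid a i b)
  have "cl (tw i @ tw (i + 1) @ tw i) = cl (tw (i + 1) @ tw i @ tw (i + 1))"
    using braid by (intro cl_relation) (auto simp: cover_rels_def tw_def)
  then show ?case
    using braid sim_simple_word[of a "[i, Suc i, i]" b "[Suc i, i, Suc i]"] by (auto simp: sim_def tw_def)
next
  case (commute a i j b)
  have "cl (tw i @ tw j) = cl (zw @ tw j @ tw i)"
    using commute by (intro cl_relation) (auto simp: cover_rels_def tw_def)
  then have "cl (simple_word [i, j]) = z_elem n \<otimes>\<^bsub>cover n\<^esub> cl (simple_word [j, i])"
    using commute by (simp add: z_elem_def tw_def cl_mult)
  then show ?case
    using commute sim_simple_word[of a "[i, j]" b "[j, i]"] by (auto simp: sim_def)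
qed

text \<open>Up to z the inverse of a generator \<open>t_i\<close> is \<open>t_i\<close> itself, and
  the letter z disappears.\<close>

lemma word_sim_simple_word:
  "w \<in> W \<Longrightarrow> \<exists>is. set is \<subseteq> {1..<n} \<and> sim (cl w) (cl (simple_word is))"
proof (induction w)
  case Nil
  then show ?case by (intro exI[of _ "[]"]) (simp add: sim_def)
next
  case (Cons x w)
  then have w: "w \<in> W" "[x] \<in> W" by simp_all
  then obtain "is" where "is": "set is \<subseteq> {1..<n}" "sim (cl w) (cl (simple_word is))" using Cons by auto
  have "sim (cl [x] \<otimes>\<^bsub>cover n\<^esub> cl w \<otimes>\<^bsub>cover n\<^esub> \<one>\<^bsub>cover n\<^esub>)
      (cl [x] \<otimes>\<^bsub>cover n\<^esub> cl (simple_word is) \<otimes>\<^bsub>cover n\<^esub> \<one>\<^bsub>cover n\<^esub>)"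
    using w "is" by (intro sim_context) auto
  then have 1: "sim (cl (x # w)) (cl (x # simple_word is))"
    using w "is" by (simp add: cl_mult)
  have z_inv: "inv\<^bsub>cover n\<^esub> z_elem n = z_elem n"
    using z_square by (intro inv_equality) auto
  obtain js where js: "set js \<subseteq> {1..<n}" "sim (cl [x]) (cl (simple_word js))"
  proof (cases x)
    case (Pair s b)
    show ?thesis
    proof (cases s)
      case Z
      then have "cl [x] = z_elem n"
        using Pair cl_letter_inverse[of Z] z_inv by (cases b) (auto simp: z_elem_def zw_def)
      then show ?thesis using that[of "[]"] by (simp add: sim_def cl_Nil)
    next
      case (T i)
      then have i: "i \<in> {1..<n}" using Pair w by simp
      have "cl (tw i @ tw i) = cl zw"
        using i by (intro cl_relation) (auto simp: cover_rels_def tw_def)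
      then have sq: "cl [(T i, True)] \<otimes>\<^bsub>cover n\<^esub> cl [(T i, True)] = z_elem n"
        using i by (simp add: cl_mult z_elem_def tw_def)
      have "(z_elem n \<otimes>\<^bsub>cover n\<^esub> cl [(T i, True)]) \<otimes>\<^bsub>cover n\<^esub> cl [(T i, True)] = \<one>\<^bsub>cover n\<^esub>"
        using i sq z_square by (simp add: m_assoc)
      then have "inv\<^bsub>cover n\<^esub> cl [(T i, True)] = z_elem n \<otimes>\<^bsub>cover n\<^esub> cl [(T i, True)]"
        using i by (intro inv_equality) auto
      then show ?thesis
        using that[of "[i]"] i T Pair cl_letter_inverse[of "T i"] by (cases b) (auto simp: sim_def)
    qed
  qed
  have "sim (\<one>\<^bsub>cover n\<^esub> \<otimes>\<^bsub>cover n\<^esub> cl [x] \<otimes>\<^bsub>cover n\<^esub> cl (simple_word is))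
      (\<one>\<^bsub>cover n\<^esub> \<otimes>\<^bsub>cover n\<^esub> cl (simple_word js) \<otimes>\<^bsub>cover n\<^esub> cl (simple_word is))"
    using w "is" js by (intro sim_context) auto
  then have "sim (cl (x # simple_word is)) (cl (simple_word (js @ is)))"
    using w "is" js by (simp add: cl_mult)
  then have "sim (cl (x # w)) (cl (simple_word (js @ is)))"
    using 1 "is" js by (intro sim_trans[OF _ 1]) auto
  then show ?case using "is" js by (intro exI[of _ "js @ is"]) auto
qed

lemma ev_cl_eq: "u \<in> W \<Longrightarrow> v \<in> W \<Longrightarrow> cl u = cl v \<Longrightarrow> ev u = ev v"
  using cl_eq_iff ev_word_rel by blast

lemma ev_sim:
  assumes "w \<in> W" "set is \<subseteq> {1..<n}" "sim (cl w) (cl (simple_word is))"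
  shows "ev w = ev (simple_word is) \<or> ev w = - ev (simple_word is)"
proof -
  have "cl w = cl (simple_word is) \<or> cl w = cl (zw @ simple_word is)"
    using assms by (auto simp: sim_def z_elem_def cl_mult)
  then have "ev w = ev (simple_word is) \<or> ev w = ev (zw @ simple_word is)"
    using assms by (auto dest: ev_cl_eq[rotated 2])
  then show ?thesis by (auto simp: zw_def)
qed

lemma lifts_ev:
  assumes "w \<in> W"
  shows "\<exists>s \<sigma>. lifts (ev w) s \<sigma> \<and> \<sigma> permutes {1..n}"
proof -
  obtain "is" where "is": "set is \<subseteq> {1..<n}" "sim (cl w) (cl (simple_word is))"
    using word_sim_simple_word[OF assms] by blast
  obtain s where "lifts (ev (simple_word is)) s (simple_perm is)" using lifts_simple_word by blast
  then have "lifts (ev w) s (simple_perm is)"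
    using ev_sim[OF assms "is"] lifts_uminus by auto
  then show ?thesis using simple_perm_permutes[OF "is"(1)] by blast
qed

text \<open>Up to z the word is a positive word over the identity permutation. Coxeter's relations
  reduce it to the empty word, and in the cover every use of them costs at most a factor z.\<close>

lemma cl_kernel:
  assumes w: "w \<in> W" "lifts (ev w) s id"
  shows "cl w = \<one>\<^bsub>cover n\<^esub> \<or> cl w = z_elem n"
proof -
  obtain "is" where "is": "set is \<subseteq> {1..<n}" "sim (cl w) (cl (simple_word is))"
    using word_sim_simple_word[OF w(1)] by blast
  obtain s' where "lifts (ev (simple_word is)) s' (simple_perm is)" using lifts_simple_word by blast
  then have "lifts (ev w) s' (simple_perm is)"
    using ev_sim[OF w(1) "is"] lifts_uminus by auto
  then have "simple_perm is = id" using lifts_unique(1)[OF w(2)] by metis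
  then have "sim (cl (simple_word is)) (cl (simple_word []))"
    using coxeter_complete[OF "is"(1)] coxeter_sim by blast
  then have "sim (cl w) (cl [])"
    using "is" sim_trans[of "cl []"] by auto
  then show ?thesis by (simp add: sim_def cl_Nil)
qed

text \<open>For a quotient of two words with equal value, the kernel leaves only 1 and z, and z is
  excluded because its value is -1.\<close>

lemma cl_eq_iff_ev:
  assumes "u \<in> W" "v \<in> W"
  shows "cl u = cl v \<longleftrightarrow> ev u = ev v"
proof
  assume eq: "ev u = ev v"
  obtain v' where v': "v' \<in> W" "cl v' = inv\<^bsub>cover n\<^esub> cl v"
    using assms inv_closed[of "cl v"] carrier_cover by auto
  then have "cl (v' @ v) = cl []" using assms by (simp add: cl_Nil flip: cl_mult)
  then have "ev (v' @ v) = ev []" using assms v' by (intro ev_cl_eq) auto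
  then have one: "ev (v' @ u) = 1" using eq by simp
  then have "cl (v' @ u) = \<one>\<^bsub>cover n\<^esub> \<or> cl (v' @ u) = cl zw"
    using cl_kernel[of "v' @ u" 1] assms v' lifts_one by (simp add: z_elem_def)
  moreover have "cl (v' @ u) \<noteq> cl zw"
  proof
    assume "cl (v' @ u) = cl zw"
    then have "ev (v' @ u) = ev zw" using assms v' by (intro ev_cl_eq) auto
    then have "(1::clif) = - 1" using one by (simp add: zw_def)
    then show False using clif_double[of 1] by simp
  qed
  ultimately have "inv\<^bsub>cover n\<^esub> cl v \<otimes>\<^bsub>cover n\<^esub> cl u = \<one>\<^bsub>cover n\<^esub>"
    using assms v' by (simp flip: cl_mult)
  then have "cl v \<otimes>\<^bsub>cover n\<^esub> (inv\<^bsub>cover n\<^esub> cl v \<otimes>\<^bsub>cover n\<^esub> cl u) = cl v"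
    using assms by simp
  then show "cl u = cl v"
    using assms by (simp flip: m_assoc)
qed (rule ev_cl_eq[OF assms])

end

section \<open>Cycles and the image of the cover\<close>

lemma cycle_of_list_snoc:
  assumes "distinct (i # js @ [j])"
  shows "cycle_of_list (i # js @ [j]) = transpose i j \<circ> cycle_of_list (i # js)"
  using assms
proof (induction js arbitrary: i)
  case (Cons k ks)
  have "transpose i k (transpose k j x) = transpose i j (transpose i k x)" for x
    using Cons.prems by (auto simp: transpose_def)
  then show ?case using Cons by (simp add: fun_eq_iff)
qed simp

lemma cycle_of_list_nth:
  assumes "distinct is" "q < length is"
  shows "cycle_of_list is (is ! q) = is ! (Suc q mod length is)"
proof -
  have "map (cycle_of_list is) is = rotate1 is"
    using cyclic_rotation[OF assms(1), of 1] by simp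
  then have "map (cycle_of_list is) is ! q = rotate1 is ! q" by simp
  then show ?thesis using assms by (simp add: nth_rotate1)
qed

text \<open>The defining product of a cycle, with an arbitrary point \<open>p\<close> in the role of
  \<open>n + 1\<close>. Keeping \<open>p\<close> free means that the elements do not change when
  \<open>n\<close> decreases in the induction of \<open>spin_coeff_top\<close>.\<close>

definition cyc :: "nat \<Rightarrow> nat list \<Rightarrow> clif" where
  "cyc p is = prod_list (map (rtv p) (hd is # rev is))"

lemma cyc_singleton: "p \<noteq> i \<Longrightarrow> cyc p [i] = - 1"
  by (simp add: cyc_def rtv_square)

text \<open>Moving the outer factor \<open>rtv p i\<close> past \<open>rtv p j\<close> turns the
  latter into a factor without \<open>p\<close>. By induction a cycle is thus a product of root
  vectors between its own points, which is why it lies in the smaller group although its defining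
  factors do not.\<close>

lemma cyc_snoc:
  assumes "distinct (p # i # js @ [j])"
  shows "cyc p (i # js @ [j]) = - rtv i j * cyc p (i # js)"
proof -
  define P where "P = prod_list (map (rtv p) (rev js)) * rtv p i"
  have sq: "rtv p i * rtv p i = - 1" using assms by (intro rtv_square) auto
  have "rtv p i * rtv p j = - rtv i j * rtv p i"
    using lifts_rtv_conj[OF lifts_rtv[of p i], of p j] assms by (simp add: transpose_def)
  then have "cyc p (i # js @ [j]) = - rtv i j * (rtv p i * P)"
    by (simp add: cyc_def P_def flip: mult.assoc)
  then show ?thesis by (simp add: cyc_def P_def)
qed

lemma lifts_cyc:
  assumes "distinct (p # is)" "is \<noteq> []"
  shows "lifts (cyc p is) ((- 1) ^ Suc (length is)) (cycle_of_list is)"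
proof -
  obtain i js where "is": "is = i # js" using assms(2) by (cases "is") auto
  have "distinct (p # i # js) \<Longrightarrow> lifts (cyc p (i # js)) ((- 1) ^ length js) (cycle_of_list (i # js))" for js
  proof (induction js rule: rev_induct)
    case Nil
    then show ?case using lifts_uminus[OF lifts_one] by (simp add: cyc_singleton id_def)
  next
    case (snoc j js)
    have "lifts (- rtv i j * cyc p (i # js)) (- 1 * (- 1) ^ length js)
        (transpose i j \<circ> cycle_of_list (i # js))"
      using snoc by (intro lifts_mult lifts_uminus lifts_rtv) auto
    then show ?case using snoc.prems by (simp add: cyc_snoc cycle_of_list_snoc comp_def)
  qed
  then show ?thesis using assms "is" by simp
qed

text \<open>By \<open>cl_eq_iff_ev\<close> this is an isomorphic copy of the cover. The copies for
  different \<open>n\<close> are nested.\<close>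

definition pin :: "nat \<Rightarrow> clif set" where
  "pin n = ev ` words (cover_gens n)"

lemma pin_one [simp]: "1 \<in> pin n"
  unfolding pin_def by (rule image_eqI[of _ _ "[]"]) auto

lemma pin_mult: "g \<in> pin n \<Longrightarrow> h \<in> pin n \<Longrightarrow> g * h \<in> pin n"
  unfolding pin_def by (auto simp flip: ev_simps(3))

lemma pin_uminus_one [simp]: "- 1 \<in> pin n"
  unfolding pin_def by (rule image_eqI[of _ _ zw]) (auto simp: zw_def)

lemma pin_uminus: "g \<in> pin n \<Longrightarrow> - g \<in> pin n"
  using pin_mult[of "- 1" n g] by simp

lemma pin_uminus_iff [simp]: "- g \<in> pin n \<longleftrightarrow> g \<in> pin n"
  using pin_uminus[of g n] pin_uminus[of "- g" n] by auto

lemma pin_simple: "1 \<le> i \<Longrightarrow> i < n \<Longrightarrow> rtv (Suc i) i \<in> pin n"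
  unfolding pin_def by (rule image_eqI[of _ _ "tw i"]) (auto simp: tw_def)

lemma pin_induct [consumes 1, case_names one uminus simple]:
  assumes "g \<in> pin n" "P 1" "\<And>g. g \<in> pin n \<Longrightarrow> P g \<Longrightarrow> P (- g)"
    "\<And>i g. 1 \<le> i \<Longrightarrow> i < n \<Longrightarrow> g \<in> pin n \<Longrightarrow> P g \<Longrightarrow> P (rtv (Suc i) i * g)"
  shows "P g"
proof -
  obtain w where w: "w \<in> words (cover_gens n)" "g = ev w" using assms(1) by (auto simp: pin_def)
  have "P (ev w) \<and> ev w \<in> pin n"
    using w(1)
  proof (induction w)
    case Nil
    then show ?case using assms(2) by simp
  next
    case (Cons x w)
    then have IH: "P (ev w)" "ev w \<in> pin n" and x: "fst x \<in> cover_gens n" by auto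
    show ?case
    proof (cases x)
      case (Pair s b)
      show ?thesis
      proof (cases s)
        case Z
        then show ?thesis using Pair IH assms(3) by auto
      next
        case (T i)
        then have "1 \<le> i" "i < n" using x Pair by auto
        then have "P (rtv (Suc i) i * ev w)" "rtv (Suc i) i * ev w \<in> pin n"
          using IH assms(4) pin_mult pin_simple by auto
        then show ?thesis using T Pair assms(3) by (cases b) auto
      qed
    qed
  qed
  then show ?thesis using w by simp
qed

lemma pin_inverse: "g \<in> pin n \<Longrightarrow> \<exists>h\<in>pin n. g * h = 1 \<and> h * g = 1"
proof (induction rule: pin_induct)
  case one
  then show ?case by (intro bexI[of _ 1]) auto
next
  case (uminus g)
  then obtain h where "h \<in> pin n" "g * h = 1" "h * g = 1" by blast
  then show ?case by (intro bexI[of _ "- h"]) auto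
next
  case (simple i g)
  then obtain h where h: "h \<in> pin n" "g * h = 1" "h * g = 1" by blast
  have sq: "rtv (Suc i) i * rtv (Suc i) i = - 1" by (simp add: rtv_square)
  have "rtv (Suc i) i * (g * h) * rtv (Suc i) i = - 1" "h * (rtv (Suc i) i * rtv (Suc i) i) * g = - 1"
    using h sq by simp_all
  then have "rtv (Suc i) i * g * - (h * rtv (Suc i) i) = 1" "- (h * rtv (Suc i) i) * (rtv (Suc i) i * g) = 1"
    by (simp_all add: mult.assoc)
  moreover have "- (h * rtv (Suc i) i) \<in> pin n" using h simple pin_simple pin_mult by simp
  ultimately show ?case by blast
qed

lemma pin_lifts: "g \<in> pin n \<Longrightarrow> \<exists>s \<sigma>. lifts g s \<sigma> \<and> \<sigma> permutes {1..n}"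
  using spin_cover.lifts_ev unfolding pin_def by blast

lemma pin_rtv_aux: "1 \<le> i \<Longrightarrow> i < j \<Longrightarrow> j \<le> n \<Longrightarrow> rtv j i \<in> pin n"
proof (induction "j - i" arbitrary: i)
  case (Suc d)
  show ?case
  proof (cases "j = Suc i")
    case True
    then show ?thesis using pin_simple Suc.prems by simp
  next
    case False
    then have IH: "rtv j (Suc i) \<in> pin n" using Suc by auto
    have s: "rtv (Suc i) i \<in> pin n" using Suc.prems by (intro pin_simple) auto
    have "rtv (Suc i) i * rtv j (Suc i) = - rtv j i * rtv (Suc i) i"
      using lifts_rtv_conj[OF lifts_rtv[of "Suc i" i], of j "Suc i"] False Suc.prems
      by (simp add: transpose_def)
    then have "rtv (Suc i) i * rtv j (Suc i) * rtv (Suc i) i = rtv j i"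
      by (simp add: mult.assoc rtv_square)
    then show ?thesis using pin_mult[OF pin_mult[OF s IH] s] by simp
  qed
qed simp

lemma pin_rtv: "i \<in> {1..n} \<Longrightarrow> j \<in> {1..n} \<Longrightarrow> i \<noteq> j \<Longrightarrow> rtv i j \<in> pin n"
  using pin_rtv_aux[of i j n] pin_rtv_aux[of j i n] rtv_swap[of i j] by (cases "i < j") auto

lemma pin_lift:
  assumes "\<sigma> permutes {1..n}"
  shows "\<exists>g\<in>pin n. \<exists>s. lifts g s \<sigma>"
proof -
  have "finite {1..n}" by simp
  with assms show ?thesis
  proof (induction rule: permutes_induct)
    case id
    then show ?case using lifts_one pin_one by blast
  next
    case (swap a b p)
    then obtain g s where "g \<in> pin n" "lifts g s p" by blast
    then have "lifts (rtv a b * g) (- 1 * s) (transpose a b \<circ> p)"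
      using swap by (intro lifts_mult lifts_rtv)
    moreover have "rtv a b * g \<in> pin n" using swap \<open>g \<in> pin n\<close> by (intro pin_mult pin_rtv)
    ultimately show ?case by blast
  qed
qed

lemma pin_kernel:
  assumes "g \<in> pin n" "lifts g s id"
  shows "g = 1 \<or> g = - 1"
proof -
  interpret spin_cover n .
  obtain w where w: "w \<in> W" "g = ev w" using assms(1) by (auto simp: pin_def)
  then have "cl w = cl [] \<or> cl w = cl zw"
    using cl_kernel assms by (simp add: z_elem_def cl_Nil)
  then have "ev w = ev [] \<or> ev w = ev zw"
    using w by (auto dest: ev_cl_eq[rotated 2])
  then show ?thesis using w by (simp add: zw_def)
qed

lemma pin_lifts_unique:
  assumes "g \<in> pin n" "g' \<in> pin n" "lifts g s \<sigma>" "lifts g' s' \<sigma>"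
  shows "g = g' \<or> g = - g'"
proof -
  obtain h where h: "h \<in> pin n" "g' * h = 1" "h * g' = 1" using pin_inverse[OF assms(2)] by blast
  obtain t \<tau> where \<tau>: "lifts h t \<tau>" using pin_lifts[OF h(1)] by blast
  have "lifts (g' * h) (s' * t) (\<sigma> \<circ> \<tau>)" by (rule lifts_mult[OF assms(4) \<tau>])
  then have "\<sigma> \<circ> \<tau> = id" using h(2) lifts_unique(1)[OF _ lifts_one] by simp
  then have "lifts (g * h) (s * t) id" using lifts_mult[OF assms(3) \<tau>] by simp
  then have "g * h = 1 \<or> g * h = - 1" using pin_kernel pin_mult assms(1) h(1) by blast
  moreover have "g * h * g' = g" using h(3) by (simp add: mult.assoc)
  ultimately show ?thesis by (metis mult_1_left mult_minus_left)
qed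

lemma cyc_in_pin:
  assumes "distinct is" "is \<noteq> []" "set is \<subseteq> {1..n}" "p \<notin> set is"
  shows "cyc p is \<in> pin n"
proof -
  obtain i js where "is": "is = i # js" using assms(2) by (cases "is") auto
  have "distinct (p # i # js) \<Longrightarrow> set (i # js) \<subseteq> {1..n} \<Longrightarrow> cyc p (i # js) \<in> pin n" for js
  proof (induction js rule: rev_induct)
    case (snoc j js)
    then have "cyc p (i # js) \<in> pin n" "rtv i j \<in> pin n" by (auto intro!: pin_rtv)
    then show ?case using snoc.prems by (simp add: cyc_snoc pin_mult)
  qed (simp add: cyc_singleton)
  then show ?thesis using assms "is" by auto
qed

definition rho :: "gen word set \<Rightarrow> clif" where
  "rho U = the_elem (ev ` U)"

context spin_cover
begin

lemma mem_cl_iff: "w \<in> W \<Longrightarrow> v \<in> cl w \<longleftrightarrow> v \<in> W \<and> ev v = ev w"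
proof -
  assume w: "w \<in> W"
  have "v \<in> cl w \<longleftrightarrow> (w, v) \<in> word_rel (cover_gens n) (cover_rels n)"
    by (simp add: cover_class_def)
  also have "\<dots> \<longleftrightarrow> v \<in> W \<and> cl w = cl v"
  proof (cases "v \<in> W")
    case False
    then show ?thesis by (simp add: word_rel_def)
  qed (simp add: cl_eq_iff[OF w])
  also have "\<dots> \<longleftrightarrow> v \<in> W \<and> ev v = ev w"
  proof (cases "v \<in> W")
    case True
    then show ?thesis using cl_eq_iff_ev[OF w True] by (simp add: eq_commute)
  qed simp
  finally show "v \<in> cl w \<longleftrightarrow> v \<in> W \<and> ev v = ev w" .
qed

lemma rho_cl: "w \<in> W \<Longrightarrow> rho (cl w) = ev w"
proof -
  assume "w \<in> W"
  then have "ev ` cl w = {ev w}" using mem_cl_iff by auto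
  then show ?thesis by (simp add: rho_def)
qed

lemma rho_mult:
  "x \<in> carrier (cover n) \<Longrightarrow> y \<in> carrier (cover n) \<Longrightarrow> rho (x \<otimes>\<^bsub>cover n\<^esub> y) = rho x * rho y"
  by (auto simp: carrier_cover cl_mult rho_cl)

lemma rho_one [simp]: "rho \<one>\<^bsub>cover n\<^esub> = 1"
  by (simp add: rho_cl flip: cl_Nil)

lemma rho_z [simp]: "rho (z_elem n) = - 1"
  by (simp add: z_elem_def rho_cl) (simp add: zw_def)

lemma rho_inj: "inj_on rho (carrier (cover n))"
  by (auto simp: inj_on_def carrier_cover rho_cl cl_eq_iff_ev)

lemma rho_eq_iff:
  "x \<in> carrier (cover n) \<Longrightarrow> y \<in> carrier (cover n) \<Longrightarrow> rho x = rho y \<longleftrightarrow> x = y"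
  using rho_inj by (auto simp: inj_on_def)

lemma rho_image: "rho ` carrier (cover n) = pin n"
  by (auto simp: carrier_cover pin_def rho_cl image_iff)

lemma list_mult_closed: "set xs \<subseteq> carrier (cover n) \<Longrightarrow> list_mult (cover n) xs \<in> carrier (cover n)"
  by (induction xs) (simp_all add: list_mult_def)

lemma rho_list_mult:
  "set xs \<subseteq> carrier (cover n) \<Longrightarrow> rho (list_mult (cover n) xs) = prod_list (map rho xs)"
proof (induction xs)
  case (Cons x xs)
  then show ?case
    using list_mult_closed[of xs] by (simp add: list_mult_def rho_mult)
qed (simp add: list_mult_def)

lemma t_elem_closed: "i \<in> {1..<n} \<Longrightarrow> t_elem n i \<in> carrier (cover n)"
  and rho_t_elem: "i \<in> {1..<n} \<Longrightarrow> rho (t_elem n i) = rtv (Suc i) i"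
  by (simp_all add: t_elem_def tw_def rho_cl)

end

lemma rho_cover_emb:
  assumes "U \<in> carrier (cover n)"
  shows "cover_emb n U \<in> carrier (cover (n + 1))" "rho (cover_emb n U) = rho U"
proof -
  interpret A: spin_cover n .
  interpret B: spin_cover "n + 1" .
  obtain w where w: "w \<in> A.W" "U = A.cl w" using assms A.carrier_cover by auto
  have sub: "A.W \<subseteq> B.W" unfolding words_def by (intro lists_mono) (auto simp: cover_gens_def)
  have "cover_emb n U = (\<Union>u\<in>U. B.cl u)"
    unfolding cover_emb_def cover_class_def by blast
  also have "\<dots> = B.cl w"
  proof -
    have "B.cl u = B.cl w" if "u \<in> U" for u
    proof -
      have u: "u \<in> A.W \<and> ev u = ev w" using that w A.mem_cl_iff[OF w(1), of u] by simp
      then have "u \<in> B.W" "w \<in> B.W" using sub w(1) by blast+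
      then show ?thesis using u B.cl_eq_iff_ev by blast
    qed
    moreover have "w \<in> U" using w A.mem_cl_iff by simp
    ultimately show ?thesis by blast
  qed
  finally have emb: "cover_emb n U = B.cl w" .
  have wB: "w \<in> B.W" using sub w(1) by blast
  show "cover_emb n U \<in> carrier (cover (n + 1))"
    unfolding emb by (rule B.cl_closed[OF wB])
  show "rho (cover_emb n U) = rho U"
  proof -
    have "rho (cover_emb n U) = ev w" unfolding emb by (rule B.rho_cl[OF wB])
    also have "\<dots> = rho U" unfolding w(2) by (rule A.rho_cl[OF w(1), symmetric])
    finally show ?thesis .
  qed
qed

text \<open>The palindrome is built outwards from its centre: conjugation by \<open>t_i\<close>
  takes the vector for \<open>i + 1\<close> to the vector for \<open>i\<close>.\<close>

lemma reflection_word: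
  assumes "i \<le> n"
  shows "prod_list (map (\<lambda>j. rtv (Suc j) j) ([i..<n + 1] @ rev [i..<n])) = rtv (n + 1) i"
  using assms
proof (induction "n - i" arbitrary: i)
  case 0
  then have "i = n" by simp
  then show ?case by simp
next
  case (Suc d)
  then have "i < n" by simp
  then have split: "[i..<n + 1] @ rev [i..<n] = i # ([Suc i..<n + 1] @ rev [Suc i..<n]) @ [i]"
    by (simp add: upt_conv_Cons del: upt_Suc)
  have "prod_list (map (\<lambda>j. rtv (Suc j) j) ([i..<n + 1] @ rev [i..<n]))
      = rtv (Suc i) i * (rtv (n + 1) (Suc i) * rtv (Suc i) i)"
  proof -
    have prod: "prod_list (map f (i # xs @ [i])) = f i * (prod_list (map f xs) * f i)"
      for f :: "nat \<Rightarrow> clif" and xs by (simp add: mult.assoc)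
    have "d = n - Suc i" "Suc i \<le> n" using Suc.hyps(2) by simp_all
    note IH = Suc.hyps(1)[OF this]
    show ?thesis unfolding split prod IH ..
  qed
  also have "\<dots> = - rtv (n + 1) i * (rtv (Suc i) i * rtv (Suc i) i)"
    using lifts_rtv_conj[OF lifts_rtv[of "Suc i" i], of "n + 1" "Suc i"] \<open>i < n\<close>
    by (simp add: transpose_def flip: mult.assoc)
  finally show ?case by (simp add: rtv_square)
qed

lemma rho_x_elem:
  assumes "i \<in> {1..n}"
  shows "x_elem n i \<in> carrier (cover (n + 1))" "rho (x_elem n i) = rtv (n + 1) i"
proof -
  interpret spin_cover "n + 1" .
  let ?js = "[i..<n + 1] @ rev [i..<n]"
  have js: "set ?js \<subseteq> {1..<n + 1}" using assms by auto
  then have sub: "set (map (t_elem (n + 1)) ?js) \<subseteq> carrier (cover (n + 1))"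
    using t_elem_closed by auto
  show "x_elem n i \<in> carrier (cover (n + 1))"
    unfolding x_elem_def using list_mult_closed[OF sub] .
  have "map rho (map (t_elem (n + 1)) ?js) = map (\<lambda>j. rtv (Suc j) j) ?js"
    using js rho_t_elem by auto
  then have "rho (x_elem n i) = prod_list (map (\<lambda>j. rtv (Suc j) j) ?js)"
    unfolding x_elem_def rho_list_mult[OF sub] by (rule arg_cong)
  also have "\<dots> = rtv (n + 1) i"
    using assms by (intro reflection_word) simp
  finally show "rho (x_elem n i) = rtv (n + 1) i" .
qed

text \<open>The description has a solution because the product lies in \<open>pin n\<close>, and
  only one because \<open>rho\<close> is injective on the cover and unchanged by the
  embedding.\<close>

lemma rho_cycle_elem:
  assumes "distinct is" "is \<noteq> []" "set is \<subseteq> {1..n}"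
  shows "cycle_elem n is \<in> carrier (cover n)" "rho (cycle_elem n is) = cyc (n + 1) is"
proof -
  interpret A: spin_cover n .
  interpret B: spin_cover "n + 1" .
  let ?xs = "map (x_elem n) (hd is # rev is)"
  have hd: "set (hd is # rev is) \<subseteq> {1..n}" using assms(3) hd_in_set[OF assms(2)] by auto
  then have sub: "set ?xs \<subseteq> carrier (cover (n + 1))" using rho_x_elem by auto
  have "map rho ?xs = map (rtv (n + 1)) (hd is # rev is)"
    using hd rho_x_elem(2)[of _ n] by (auto simp del: One_nat_def)
  then have prod: "rho (list_mult (cover (n + 1)) ?xs) = cyc (n + 1) is"
    unfolding cyc_def B.rho_list_mult[OF sub] by (rule arg_cong)
  have "cyc (n + 1) is \<in> pin n" using assms by (intro cyc_in_pin) auto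
  then obtain g where g: "g \<in> carrier (cover n)" "rho g = cyc (n + 1) is"
    unfolding A.rho_image [symmetric] by (metis imageE)
  have iff: "cover_emb n h = list_mult (cover (n + 1)) ?xs \<longleftrightarrow> rho h = cyc (n + 1) is"
    if "h \<in> carrier (cover n)" for h
    using B.rho_eq_iff[OF rho_cover_emb(1)[OF that] B.list_mult_closed[OF sub]] rho_cover_emb(2)[OF that] prod
    by simp
  have "cycle_elem n is = g"
    unfolding cycle_elem_def
  proof (rule the_equality)
    show "g \<in> carrier (cover n) \<and> cover_emb n g = list_mult (cover (n + 1)) ?xs"
      using g iff[OF g(1)] by blast
    fix h assume "h \<in> carrier (cover n) \<and> cover_emb n h = list_mult (cover (n + 1)) ?xs"
    then have h: "h \<in> carrier (cover n)" "rho h = rho g" using iff[of h] g by simp_all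
    then show "h = g" using A.rho_eq_iff[OF h(1) g(1)] by blast
  qed
  then show "cycle_elem n is \<in> carrier (cover n)" "rho (cycle_elem n is) = cyc (n + 1) is"
    using g by auto
qed


section \<open>Symmetric functions of odd Jucys--Murphy elements\<close>

lemma minus_one_power_cases: "(- 1 :: 'a::ring_1) ^ k = 1 \<or> (- 1 :: 'a) ^ k = - 1"
  by (induction k) auto

lemma rtv_prod_conj:
  assumes "lifts h s \<tau>" "\<tau> p = p"
  shows "h * prod_list (map (rtv p) xs) = s ^ length xs * prod_list (map (rtv p) (map \<tau> xs)) * h"
proof (induction xs)
  case (Cons x xs)
  have s: "s = 1 \<or> s = - 1" by (rule lifts_sign[OF assms(1)])
  have "h * prod_list (map (rtv p) (x # xs)) = s * rtv p (\<tau> x) * (h * prod_list (map (rtv p) xs))"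
    using lifts_rtv_conj[OF assms(1), of p x] assms(2) by (simp flip: mult.assoc)
  also have "\<dots> = s * (rtv p (\<tau> x) * s ^ length xs) * prod_list (map (rtv p) (map \<tau> xs)) * h"
    unfolding Cons.IH by (simp only: mult.assoc)
  also have "rtv p (\<tau> x) * s ^ length xs = s ^ length xs * rtv p (\<tau> x)"
  proof -
    have "s ^ length xs = 1 \<or> s ^ length xs = - 1"
      using s minus_one_power_cases[of "length xs"] by auto
    then show ?thesis by (elim disjE) simp_all
  qed
  finally show ?case by (simp add: mult.assoc)
qed simp

lemma cyc_conj:
  assumes "lifts h s \<tau>" "\<tau> p = p" "is \<noteq> []"
  shows "h * cyc p is = s ^ Suc (length is) * cyc p (map \<tau> is) * h"
  using rtv_prod_conj[OF assms(1,2), of "hd is # rev is"] assms(3)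
  by (simp add: cyc_def rev_map hd_map)

text \<open>Conjugation by the cycle takes the outer factor at its first point to the factor at the
  second, with the sign of the cycle. So a cycle with an even number of points is determined by its
  cyclic order only up to z, while one with an odd number of points is truly determined.\<close>

lemma cyc_rotate1_sign:
  assumes "distinct (p # is)" "is \<noteq> []"
  shows "cyc p (rotate1 is) = (- 1) ^ Suc (length is) * cyc p is"
proof (cases "is")
  case (Cons i js')
  show ?thesis
  proof (cases js')
    case (Cons j js)
    then have "is": "is = i # j # js" using \<open>is = i # js'\<close> by simp
    define P where "P = prod_list (map (rtv p) (rev js))"
    define s where "s = (- 1 :: clif) ^ Suc (length is)"
    have xi: "rtv p i * rtv p i = - 1" and xj: "rtv p j * rtv p j = - 1"
      using assms "is" by (auto intro!: rtv_square)
    have c: "cyc p is = rtv p i * P * rtv p j * rtv p i"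
      by (simp add: cyc_def "is" P_def mult.assoc)
    have c': "cyc p (rotate1 is) = rtv p j * rtv p i * P * rtv p j"
      by (simp add: cyc_def "is" P_def mult.assoc)
    have s: "s = 1 \<or> s = - 1" unfolding s_def by (rule minus_one_power_cases)
    have "cycle_of_list is p = p" "cycle_of_list is i = j"
      using assms id_outside_supp[of p "is"] cycle_of_list_nth[of "is" 0] "is" by auto
    then have "cyc p is * rtv p i = s * rtv p j * cyc p is"
      using lifts_rtv_conj[OF lifts_cyc[OF assms], of p i] by (simp add: s_def)
    moreover have "cyc p is * rtv p i = - (rtv p i * P * rtv p j)"
      using xi by (simp add: c mult.assoc)
    ultimately have "s * rtv p j * cyc p is = - (rtv p i * P * rtv p j)" by simp
    then have "rtv p j * (s * rtv p j * cyc p is) = - cyc p (rotate1 is)"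
      by (simp add: c' mult.assoc)
    moreover have "rtv p j * (s * rtv p j * cyc p is) = - (s * cyc p is)"
    proof -
      have "rtv p j * (s * rtv p j * cyc p is) = s * ((rtv p j * rtv p j) * cyc p is)"
        using s by (auto simp: mult.assoc)
      then show ?thesis by (simp add: xj)
    qed
    ultimately have "cyc p (rotate1 is) = s * cyc p is" by simp
    then show ?thesis unfolding s_def .
  qed (use Cons in simp)
qed (use assms in simp)

lemma cyc_rotate:
  assumes "distinct (p # is)" "odd (length is)"
  shows "cyc p (rotate m is) = cyc p is"
proof (induction m)
  case (Suc m)
  have "cyc p (rotate1 (rotate m is)) = cyc p (rotate m is)"
    using assms cyc_rotate1_sign[of p "rotate m is"] by (cases "is") auto
  then show ?case using Suc by simp
qed simp

text \<open>Right multiplication by the Jucys--Murphy element \<open>M\<^sub>k\<close>, as an operator on functions on the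
  Clifford group; since \<open>[i, k]\<^sup>-\<^sup>1 = - [i, k]\<close>, this is so only up to a sign, which disappears in
  \<open>M\<^sub>k\<^sup>2\<close>.\<close>

definition jm :: "nat \<Rightarrow> (clif \<Rightarrow> 'b::comm_ring_1) \<Rightarrow> clif \<Rightarrow> 'b" where
  "jm k f = (\<lambda>x. \<Sum>i\<in>{1..<k}. f (x * rtv i k))"

text \<open>The product of the operators \<open>1 + u M\<^sub>k\<^sup>2\<close>, with the \<open>e\<^sub>r\<^sub>;\<^sub>n\<close> as coefficients of the powers of \<open>u\<close>.\<close>

fun esym :: "'b::comm_ring_1 \<Rightarrow> nat \<Rightarrow> (clif \<Rightarrow> 'b) \<Rightarrow> clif \<Rightarrow> 'b" where
  "esym u 0 f = f"
| "esym u (Suc n) f = esym u n f + (\<lambda>x. u) * jm (Suc n) (jm (Suc n) (esym u n f))"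

text \<open>Right translations by \<open>t_j\<close> and by z make the relations between generators
  and Jucys-Murphy elements into identities between operators.\<close>

definition tr :: "nat \<Rightarrow> (clif \<Rightarrow> 'b::comm_ring_1) \<Rightarrow> clif \<Rightarrow> 'b" where
  "tr j f = (\<lambda>x. f (x * rtv (Suc j) j))"

definition neg :: "(clif \<Rightarrow> 'b::comm_ring_1) \<Rightarrow> clif \<Rightarrow> 'b" where
  "neg f = (\<lambda>x. f (- x))"

lemma jm_linear:
  "jm k (f + g) = jm k f + jm k g" "jm k (f - g) = jm k f - jm k g"
  "jm k ((\<lambda>x. u) * f) = (\<lambda>x. u) * jm k f"
  by (simp_all add: jm_def fun_eq_iff sum.distrib sum_subtractf sum_distrib_left)

lemma tr_linear:
  "tr k (f + g) = tr k f + tr k g" "tr k (f - g) = tr k f - tr k g"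
  "tr k ((\<lambda>x. u) * f) = (\<lambda>x. u) * tr k f"
  by (simp_all add: tr_def fun_eq_iff)

lemma neg_linear:
  "neg (f + g) = neg f + neg g" "neg (f - g) = neg f - neg g" "neg (neg f) = f"
  by (simp_all add: neg_def fun_eq_iff)

lemma neg_commutes: "jm k (neg f) = neg (jm k f)" "tr k (neg f) = neg (tr k f)"
  by (simp_all add: jm_def tr_def neg_def)

text \<open>Conjugation by \<open>t_j\<close> permutes the summands \<open>[i, k]\<close> of the
  Jucys-Murphy element, and the sign is that of an odd element.\<close>

lemma tr_jm_far:
  assumes "1 \<le> j" "k \<noteq> j" "k \<noteq> Suc j"
  shows "tr j (jm k f) = neg (jm k (tr j f))"
proof
  fix x
  let ?s = "transpose (Suc j) j"
  have maps: "?s \<in> {1..<k} \<rightarrow> {1..<k}" using assms by (auto simp: transpose_def)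
  have bij: "bij_betw ?s {1..<k} {1..<k}" by (rule bij_betwI[OF maps maps]) auto
  have "rtv (Suc j) j * rtv i k = - rtv (?s i) k * rtv (Suc j) j" for i
    using lifts_rtv_conj[OF lifts_rtv[of "Suc j" j], of i k] assms by (simp add: transpose_def)
  then have "tr j (jm k f) x = (\<Sum>i\<in>{1..<k}. f (- x * rtv (?s i) k * rtv (Suc j) j))"
    by (simp add: tr_def jm_def mult.assoc)
  also have "\<dots> = (\<Sum>i\<in>{1..<k}. f (- x * rtv i k * rtv (Suc j) j))"
    by (rule sum.reindex_bij_betw[OF bij])
  finally show "tr j (jm k f) x = neg (jm k (tr j f)) x"
    by (simp add: tr_def jm_def neg_def)
qed

lemma jm_Suc_split: "1 \<le> j \<Longrightarrow> jm (Suc j) f x = (\<Sum>i\<in>{1..<j}. f (x * rtv i (Suc j))) + f (x * rtv j (Suc j))"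
  by (simp add: jm_def atLeastLessThanSuc add.commute)

lemma rtv_simple_shift:
  assumes "i < j"
  shows "rtv (Suc j) j * rtv i (Suc j) = - rtv i j * rtv (Suc j) j"
    "rtv (Suc j) j * rtv i j = - rtv i (Suc j) * rtv (Suc j) j"
  using lifts_rtv_conj[OF lifts_rtv[of "Suc j" j], of i] assms by (simp_all add: transpose_def)

lemma rtv_simple_cancel: "rtv (Suc j) j * rtv j (Suc j) = 1" "rtv j (Suc j) * rtv (Suc j) j = 1"
  using rtv_square[of "Suc j" j] rtv_swap[of "Suc j" j] by simp_all

text \<open>The summands with \<open>i < j\<close> are carried to those for \<open>j\<close>. The
  remaining one, \<open>[j, j + 1]\<close>, is the inverse of \<open>t_j\<close> and leaves
  \<open>f\<close> itself.\<close>

lemma tr_jm_Suc: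
  assumes "1 \<le> j"
  shows "tr j (jm (Suc j) f) = neg (jm j (tr j f)) + f"
proof
  fix x
  have "tr j (jm (Suc j) f) x = (\<Sum>i\<in>{1..<j}. f (- x * rtv i j * rtv (Suc j) j)) + f x"
    using assms rtv_simple_shift(1)
    by (simp add: tr_def jm_Suc_split mult.assoc rtv_simple_cancel)
  then show "tr j (jm (Suc j) f) x = (neg (jm j (tr j f)) + f) x"
    by (simp add: tr_def jm_def neg_def)
qed

lemma jm_Suc_tr:
  assumes "1 \<le> j"
  shows "jm (Suc j) (tr j f) = neg (tr j (jm j f)) + f"
proof
  fix x
  have shift: "rtv i (Suc j) * rtv (Suc j) j = - (rtv (Suc j) j * rtv i j)" if "i < j" for i
    using rtv_simple_shift(2)[OF that] by simp
  have "jm (Suc j) (tr j f) x = (\<Sum>i\<in>{1..<j}. f (- x * rtv (Suc j) j * rtv i j)) + f x"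
    using assms shift by (simp add: tr_def jm_Suc_split mult.assoc rtv_simple_cancel)
  then show "jm (Suc j) (tr j f) x = (neg (tr j (jm j f)) + f) x"
    by (simp add: tr_def jm_def neg_def)
qed

text \<open>Since \<open>i\<close> and \<open>k\<close> are both below \<open>l\<close>, conjugation
  by \<open>[i, k]\<close> permutes the summands \<open>[m, l]\<close>, with a factor z each
  time.\<close>

lemma jm_anticommute:
  assumes "k < l"
  shows "jm k (jm l f) = neg (jm l (jm k f))"
proof
  fix x
  have "jm k (jm l f) x = (\<Sum>i\<in>{1..<k}. \<Sum>m\<in>{1..<l}. f (- x * rtv m l * rtv i k))"
    unfolding jm_def
  proof (rule sum.cong [OF refl])
    fix i assume i: "i \<in> {1..<k}"
    let ?s = "transpose i k"
    have maps: "?s \<in> {1..<l} \<rightarrow> {1..<l}" using assms i by (auto simp: transpose_def)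
    have bij: "bij_betw ?s {1..<l} {1..<l}" by (rule bij_betwI[OF maps maps]) auto
    have "rtv i k * rtv m l = - rtv (?s m) l * rtv i k" for m
      using lifts_rtv_conj[OF lifts_rtv[of i k], of m l] i assms by (simp add: transpose_def)
    then have "(\<Sum>m\<in>{1..<l}. f (x * rtv i k * rtv m l))
        = (\<Sum>m\<in>{1..<l}. f (- x * rtv (?s m) l * rtv i k))"
      by (simp add: mult.assoc)
    also have "\<dots> = (\<Sum>m\<in>{1..<l}. f (- x * rtv m l * rtv i k))"
      by (rule sum.reindex_bij_betw[OF bij])
    finally show "(\<Sum>m\<in>{1..<l}. f (x * rtv i k * rtv m l))
        = (\<Sum>m\<in>{1..<l}. f (- x * rtv m l * rtv i k))" .
  qed
  also have "\<dots> = (\<Sum>m\<in>{1..<l}. \<Sum>i\<in>{1..<k}. f (- x * rtv m l * rtv i k))"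
    by (rule sum.swap)
  finally show "jm k (jm l f) x = neg (jm l (jm k f)) x"
    by (simp add: jm_def neg_def)
qed

text \<open>The two squares do not commute with \<open>t_j\<close> separately: \<open>tAA\<close>
  and \<open>tBB\<close> exchange them up to correction terms of degree one. These are opposite, so
  they cancel in the sum; in the product they cancel because \<open>B\<close> commutes with the
  square of \<open>A\<close>.\<close>

lemma jm_sq_commutes_tr:
  fixes f :: "clif \<Rightarrow> 'b::comm_ring_1"
  assumes j: "1 \<le> j"
  defines "A \<equiv> jm j :: (clif \<Rightarrow> 'b) \<Rightarrow> clif \<Rightarrow> 'b" and "B \<equiv> jm (Suc j) :: (clif \<Rightarrow> 'b) \<Rightarrow> clif \<Rightarrow> 'b"
  shows "tr j (A (A f) + B (B f)) = A (A (tr j f)) + B (B (tr j f))"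
    and "tr j (B (B (A (A f)))) = B (B (A (A (tr j f))))"
proof -
  have lin: "A (f + g) = A f + A g" "A (f - g) = A f - A g"
    "B (f + g) = B f + B g" "B (f - g) = B f - B g"
    "A (neg f) = neg (A f)" "B (neg f) = neg (B f)" for f g
    by (simp_all add: A_def B_def jm_linear neg_commutes)
  have tB: "tr j (B f) = neg (A (tr j f)) + f" for f
    using tr_jm_Suc[OF j] by (simp add: A_def B_def)
  have tA: "tr j (A f) = neg (B (tr j f)) - neg f" for f
  proof -
    have "B (tr j f) = neg (tr j (A f)) + f" using jm_Suc_tr[OF j] by (simp add: A_def B_def)
    then have "neg (B (tr j f)) = tr j (A f) + neg f" by (simp add: neg_linear)
    then show ?thesis by simp
  qed
  have AB: "A (B f) = neg (B (A f))" for f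
    unfolding A_def B_def by (rule jm_anticommute) simp
  have tAA: "tr j (A (A f)) = B (B (tr j f)) - B f - neg (A f)" for f
    by (simp add: tA lin neg_linear)
  have tBB: "tr j (B (B f)) = A (A (tr j f)) + neg (A f) + B f" for f
    by (simp add: tB lin neg_linear)
  show "tr j (A (A f) + B (B f)) = A (A (tr j f)) + B (B (tr j f))"
    by (simp add: tr_linear tAA tBB)
  show "tr j (B (B (A (A f)))) = B (B (A (A (tr j f))))"
    by (simp add: tBB tAA lin neg_linear AB)
qed

text \<open>The factors other than those for \<open>j\<close> and \<open>j + 1\<close> commute with
  \<open>t_j\<close> one by one, as the sign of \<open>tr_jm_far\<close> occurs twice. The two
  exceptional factors commute with it only together, and for \<open>j = n\<close> the second of them
  would be missing. The induction is strong because these two are peeled off at once.\<close>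

lemma esym_tr: "1 \<le> j \<Longrightarrow> j \<noteq> n \<Longrightarrow> tr j (esym u n f) = esym u n (tr j f)"
proof (induction n arbitrary: f rule: less_induct)
  case (less n)
  show ?case
  proof (cases n)
    case 0
    then show ?thesis by simp
  next
    case (Suc m)
    show ?thesis
    proof (cases "j = m")
      case False
      then have "tr j (esym u m f) = esym u m (tr j f)" using less Suc by simp
      moreover have "tr j (jm n h) = neg (jm n (tr j h))" for h :: "clif \<Rightarrow> 'a"
        using Suc less.prems False by (intro tr_jm_far) auto
      ultimately show ?thesis
        unfolding Suc esym.simps by (simp only: tr_linear neg_linear neg_commutes)
    next
      case True
      then obtain l where m: "m = Suc l" using less.prems by (cases m) auto
      define g where "g = esym u l f"
      define U :: "clif \<Rightarrow> 'a" where "U = (\<lambda>x. u)"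
      have tg: "tr j g = esym u l (tr j f)" using less Suc True m by (simp add: g_def)
      have exp: "esym u n h = esym u l h + U * (jm j (jm j (esym u l h)) + jm (Suc j) (jm (Suc j) (esym u l h)))
        + U * (U * jm (Suc j) (jm (Suc j) (jm j (jm j (esym u l h)))))" for h
        using Suc True m by (simp add: jm_linear U_def algebra_simps)
      have lin: "tr j (U * h) = U * tr j h" for h by (simp add: U_def tr_linear)
      show ?thesis
        unfolding exp using jm_sq_commutes_tr[OF less.prems(1), of "esym u l f"] tg
        by (simp only: tr_linear(1) lin g_def)
    qed
  qed
qed

lemma jm_left: "jm k (\<lambda>x. f (h * x)) = (\<lambda>x. jm k f (h * x))"
  by (simp add: jm_def mult.assoc)

lemma esym_left: "esym u n (\<lambda>x. f (h * x)) = (\<lambda>x. esym u n f (h * x))"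
proof (induction n)
  case (Suc n)
  show ?case by (simp only: esym.simps Suc.IH jm_left) (simp add: fun_eq_iff)
qed simp

definition delta :: "clif \<Rightarrow> 'b::comm_ring_1" where
  "delta x = (if x = 1 then 1 else 0)"

text \<open>The operators act by right multiplication and so commute with left translations, and at
  \<open>delta\<close> left and right translation by \<open>t_j\<close> agree. Hence commuting with
  \<open>tr j\<close> says that the function is invariant under conjugation by
  \<open>t_j\<close>.\<close>

lemma esym_delta_simple:
  fixes u :: "'b::comm_ring_1"
  assumes "1 \<le> j" "j < n"
  shows "esym u n delta (rtv (Suc j) j * x) = esym u n delta (x * rtv (Suc j) j)"
proof -
  let ?t = "rtv (Suc j) j"
  have sq: "?t * ?t = - 1" by (simp add: rtv_square)
  have "x * ?t = 1 \<longleftrightarrow> ?t * x = 1" for x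
  proof
    assume "x * ?t = 1"
    then have "x * (?t * ?t) = ?t" by (simp flip: mult.assoc)
    then have "?t = - x" using sq by simp
    then show "?t * x = 1" using \<open>x * ?t = 1\<close> by simp
  next
    assume "?t * x = 1"
    then have "(?t * ?t) * x = ?t" by (simp add: mult.assoc)
    then have "?t = - x" using sq by simp
    then show "x * ?t = 1" using \<open>?t * x = 1\<close> by simp
  qed
  then have "tr j (delta :: clif \<Rightarrow> 'b) = (\<lambda>x. delta (?t * x))" by (simp add: tr_def delta_def)
  moreover have "tr j (esym u n delta) = esym u n (tr j delta)"
    using assms by (intro esym_tr) auto
  ultimately have "tr j (esym u n delta) = esym u n (\<lambda>x. delta (?t * x))"
    by (simp only:)
  then show ?thesis unfolding esym_left by (simp add: tr_def fun_eq_iff)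
qed

lemma esym_delta_commute:
  "h \<in> pin n \<Longrightarrow> esym u n delta (h * x) = esym u n delta (x * h)"
proof (induction arbitrary: x rule: pin_induct)
  case (uminus g)
  then show ?case using uminus.IH[of "- x"] by simp
next
  case (simple i g)
  then show ?case
    using esym_delta_simple[of i n u "g * x"] simple.IH[of "x * rtv (Suc i) i"] by (simp add: mult.assoc)
qed simp

lemma esym_delta_conj:
  assumes "h \<in> pin n" "h * g = g' * h"
  shows "esym u n delta g = esym u n delta g'"
proof -
  obtain h' where h': "h * h' = 1" "h' * h = 1" using pin_inverse[OF assms(1)] by blast
  have "g' = h * (g * h')" using h'(1) assms(2) by (metis mult.assoc mult_1_right)
  then show ?thesis
    using esym_delta_commute[OF assms(1), of u "g * h'"] h'(2) by (simp add: mult.assoc)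
qed

text \<open>The conjugating element is the even cycle itself: \<open>g\<close> carries it to its
  rotation, which is z times the cycle, and so the cycle carries \<open>g\<close> to
  \<open>- g\<close>.\<close>

lemma esym_delta_even_cycle:
  assumes "g \<in> pin n" "lifts g 1 \<sigma>" "distinct c" "c \<noteq> []" "even (length c)" "set c \<subseteq> {1..n}"
    "map \<sigma> c = rotate1 c"
  shows "esym u n delta g = esym u n delta (- g)"
proof -
  let ?h = "cyc (n + 1) c"
  have "\<sigma> permutes {1..n}" using pin_lifts[OF assms(1)] lifts_unique(1)[OF assms(2)] by blast
  then have fix_p: "\<sigma> (n + 1) = n + 1" by (auto simp: permutes_def)
  have d: "distinct ((n + 1) # c)" using assms by auto
  have "g * ?h = cyc (n + 1) (rotate1 c) * g"
    using cyc_conj[OF assms(2) fix_p assms(4)] assms(7) by simp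
  then have "?h * g = - g * ?h" using cyc_rotate1_sign[OF d assms(4)] assms(5) by simp
  moreover have "?h \<in> pin n" using d assms by (intro cyc_in_pin) auto
  ultimately show ?thesis by (intro esym_delta_conj)
qed


section \<open>The top coefficients\<close>

definition epoly :: "nat \<Rightarrow> clif \<Rightarrow> int poly" where
  "epoly n = esym [:0, 1:] n delta"

text \<open>In the quotient \<open>- g\<close> counts as the negative of \<open>g\<close>. By
  \<open>pe_eq_iff\<close> these differences are exactly what the quotient remembers of an
  element.\<close>

definition spin_coeff :: "nat \<Rightarrow> nat \<Rightarrow> clif \<Rightarrow> int" where
  "spin_coeff r n g = coeff (epoly n g) r - coeff (epoly n (- g)) r"

lemma epoly_0: "epoly 0 x = (if x = 1 then 1 else 0)"
  by (simp add: epoly_def delta_def)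

lemma epoly_Suc: "epoly (Suc n) x = epoly n x +
    [:0, 1:] * (\<Sum>a\<in>{1..n}. \<Sum>b\<in>{1..n}. epoly n (x * rtv a (Suc n) * rtv b (Suc n)))"
  by (simp add: epoly_def jm_def atLeastLessThanSuc_atLeastAtMost del: mult_pCons_left)

lemma coeff_epoly_Suc: "coeff (epoly (Suc n) x) r = coeff (epoly n x) r +
    (case r of 0 \<Rightarrow> 0 | Suc r' \<Rightarrow>
      \<Sum>a\<in>{1..n}. \<Sum>b\<in>{1..n}. coeff (epoly n (x * rtv a (Suc n) * rtv b (Suc n))) r')"
  unfolding epoly_Suc by (cases r) (simp_all add: coeff_sum)

lemma spin_coeff_Suc: "spin_coeff r (Suc n) g = spin_coeff r n g +
    (case r of 0 \<Rightarrow> 0 | Suc r' \<Rightarrow>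
      \<Sum>a\<in>{1..n}. \<Sum>b\<in>{1..n}. spin_coeff r' n (g * rtv a (Suc n) * rtv b (Suc n)))"
  by (cases r) (simp_all add: spin_coeff_def coeff_epoly_Suc sum_subtractf)

lemma spin_coeff_uminus: "spin_coeff r n (- g) = - spin_coeff r n g"
  by (simp add: spin_coeff_def)

text \<open>A labelling constant on the orbits of \<open>\<sigma>\<close> that takes at least \<open>N - q\<close> values: such a labelling
  exists if \<open>\<sigma>\<close> is a product of \<open>q\<close> transpositions, and forces the cycles of \<open>\<sigma>\<close> to be short.\<close>

definition labelled :: "nat \<Rightarrow> nat \<Rightarrow> (nat \<Rightarrow> nat) \<Rightarrow> bool" where
  "labelled q N \<sigma> \<longleftrightarrow> (\<exists>L::nat \<Rightarrow> nat. (\<forall>i. L (\<sigma> i) = L i) \<and> N \<le> card (L ` {1..N}) + q)"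

text \<open>Identifying the labels of \<open>a\<close> and \<open>b\<close> restores invariance
  under the additional transposition and loses at most one label.\<close>

lemma labelled_transpose:
  assumes "labelled q N \<sigma>"
  shows "labelled (Suc q) N (\<sigma> \<circ> transpose a b)"
proof -
  obtain L :: "nat \<Rightarrow> nat" where L: "\<And>i. L (\<sigma> i) = L i" "N \<le> card (L ` {1..N}) + q"
    using assms by (auto simp: labelled_def)
  define L' where "L' i = (if L i = L b then L a else L i)" for i
  have "L' ((\<sigma> \<circ> transpose a b) i) = L' i" for i
    by (auto simp: L'_def L(1) transpose_def)
  moreover have "card (L ` {1..N}) \<le> Suc (card (L' ` {1..N}))"
  proof -
    have "L ` {1..N} \<subseteq> insert (L b) (L' ` {1..N})" by (auto simp: L'_def image_iff)
    then have "card (L ` {1..N}) \<le> card (insert (L b) (L' ` {1..N}))" by (intro card_mono) auto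
    also have "\<dots> \<le> Suc (card (L' ` {1..N}))" by (simp add: card_insert_le_m1)
    finally show ?thesis .
  qed
  ultimately show ?thesis using L(2) unfolding labelled_def by (intro exI[of _ L']) auto
qed

lemma rotate1_fixed_constant:
  assumes "rotate1 xs = xs" "x \<in> set xs"
  shows "x = hd xs"
proof -
  have "xs ! i = xs ! 0" if "i < length xs" for i
    using that
  proof (induction i)
    case (Suc i)
    have "xs ! i = xs ! Suc i"
      using nth_rotate1[of i xs] assms(1) Suc.prems by simp
    then show ?case using Suc by simp
  qed simp
  then show ?thesis using assms(2) by (metis hd_conv_nth in_set_conv_nth length_pos_if_in_set less_numeral_extra(3) list.size(3))
qed

text \<open>The label is constant on a cycle, so a cycle of length l loses l - 1 of the possible
  labels, and at most \<open>q\<close> may be lost.\<close>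

lemma labelled_cycles:
  assumes "labelled q N \<sigma>" "distinct (concat css)" "set (concat css) \<subseteq> {1..N}"
    "\<And>c. c \<in> set css \<Longrightarrow> c \<noteq> [] \<and> map \<sigma> c = rotate1 c"
  shows "(\<Sum>c\<leftarrow>css. length c - 1) \<le> q"
proof -
  obtain L :: "nat \<Rightarrow> nat" where L: "\<And>i. L (\<sigma> i) = L i" "N \<le> card (L ` {1..N}) + q"
    using assms(1) by (auto simp: labelled_def)
  have const: "L x = L (hd c)" if "c \<in> set css" "x \<in> set c" for x c
  proof -
    have "map L c = map L (map \<sigma> c)" using L(1) by simp
    also have "\<dots> = rotate1 (map L c)" using assms(4)[OF that(1)] by (simp add: rotate1_map)
    finally show ?thesis
      using rotate1_fixed_constant[of "map L c" "L x"] that assms(4)[OF that(1)] by (simp add: hd_map)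
  qed
  have "L ` {1..N} \<subseteq> L ` ({1..N} - set (concat css)) \<union> (\<lambda>c. L (hd c)) ` set css"
    using const by fastforce
  then have "card (L ` {1..N}) \<le> card (L ` ({1..N} - set (concat css)) \<union> (\<lambda>c. L (hd c)) ` set css)"
    by (intro card_mono) auto
  also have "\<dots> \<le> card (L ` ({1..N} - set (concat css))) + card ((\<lambda>c. L (hd c)) ` set css)"
    by (rule card_Un_le)
  also have "\<dots> \<le> card ({1..N} - set (concat css)) + length css"
    by (intro add_mono card_image_le) (auto intro: order_trans[OF card_image_le] card_length)
  also have "card ({1..N} - set (concat css)) = N - length (concat css)"
    using card_Diff_subset[OF finite_set assms(3)] distinct_card[OF assms(2)] by simp
  finally have *: "card (L ` {1..N}) \<le> N - length (concat css) + length css" .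
  have "length (concat css) \<le> N"
    using card_mono[OF _ assms(3)] distinct_card[OF assms(2)] by simp
  moreover have "(\<Sum>c\<leftarrow>css. length c - 1) + length css = length (concat css)"
    using assms(4) by (induction css) (auto simp: Suc_leI)
  ultimately show ?thesis using * L(2) by linarith
qed

lemma pin_mono_Suc: "pin n \<subseteq> pin (Suc n)"
  unfolding pin_def words_def by (intro image_mono lists_mono) (auto simp: cover_gens_def)

lemma lifts_mult_pair:
  assumes "lifts g 1 \<sigma>" "a \<noteq> k" "b \<noteq> k"
  shows "lifts (g * rtv a k * rtv b k) 1 (\<sigma> \<circ> transpose a k \<circ> transpose b k)"
  using lifts_mult[OF lifts_mult[OF assms(1) lifts_rtv[OF assms(2)]] lifts_rtv[OF assms(3)]] by simp

text \<open>Elements occurring at the power \<open>r\<close> are products of \<open>2 * r\<close>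
  root vectors \<open>[a, k]\<close> up to sign, each of which costs one label. All
  \<open>N \<ge> n\<close> are allowed so that cycles reaching beyond \<open>n\<close> can be tested
  as well.\<close>

lemma epoly_support:
  "coeff (epoly n x) r \<noteq> 0 \<Longrightarrow>
    x \<in> pin n \<and> (\<exists>\<sigma>. lifts x 1 \<sigma> \<and> \<sigma> permutes {1..n} \<and> (\<forall>N\<ge>n. labelled (2 * r) N \<sigma>))"
proof (induction n arbitrary: x r)
  case 0
  then have "x = 1" by (auto simp: epoly_0 split: if_splits)
  moreover have "labelled (2 * r) N id" for N
    unfolding labelled_def by (intro exI[of _ id]) simp
  ultimately show ?case using lifts_one permutes_id pin_one by blast
next
  case (Suc n)
  let ?k = "Suc n"
  show ?case
  proof (cases "coeff (epoly n x) r = 0")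
    case False
    then obtain \<sigma> where "x \<in> pin n" "lifts x 1 \<sigma>" "\<sigma> permutes {1..n}" "\<forall>N\<ge>n. labelled (2 * r) N \<sigma>"
      using Suc.IH by blast
    moreover have "\<sigma> permutes {1..Suc n}" by (rule permutes_subset[OF \<open>\<sigma> permutes {1..n}\<close>]) auto
    ultimately show ?thesis using pin_mono_Suc by (auto intro!: exI[of _ \<sigma>])
  next
    case True
    then obtain r' where r: "r = Suc r'" and
      "(\<Sum>a\<in>{1..n}. \<Sum>b\<in>{1..n}. coeff (epoly n (x * rtv a ?k * rtv b ?k)) r') \<noteq> 0"
      using Suc.prems by (cases r) (auto simp: coeff_epoly_Suc)
    then obtain a b where ab: "a \<in> {1..n}" "b \<in> {1..n}"
      and nz: "coeff (epoly n (x * rtv a ?k * rtv b ?k)) r' \<noteq> 0"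
      by (meson sum.not_neutral_contains_not_neutral)
    let ?y = "x * rtv a ?k * rtv b ?k"
    obtain \<tau> where \<tau>: "?y \<in> pin n" "lifts ?y 1 \<tau>" "\<tau> permutes {1..n}" "\<forall>N\<ge>n. labelled (2 * r') N \<tau>"
      using Suc.IH[OF nz] by blast
    have sq: "rtv a ?k * rtv a ?k = - 1" "rtv b ?k * rtv b ?k = - 1"
      using ab by (auto intro!: rtv_square)
    have x: "x = ?y * rtv b ?k * rtv a ?k"
      by (simp add: mult.assoc sq)
    have "?y \<in> pin (Suc n)" "rtv b ?k \<in> pin (Suc n)" "rtv a ?k \<in> pin (Suc n)"
      using ab \<tau>(1) pin_mono_Suc by (auto intro!: pin_rtv)
    then have "?y * rtv b ?k * rtv a ?k \<in> pin (Suc n)" by (rule pin_mult[OF pin_mult])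
    then have "x \<in> pin (Suc n)" by (simp only: x [symmetric])
    moreover have "lifts x 1 (\<tau> \<circ> transpose b ?k \<circ> transpose a ?k)"
      using ab \<tau>(2) by (subst x) (intro lifts_mult_pair; auto)
    moreover have "\<tau> \<circ> transpose b ?k \<circ> transpose a ?k permutes {1..Suc n}"
      using ab by (intro permutes_compose permutes_swap_id permutes_subset[OF \<tau>(3)]) auto
    moreover have "labelled (2 * r) N (\<tau> \<circ> transpose b ?k \<circ> transpose a ?k)" if "N \<ge> Suc n" for N
      using labelled_transpose[OF labelled_transpose] \<tau>(4) that r by simp
    ultimately show ?thesis by blast
  qed
qed

lemma spin_coeff_nonzero:
  assumes "spin_coeff r n g \<noteq> 0" "lifts g s \<sigma>"
  shows "g \<in> pin n" "s = 1" "\<sigma> permutes {1..n}" "N \<ge> n \<Longrightarrow> labelled (2 * r) N \<sigma>"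
proof -
  consider "coeff (epoly n g) r \<noteq> 0" | "coeff (epoly n (- g)) r \<noteq> 0"
    using assms(1) by (force simp: spin_coeff_def)
  then have "g \<in> pin n \<and> (\<exists>\<tau>. lifts g 1 \<tau> \<and> \<tau> permutes {1..n} \<and> (\<forall>N\<ge>n. labelled (2 * r) N \<tau>))"
  proof cases
    case 2
    then show ?thesis using epoly_support[OF 2] lifts_uminus[of "- g"] by auto
  qed (rule epoly_support)
  then obtain \<tau> where \<tau>: "lifts g 1 \<tau>" "g \<in> pin n" "\<tau> permutes {1..n}" "\<And>N. N \<ge> n \<Longrightarrow> labelled (2 * r) N \<tau>"
    by blast
  then show "g \<in> pin n" "s = 1" "\<sigma> permutes {1..n}" "N \<ge> n \<Longrightarrow> labelled (2 * r) N \<sigma>"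
    using lifts_unique[OF assms(2) \<tau>(1)] by auto
qed

lemma spin_coeff_moved:
  "lifts g s \<sigma> \<Longrightarrow> \<sigma> j \<noteq> j \<Longrightarrow> j \<notin> {1..n} \<Longrightarrow> spin_coeff r n g = 0"
  using spin_coeff_nonzero(3) permutes_not_in by metis

text \<open>Cycles of total excess (length minus one) greater than \<open>2 * r\<close> cannot be
  produced by \<open>2 * r\<close> transpositions.\<close>

lemma spin_coeff_long_cycles:
  assumes "lifts g s \<sigma>" "distinct (concat css)" "set (concat css) \<subseteq> {1..m}"
    "\<And>c. c \<in> set css \<Longrightarrow> c \<noteq> [] \<and> map \<sigma> c = rotate1 c"
    "2 * r < (\<Sum>c\<leftarrow>css. length c - 1)"
  shows "spin_coeff r n g = 0"
proof (rule ccontr)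
  assume "spin_coeff r n g \<noteq> 0"
  then have "labelled (2 * r) (max m n) \<sigma>" using spin_coeff_nonzero(4) assms(1) by simp
  then have "(\<Sum>c\<leftarrow>css. length c - 1) \<le> 2 * r"
    using assms by (intro labelled_cycles[of _ "max m n" \<sigma>]) force+
  then show False using assms(5) by simp
qed

lemma spin_coeff_even_cycle:
  assumes "lifts g s \<sigma>" "distinct c" "c \<noteq> []" "even (length c)" "set c \<subseteq> {1..n}"
    "map \<sigma> c = rotate1 c"
  shows "spin_coeff r n g = 0"
proof (rule ccontr)
  assume nz: "spin_coeff r n g \<noteq> 0"
  then have "epoly n g = epoly n (- g)"
    using assms spin_coeff_nonzero[OF nz assms(1)] unfolding epoly_def
    by (intro esym_delta_even_cycle[of g n \<sigma> c]) auto
  then show False using nz by (simp add: spin_coeff_def)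
qed

section \<open>Products of disjoint odd cycles\<close>

lemma cyc_commute:
  assumes "lifts g 1 \<sigma>" "\<sigma> p = p" "\<forall>x\<in>set c. \<sigma> x = x" "c \<noteq> []"
  shows "g * cyc p c = cyc p c * g"
  using cyc_conj[OF assms(1,2,4)] assms(3) map_idI[of c \<sigma>] by simp

definition prodcyc :: "nat \<Rightarrow> nat list list \<Rightarrow> clif" where
  "prodcyc p css = prod_list (map (cyc p) css)"

lemma prodcyc_simps [simp]:
  "prodcyc p [] = 1" "prodcyc p (c # css) = cyc p c * prodcyc p css"
  by (simp_all add: prodcyc_def)

lemma lifts_odd_cyc:
  assumes "distinct (p # c)" "odd (length c)"
  shows "lifts (cyc p c) 1 (cycle_of_list c)"
proof -
  have "c \<noteq> []" using assms(2) by auto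
  then show ?thesis using lifts_cyc[OF assms(1)] assms(2) by simp
qed

lemma lifts_prodcyc:
  assumes "distinct (p # concat css)" "\<forall>c\<in>set css. odd (length c)"
  shows "\<exists>\<sigma>. lifts (prodcyc p css) 1 \<sigma> \<and> (\<forall>c\<in>set css. map \<sigma> c = rotate1 c) \<and> \<sigma> permutes set (concat css)"
  using assms
proof (induction css)
  case Nil
  then show ?case using lifts_one by (auto intro!: exI[of _ id] simp: permutes_id)
next
  case (Cons c css)
  then obtain \<sigma> where \<sigma>: "lifts (prodcyc p css) 1 \<sigma>" "\<forall>c\<in>set css. map \<sigma> c = rotate1 c"
    "\<sigma> permutes set (concat css)" by auto
  let ?\<tau> = "cycle_of_list c \<circ> \<sigma>"
  have "lifts (prodcyc p (c # css)) (1 * 1) ?\<tau>"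
    unfolding prodcyc_simps using Cons.prems \<sigma>(1) by (intro lifts_mult lifts_odd_cyc) auto
  moreover have "map ?\<tau> c = rotate1 c"
  proof -
    have "map \<sigma> c = c" using Cons.prems by (intro map_idI permutes_not_in[OF \<sigma>(3)]) auto
    then have "map ?\<tau> c = map (cycle_of_list c) c" by (metis map_map)
    also have "\<dots> = rotate1 c" using cyclic_rotation[of c 1] Cons.prems by simp
    finally show ?thesis .
  qed
  moreover have "map ?\<tau> d = rotate1 d" if "d \<in> set css" for d
  proof -
    have "map ?\<tau> d = map (cycle_of_list c) (rotate1 d)" using \<sigma>(2) that by (metis map_map)
    also have "\<dots> = rotate1 d"
      using Cons.prems that by (intro map_idI id_outside_supp) auto
    finally show ?thesis .
  qed
  moreover have "?\<tau> permutes set (concat (c # css))"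
    by (intro permutes_compose permutes_subset[OF \<sigma>(3)] permutes_subset[OF cycle_permutes]) auto
  ultimately show ?case by (intro exI[of _ ?\<tau>]) (simp del: comp_apply)
qed

lemma cyc_prodcyc_commute:
  assumes "distinct (p # c @ concat css)" "\<forall>d\<in>set css. odd (length d)" "c \<noteq> []"
  shows "prodcyc p css * cyc p c = cyc p c * prodcyc p css"
proof -
  obtain \<sigma> where \<sigma>: "lifts (prodcyc p css) 1 \<sigma>" "\<sigma> permutes set (concat css)"
    using lifts_prodcyc[of p css] assms by auto
  show ?thesis
    by (rule cyc_commute[OF \<sigma>(1)]) (use assms in \<open>auto intro!: permutes_not_in[OF \<sigma>(2)]\<close>)
qed

lemma prodcyc_rtv_commute:
  assumes "distinct (p # concat css)" "\<forall>d\<in>set css. odd (length d)"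
    "i \<notin> set (concat css)" "j \<notin> set (concat css)"
  shows "prodcyc p css * rtv i j = rtv i j * prodcyc p css"
proof -
  obtain \<sigma> where \<sigma>: "lifts (prodcyc p css) 1 \<sigma>" "\<sigma> permutes set (concat css)"
    using lifts_prodcyc[of p css] assms by auto
  then show ?thesis
    using lifts_rtv_conj[OF \<sigma>(1), of i j] assms permutes_not_in[OF \<sigma>(2)] by simp
qed

lemma prodcyc_move_front:
  assumes "distinct (p # concat (A @ c # B))" "\<forall>d\<in>set (A @ c # B). odd (length d)"
  shows "prodcyc p (A @ c # B) = cyc p c * prodcyc p (A @ B)"
  using assms
proof (induction A)
  case (Cons a A)
  have "c \<noteq> []" using Cons.prems(2) by auto
  then have "prodcyc p [a] * cyc p c = cyc p c * prodcyc p [a]"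
    using Cons.prems by (intro cyc_prodcyc_commute) auto
  then show ?case using Cons by (simp flip: mult.assoc)
qed simp

section \<open>Removing the largest point from a cycle\<close>

lemma cyc_cut:
  assumes "distinct (p # k # v)" "odd (length v)"
  shows "cyc p (k # v) * rtv (last v) k = - cyc p v"
proof -
  obtain v0 b where v: "v = v0 @ [b]" using assms(2) by (cases v rule: rev_cases) auto
  define P where "P = prod_list (map (rtv p) (rev v0))"
  have sq: "rtv p k * rtv p k = - 1" "rtv p b * rtv p b = - 1"
    using assms v by (auto intro!: rtv_square)
  have "rtv p k * rtv p b = - rtv k b * rtv p k"
    using lifts_rtv_conj[OF lifts_rtv[of p k], of p b] assms v by (simp add: transpose_def)
  then have "rtv p k * rtv p b * rtv p k = rtv k b" by (simp add: mult.assoc sq)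
  then have bk: "rtv b k = - (rtv p k * rtv p b * rtv p k)" using rtv_swap[of k b] by simp
  have c: "cyc p (b # v0) = rtv p b * P * rtv p b" by (simp add: cyc_def P_def mult.assoc)
  \<comment> \<open>Here the odd length enters: the last point may be put in front without a
    sign.\<close>
  have "cyc p (rotate1 (b # v0)) = cyc p (b # v0)"
    using cyc_rotate[of p "b # v0" 1] assms v by simp
  then have cv: "cyc p v = rtv p b * P * rtv p b" using c v by simp
  have "cyc p (k # v) * rtv b k = - (rtv p k * rtv p b * P * (rtv p k * rtv p k) * rtv p b * rtv p k)"
    by (simp add: bk cyc_def v P_def mult.assoc)
  also have "\<dots> = rtv p k * (rtv p b * P * rtv p b) * rtv p k"
    by (simp add: sq mult.assoc)
  also have "\<dots> = rtv p k * (cyc p v * rtv p k)" by (simp add: cv mult.assoc)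
  also have "cyc p v * rtv p k = rtv p k * cyc p v"
    using prodcyc_rtv_commute[of p "[v]" p k] assms by simp
  also have "rtv p k * (rtv p k * cyc p v) = - cyc p v"
    by (simp add: sq flip: mult.assoc)
  finally show ?thesis by (simp add: v)
qed

text \<open>Up to sign the cycle is the product of the two even cycles \<open>k # w\<close> and
  \<open>k # v\<close>, and each of the two factors on the right frees one of them from
  \<open>k\<close>. The minus sign that survives is the sign of the Catalan recursion.\<close>

lemma cyc_split:
  assumes "distinct (p # k # v @ w)" "odd (length v)" "odd (length w)"
  shows "cyc p (k # v @ w) * rtv (last v) k * rtv (last w) k = - (cyc p v * cyc p w)"
proof -
  have ne: "v \<noteq> []" "w \<noteq> []" using assms by auto
  have sq: "rtv p k * rtv p k = - 1" using assms by (intro rtv_square) auto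
  have "cyc p (k # w) * cyc p (k # v)
    = rtv p k * prod_list (map (rtv p) (rev w)) * (rtv p k * rtv p k) * prod_list (map (rtv p) (rev v)) * rtv p k"
    by (simp add: cyc_def mult.assoc)
  also have "\<dots> = - cyc p (k # v @ w)"
    by (simp add: cyc_def sq mult.assoc)
  finally have "cyc p (k # v @ w) = - (cyc p (k # w) * cyc p (k # v))" by simp
  then have "cyc p (k # v @ w) * rtv (last v) k * rtv (last w) k
    = - (cyc p (k # w) * (cyc p (k # v) * rtv (last v) k) * rtv (last w) k)"
    by (simp add: mult.assoc)
  also have "\<dots> = cyc p (k # w) * (cyc p v * rtv (last w) k)"
    using assms cyc_cut[of p k v] by (simp add: mult.assoc)
  also have "cyc p v * rtv (last w) k = rtv (last w) k * cyc p v"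
  proof -
    have "last w \<notin> set v" using assms(1) last_in_set[OF ne(2)] by auto
    then show ?thesis using prodcyc_rtv_commute[of p "[v]" "last w" k] assms by simp
  qed
  also have "cyc p (k # w) * (rtv (last w) k * cyc p v) = - (cyc p w * cyc p v)"
    using cyc_cut[of p k w] assms by (simp flip: mult.assoc)
  also have "cyc p w * cyc p v = cyc p v * cyc p w"
    using cyc_prodcyc_commute[of p v "[w]"] assms ne by auto
  finally show ?thesis .
qed

text \<open>The square of the last Jucys-Murphy element contributes nothing. Terms with
  \<open>a = b\<close> give \<open>g\<close> back up to sign, whose excess is too large for
  \<open>r - 1\<close>; terms with \<open>a \<noteq> b\<close> move the point
  \<open>n + 1\<close>.\<close>

lemma spin_coeff_fixed_point:
  assumes css: "distinct (concat css)" "set (concat css) \<subseteq> {1..n}" "\<forall>c\<in>set css. odd (length c)"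
    and r: "(\<Sum>c\<leftarrow>css. length c - 1) = 2 * r" and p: "n < p"
  shows "spin_coeff r (Suc n) (prodcyc p css) = spin_coeff r n (prodcyc p css)"
proof (cases r)
  case (Suc r')
  let ?g = "prodcyc p css" and ?k = "Suc n"
  obtain \<sigma> where \<sigma>: "lifts ?g 1 \<sigma>" "\<forall>c\<in>set css. map \<sigma> c = rotate1 c" "\<sigma> permutes set (concat css)"
    using lifts_prodcyc[of p css] css p by fastforce
  have k: "\<sigma> ?k = ?k" using css(2) by (intro permutes_not_in[OF \<sigma>(3)]) auto
  have "spin_coeff r' n (?g * rtv a ?k * rtv b ?k) = 0" if ab: "a \<in> {1..n}" "b \<in> {1..n}" for a b
  proof (cases "a = b")
    case True
    have "?g * rtv a ?k * rtv b ?k = - ?g"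
      using ab True by (simp add: mult.assoc rtv_square)
    moreover have "spin_coeff r' n ?g = 0"
      using css(1,2) \<sigma>(2) css(3) r Suc by (intro spin_coeff_long_cycles[OF \<sigma>(1)]) auto
    ultimately show ?thesis by (simp add: spin_coeff_uminus)
  next
    case False
    have "\<sigma> b \<noteq> ?k" using k ab injD[OF permutes_inj[OF \<sigma>(3)], of b ?k] by auto
    then show ?thesis
      using ab False by (intro spin_coeff_moved[OF lifts_mult_pair[OF \<sigma>(1)], where j = ?k])
        (auto simp: transpose_def)
  qed
  then show ?thesis by (simp add: spin_coeff_Suc Suc)
qed (simp add: spin_coeff_Suc)

text \<open>The first factor joins the cycles of \<open>a\<close> and \<open>k\<close> and the
  second one releases \<open>k\<close>, so the total excess is the same as before and still exceeds
  \<open>2 * r\<close>.\<close>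

lemma long_cycle_merge:
  assumes d: "distinct (k # us @ concat D)" and k: "set (k # us @ concat D) \<subseteq> {1..Suc n}"
    and \<sigma>: "lifts g 1 \<sigma>" "map \<sigma> (k # us) = rotate1 (k # us)" "\<forall>c\<in>set D. map \<sigma> c = rotate1 c"
      "\<sigma> permutes set (k # us @ concat D)"
    and D: "\<forall>c\<in>set D. odd (length c)" and us: "us \<noteq> []"
    and a: "a \<in> {1..n}" "a \<noteq> k" "a \<notin> set us"
    and r: "2 * r < length us + (\<Sum>c\<leftarrow>D. length c - 1)"
  shows "spin_coeff r n (g * rtv a k * rtv (last us) k) = 0"
proof -
  \<comment> \<open>\<open>a # ds\<close> is the cycle of \<open>a\<close>, rotated to start there,
    with \<open>ds\<close> empty for a fixed point; \<open>D'\<close> holds the other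
    cycles.\<close>
  obtain ds D' where ds: "distinct (k # us @ a # ds @ concat D')"
      "set (k # us @ a # ds @ concat D') \<subseteq> {1..Suc n}"
      "map \<sigma> (a # ds) = rotate1 (a # ds)" "\<forall>c\<in>set D'. c \<noteq> [] \<and> map \<sigma> c = rotate1 c"
      "(\<Sum>c\<leftarrow>D'. length c - 1) + length ds = (\<Sum>c\<leftarrow>D. length c - 1)"
  proof (cases "a \<in> set (concat D)")
    case False
    then have "\<sigma> a = a" using a by (intro permutes_not_in[OF \<sigma>(4)]) auto
    moreover have "\<forall>c\<in>set D. c \<noteq> []" using D by auto
    ultimately show ?thesis using that[of "[]" D] False d k a \<sigma>(3) by auto
  next
    case True
    then obtain e where e: "e \<in> set D" "a \<in> set e" by auto
    obtain A B where D_eq: "D = A @ e # B" using e(1) split_list by metis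
    obtain e1 e2 where e_eq: "e = e1 @ a # e2" using e(2) split_list by metis
    have rot: "rotate (length e1) e = a # e2 @ e1" by (simp add: e_eq rotate_append)
    have "map \<sigma> (rotate (length e1) e) = rotate1 (rotate (length e1) e)"
      using \<sigma>(3) e(1) by (simp add: rotate1_rotate_swap flip: rotate_map)
    then have "map \<sigma> (a # e2 @ e1) = rotate1 (a # e2 @ e1)" by (simp only: rot)
    moreover have "c \<noteq> []" if "c \<in> set D" for c using D that by (cases c) auto
    moreover have meq: "mset (k # us @ a # (e2 @ e1) @ concat (A @ B)) = mset (k # us @ concat D)"
      by (simp add: D_eq e_eq)
    moreover have "(\<Sum>c\<leftarrow>A @ B. length c - 1) + length (e2 @ e1) = (\<Sum>c\<leftarrow>D. length c - 1)"
      by (simp add: D_eq e_eq)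
    moreover have "distinct (k # us @ a # (e2 @ e1) @ concat (A @ B))"
      using d mset_eq_imp_distinct_iff[OF meq] by simp
    moreover have "set (k # us @ a # (e2 @ e1) @ concat (A @ B)) \<subseteq> {1..Suc n}"
      using k mset_eq_setD[OF meq] by (simp only:)
    ultimately show ?thesis
      using that[of "e2 @ e1" "A @ B"] \<sigma>(3) D_eq by simp
  qed
  obtain u0 l where u0: "us = u0 @ [l]" using us by (cases us rule: rev_cases) auto
  let ?c = "us @ ds @ [a]" and ?\<tau> = "\<sigma> \<circ> transpose a k \<circ> transpose l k"
  have "\<sigma> k # map \<sigma> u0 = us" "\<sigma> l = k"
    using \<sigma>(2) by (simp_all add: u0)
  have "map ?\<tau> ?c = rotate1 ?c"
  proof -
    have m: "map ?\<tau> u0 = map \<sigma> u0" "map ?\<tau> ds = map \<sigma> ds"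
      using ds(1) u0 by (auto simp: transpose_def)
    have "?\<tau> l = \<sigma> a" "?\<tau> a = \<sigma> k"
      using ds(1) u0 by (auto simp: transpose_def)
    then have "map ?\<tau> ?c = map \<sigma> u0 @ map \<sigma> (a # ds) @ [\<sigma> k]"
      using m unfolding u0 by simp
    also have "\<dots> = map \<sigma> u0 @ ds @ [a, \<sigma> k]" by (simp only: ds(3)) simp
    also have "\<dots> = rotate1 ((\<sigma> k # map \<sigma> u0) @ ds @ [a])" by simp
    finally show ?thesis by (simp only: \<open>\<sigma> k # map \<sigma> u0 = us\<close>)
  qed
  moreover have "lifts (g * rtv a k * rtv l k) 1 ?\<tau>"
    using ds(1) u0 a by (intro lifts_mult_pair[OF \<sigma>(1)]) auto
  moreover have "map ?\<tau> c = rotate1 c" if "c \<in> set D'" for c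
  proof -
    have "map ?\<tau> c = map \<sigma> c" using that ds(1) u0 by (auto simp: transpose_def)
    then show ?thesis using ds(4) that by simp
  qed
  moreover have "distinct (concat (?c # D'))" "set (concat (?c # D')) \<subseteq> {1..Suc n}"
    using ds(1,2) by auto
  moreover have "2 * r < (\<Sum>c\<leftarrow>?c # D'. length c - 1)" using ds(5) r by simp
  ultimately have "spin_coeff r n (g * rtv a k * rtv l k) = 0"
    using ds(4) by (intro spin_coeff_long_cycles[where css = "?c # D'" and m = "Suc n"])
      (simp_all del: map_append rotate1.simps concat.simps comp_apply, blast?)
  then show ?thesis by (simp add: u0)
qed

text \<open>After the two factors \<open>v\<close> is a cycle of its own, and its length is
  even.\<close>

lemma even_cycle_cut:
  assumes d: "distinct (k # v @ w)" "set (v @ w) \<subseteq> {1..n}" "v \<noteq> []" "w \<noteq> []" "even (length v)"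
    and \<sigma>: "lifts g 1 \<sigma>" "map \<sigma> (k # v @ w) = rotate1 (k # v @ w)"
  shows "spin_coeff r n (g * rtv (last v) k * rtv (last w) k) = 0"
proof -
  obtain v0 a where v0: "v = v0 @ [a]" using d by (cases v rule: rev_cases) auto
  obtain w0 l where w0: "w = w0 @ [l]" using d by (cases w rule: rev_cases) auto
  let ?\<tau> = "\<sigma> \<circ> transpose a k \<circ> transpose l k"
  have "map \<sigma> (k # v0) @ (\<sigma> a # map \<sigma> w) = v @ (w @ [k])" using \<sigma>(2) by (simp add: v0)
  then have \<sigma>v: "map \<sigma> (k # v0) = v" by (rule append_eq_append_conv[THEN iffD1, THEN conjunct1, rotated]) (simp add: v0)
  have "map ?\<tau> v0 = map \<sigma> v0" "?\<tau> a = \<sigma> k"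
    using d v0 w0 by (auto simp: transpose_def)
  then have "map ?\<tau> v = rotate1 (map \<sigma> (k # v0))" unfolding v0 by simp
  then have "map ?\<tau> v = rotate1 v" by (simp only: \<sigma>v)
  moreover have "lifts (g * rtv a k * rtv l k) 1 ?\<tau>"
    using d v0 w0 by (intro lifts_mult_pair[OF \<sigma>(1)]) auto
  ultimately have "spin_coeff r n (g * rtv a k * rtv l k) = 0"
    using d by (intro spin_coeff_even_cycle) auto
  then show ?thesis by (simp add: v0 w0)
qed

text \<open>A cut after position \<open>q\<close> leaves pieces with \<open>q + 1\<close> and
  \<open>2 * s - 1 - q\<close> points, both odd exactly for even \<open>q\<close>. The outer minus
  is that of \<open>cyc_split\<close>; the inner ones are the values of the two pieces.\<close>

lemma catalan_sum_even:
  assumes "0 < s"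
  shows "(\<Sum>q<2 * s - 1. if even q then - (- int (catalan (q div 2)) * - int (catalan ((2 * s - 1 - q) div 2))) else 0)
    = - int (catalan s)"
proof -
  obtain t where s: "s = Suc t" using assms by (cases s) auto
  have "(\<Sum>q<2 * s - 1. if even q then - (- int (catalan (q div 2)) * - int (catalan ((2 * s - 1 - q) div 2))) else 0)
    = (\<Sum>q\<in>(\<lambda>i. 2 * i) ` {..t}. - (int (catalan (q div 2)) * int (catalan ((2 * s - 1 - q) div 2))))"
    by (rule sum.mono_neutral_cong_right) (auto simp: s elim!: evenE)
  also have "\<dots> = (\<Sum>i\<le>t. - (int (catalan i) * int (catalan (t - i))))"
  proof (subst sum.reindex)
    show "inj_on (\<lambda>i. 2 * i) {..t}" by (auto simp: inj_on_def)
    have "(2 * s - 1 - 2 * i) div 2 = t - i" if "i \<le> t" for i using that s by simp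
    then show "(\<Sum>i\<le>t. ((\<lambda>q. - (int (catalan (q div 2)) * int (catalan ((2 * s - 1 - q) div 2)))) \<circ> (*) 2) i)
      = (\<Sum>i\<le>t. - (int (catalan i) * int (catalan (t - i))))"
      by (intro sum.cong) simp_all
  qed
  also have "\<dots> = - int (catalan s)" by (simp add: s sum_negf)
  finally show ?thesis .
qed

lemma subset_atLeastAtMost_Suc: "S \<subseteq> {1..Suc n} \<Longrightarrow> Suc n \<notin> S \<Longrightarrow> S \<subseteq> {1..n}"
proof
  fix x assume "S \<subseteq> {1..Suc n}" "Suc n \<notin> S" "x \<in> S"
  then have "x \<in> {1..Suc n}" "x \<noteq> Suc n" by blast+
  then show "x \<in> {1..n}" by auto
qed

text \<open>Suppose that the largest point k is moved. A term \<open>[a, k] [b, k]\<close>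
  contributes only if b is the predecessor of k in its cycle, since otherwise k remains moved; if a
  lies in the same cycle, since otherwise cycles merge and get too long; and if both pieces are odd.
  The induction hypothesis applies to the pieces together with the other cycles.\<close>

theorem spin_coeff_top:
  assumes "distinct (concat css)" "set (concat css) \<subseteq> {1..n}" "\<forall>c\<in>set css. odd (length c)"
    "(\<Sum>c\<leftarrow>css. length c - 1) = 2 * r" "n < p"
  shows "spin_coeff r n (prodcyc p css) = (\<Prod>c\<leftarrow>css. - int (catalan (length c div 2)))"
  using assms
proof (induction n arbitrary: css r)
  case 0
  then have "css = []" by (cases css) auto
  moreover have "(- 1 :: clif) \<noteq> 1" using clif_double[of 1] by (metis one_neq_zero)
  ultimately show ?case using 0 by (simp add: spin_coeff_def epoly_0)
next
  case (Suc n)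
  let ?k = "Suc n"
  have fixed: "spin_coeff r (Suc n) (prodcyc p D) = (\<Prod>c\<leftarrow>D. - int (catalan (length c div 2)))"
    if "distinct (concat D)" "set (concat D) \<subseteq> {1..n}" "\<forall>c\<in>set D. odd (length c)"
      "(\<Sum>c\<leftarrow>D. length c - 1) = 2 * r" for D
  proof -
    have "n < p" using Suc.prems(5) by simp
    note spin_coeff_fixed_point[OF that \<open>n < p\<close>]
    also note Suc.IH[OF that \<open>n < p\<close>]
    finally show ?thesis .
  qed
  show ?case
  proof (cases "?k \<in> set (concat css)")
    case False
    have "set (concat css) \<subseteq> {1..n}"
      by (rule subset_atLeastAtMost_Suc[OF Suc.prems(2) False])
    then show ?thesis using fixed Suc.prems by blast
  next
    case True
    then obtain c where c: "c \<in> set css" "?k \<in> set c" by auto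
    obtain A B where css: "css = A @ c # B" using c(1) split_list by metis
    obtain c1 c2 where c_eq: "c = c1 @ ?k # c2" using c(2) split_list by metis
    \<comment> \<open>The cycle of the largest point is rotated to start with it, which is harmless
      for odd length.\<close>
    define us D where "us = c2 @ c1" and "D = A @ B"
    have d: "distinct (?k # us @ concat D)" "set (?k # us @ concat D) \<subseteq> {1..Suc n}" 
      using Suc.prems(1,2) by (auto simp: css c_eq us_def D_def)
    have lc: "length c = Suc (length us)" by (simp add: c_eq us_def)
    have odd: "\<forall>e\<in>set D. odd (length e)" using Suc.prems(3) by (simp add: css D_def)
    have "odd (length c)" using Suc.prems(3) c(1) by blast
    then have even: "even (length us)" by (simp add: lc)
    then have len: "length c div 2 = length us div 2" by (simp add: lc)
    have total: "length us + (\<Sum>e\<leftarrow>D. length e - 1) = 2 * r"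
    proof -
      have "(\<Sum>e\<leftarrow>css. length e - 1) = (length c - 1) + (\<Sum>e\<leftarrow>D. length e - 1)"
        unfolding css D_def by simp
      then show ?thesis unfolding Suc.prems(4) lc by simp
    qed
    have "set (us @ concat D) \<subseteq> {1..Suc n}" "?k \<notin> set (us @ concat D)" using d by auto
    then have dn: "set (us @ concat D) \<subseteq> {1..n}"
      by (rule subset_atLeastAtMost_Suc)
    have dp: "distinct (p # ?k # us @ concat D)" using d Suc.prems(5) by auto
    have "rotate (length c1) c = ?k # us" by (simp add: c_eq us_def rotate_append)
    then have "cyc p c = cyc p (?k # us)"
    proof -
      have "distinct (p # c)" using Suc.prems(1,2,5) by (auto simp: css)
      moreover have "odd (length c)" using Suc.prems(3) c(1) by blast
      ultimately have "cyc p (rotate (length c1) c) = cyc p c" by (rule cyc_rotate)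
      then show ?thesis using \<open>rotate (length c1) c = ?k # us\<close> by (simp only:)
    qed
    then have g: "prodcyc p css = cyc p (?k # us) * prodcyc p D"
    proof -
      have "distinct (p # concat (A @ c # B))" using Suc.prems(1,2,5) by (auto simp: css)
      moreover have "\<forall>d\<in>set (A @ c # B). odd (length d)" using Suc.prems(3) by (simp add: css)
      ultimately have "prodcyc p (A @ c # B) = cyc p c * prodcyc p (A @ B)"
        by (rule prodcyc_move_front)
      then show ?thesis by (simp only: css D_def \<open>cyc p c = cyc p (?k # us)\<close>)
    qed
    let ?PD = "\<Prod>e\<leftarrow>D. - int (catalan (length e div 2))"
    have goal: "(\<Prod>c\<leftarrow>css. - int (catalan (length c div 2))) = - int (catalan (length us div 2)) * ?PD"
      by (simp add: css D_def len)
    show ?thesis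
    proof (cases "us = []")
      case True
      \<comment> \<open>A listed cycle of length one counts -1 on both sides:
        \<open>cyc p [k]\<close> is -1, and so is minus the Catalan number for 0.\<close>
      have "spin_coeff r (Suc n) (prodcyc p D) = ?PD"
        using d(1) dn odd total True by (intro fixed) auto
      then show ?thesis
        unfolding goal g using True dp by (simp add: cyc_singleton spin_coeff_uminus)
    next
      case False
      let ?g = "prodcyc p css" and ?l = "last us"
      define s where "s = length us div 2"
      have "length us = 2 * s" using even by (simp add: s_def)
      moreover have "0 < length us" using False by simp
      ultimately have s: "length us = 2 * s" "0 < s" by simp_all
      obtain r' where r: "r = Suc r'" using total s by (cases r) auto
      obtain \<sigma> where \<sigma>: "lifts ?g 1 \<sigma>" "map \<sigma> (?k # us) = rotate1 (?k # us)"
        "\<forall>e\<in>set D. map \<sigma> e = rotate1 e" "\<sigma> permutes set (?k # us @ concat D)"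
      proof -
        have "\<exists>\<sigma>. lifts (prodcyc p ((?k # us) # D)) 1 \<sigma> \<and>
            (\<forall>c\<in>set ((?k # us) # D). map \<sigma> c = rotate1 c) \<and> \<sigma> permutes set (concat ((?k # us) # D))"
          using dp odd even by (intro lifts_prodcyc) auto
        then show ?thesis using that by (auto simp: g)
      qed
      have inj: "inj \<sigma>" by (rule permutes_inj[OF \<sigma>(4)])
      have l: "?l \<in> set us" "us = butlast us @ [?l]" using False by simp_all
      have \<sigma>l: "\<sigma> ?l = ?k"
      proof -
        have "last (map \<sigma> (?k # us)) = \<sigma> ?l" using False by (simp add: last_map)
        then show ?thesis by (simp only: \<sigma>(2)) simp
      qed
      have \<sigma>k: "\<sigma> ?k \<noteq> ?k" using injD[OF inj, of ?k ?l] \<sigma>l l(1) d(1) by auto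
      \<comment> \<open>For \<open>a \<noteq> b\<close> the new permutation sends \<open>?k\<close>
        to \<open>\<sigma> b\<close>, which is \<open>?k\<close> only for \<open>b = ?l\<close>; for
        \<open>a = b\<close> it sends \<open>?k\<close> to \<open>\<sigma> ?k\<close>.\<close>
      have moved: "spin_coeff r' n (?g * rtv a ?k * rtv b ?k) = 0"
        if ab: "a \<in> {1..n}" "b \<in> {1..n}" "b \<noteq> ?l \<or> a = b" for a b
      proof -
        have "(\<sigma> \<circ> transpose a ?k \<circ> transpose b ?k) ?k \<noteq> ?k"
        proof (cases "a = b")
          case True
          then show ?thesis using \<sigma>k by simp
        next
          case False
          then have "(\<sigma> \<circ> transpose a ?k \<circ> transpose b ?k) ?k = \<sigma> b"
            using ab by (simp add: transpose_def)
          moreover have "\<sigma> b \<noteq> \<sigma> ?l" using injD[OF inj, of b ?l] ab(3) False by blast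
          ultimately show ?thesis by (simp only: \<sigma>l) simp
        qed
        then show ?thesis
          using ab by (intro spin_coeff_moved[OF lifts_mult_pair[OF \<sigma>(1)], where j = ?k]) auto
      qed
      have ln: "?l \<in> {1..n}" using l(1) dn by auto
      let ?T = "\<lambda>a. spin_coeff r' n (?g * rtv a ?k * rtv ?l ?k)"
      have "spin_coeff r (Suc n) ?g = (\<Sum>a\<in>{1..n}. \<Sum>b\<in>{1..n}. spin_coeff r' n (?g * rtv a ?k * rtv b ?k))"
        using spin_coeff_moved[OF \<sigma>(1) \<sigma>k] by (simp add: spin_coeff_Suc r)
      also have "\<dots> = (\<Sum>a\<in>{1..n}. ?T a)"
      proof (rule sum.cong [OF refl])
        fix a assume a: "a \<in> {1..n}"
        have "(\<Sum>b\<in>{1..n}. spin_coeff r' n (?g * rtv a ?k * rtv b ?k))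
          = (\<Sum>b\<in>{?l}. spin_coeff r' n (?g * rtv a ?k * rtv b ?k))"
          by (rule sum.mono_neutral_right) (use ln moved[OF a] in auto)
        then show "(\<Sum>b\<in>{1..n}. spin_coeff r' n (?g * rtv a ?k * rtv b ?k)) = ?T a" by simp
      qed
      also have "\<dots> = (\<Sum>a\<in>set (butlast us). ?T a)"
      proof (rule sum.mono_neutral_right)
        show "set (butlast us) \<subseteq> {1..n}" using dn in_set_butlastD[of _ us] by auto
        show "\<forall>a\<in>{1..n} - set (butlast us). ?T a = 0"
        proof
          fix a assume a: "a \<in> {1..n} - set (butlast us)"
          show "?T a = 0"
          proof (cases "a = ?l")
            case True
            then show ?thesis using moved[of a ?l] a ln by simp
          next
            case False
            moreover have "set us = insert ?l (set (butlast us))"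
              using \<open>us \<noteq> []\<close> by (cases us rule: rev_cases) auto
            ultimately have "a \<notin> set us" using a by auto
            then show ?thesis
              using d \<sigma> odd \<open>us \<noteq> []\<close> a total r by (intro long_cycle_merge[of ?k us D n ?g \<sigma> a r']) auto
          qed
        qed
      qed simp
      also have "\<dots> = (\<Sum>q<2 * s - 1. ?T (us ! q))"
      proof -
        have "distinct (butlast us)" using d(1) distinct_butlast by auto
        then have "bij_betw ((!) (butlast us)) {..<length (butlast us)} (set (butlast us))"
          by (rule bij_betw_nth) auto
        then have "(\<Sum>a\<in>set (butlast us). ?T a) = (\<Sum>q<length (butlast us). ?T (butlast us ! q))"
          by (rule sum.reindex_bij_betw [symmetric])
        then show ?thesis by (simp add: nth_butlast s(1))
      qed
      also have "\<dots> = (\<Sum>q<2 * s - 1. (if even q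
          then - (- int (catalan (q div 2)) * - int (catalan ((2 * s - 1 - q) div 2))) else 0) * ?PD)"
      proof (rule sum.cong [OF refl])
        fix q assume "q \<in> {..<2 * s - 1}"
        then have q: "Suc q < length us" using s by auto
        define v w where "v = take (Suc q) us" and "w = drop (Suc q) us"
        have vw: "us = v @ w" by (simp add: v_def w_def)
        have lv: "length v = Suc q" and lw: "length w = 2 * s - 1 - q" using q s by (simp_all add: v_def w_def)
        have ne: "v \<noteq> []" "w \<noteq> []" using lv lw q s by auto
        have last: "last v = us ! q" "last w = ?l"
          using q ne by (simp_all add: v_def w_def take_Suc_conv_app_nth last_drop)
        show "?T (us ! q) = (if even q
          then - (- int (catalan (q div 2)) * - int (catalan ((2 * s - 1 - q) div 2))) else 0) * ?PD"
        proof (cases "even q")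
          case False
          have "?T (us ! q) = 0"
            unfolding last[symmetric] using d(1) dn ne \<sigma>(1,2) False lv
            by (intro even_cycle_cut[where \<sigma> = \<sigma>]) (auto simp: vw)
          then show ?thesis using False by simp
        next
          case True
          have ow: "odd (length w)" using lw True q s by simp
          have comm: "prodcyc p D * rtv x ?k = rtv x ?k * prodcyc p D" if "x \<in> set us" for x
            using that dp odd by (intro prodcyc_rtv_commute) auto
          have "last v \<in> set us" "last w \<in> set us" using ne by (auto simp: vw)
          then have "?g * rtv (last v) ?k * rtv (last w) ?k
            = cyc p (?k # v @ w) * rtv (last v) ?k * rtv (last w) ?k * prodcyc p D"
          proof -
            have "?g * rtv (last v) ?k * rtv (last w) ?k
              = cyc p (?k # us) * (prodcyc p D * rtv (last v) ?k) * rtv (last w) ?k"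
              by (simp only: g mult.assoc)
            also have "\<dots> = cyc p (?k # us) * rtv (last v) ?k * (prodcyc p D * rtv (last w) ?k)"
              by (simp only: comm[OF \<open>last v \<in> set us\<close>] mult.assoc)
            also have "\<dots> = cyc p (?k # us) * rtv (last v) ?k * rtv (last w) ?k * prodcyc p D"
              by (simp only: comm[OF \<open>last w \<in> set us\<close>] mult.assoc)
            finally show ?thesis by (simp only: vw)
          qed
          also have "cyc p (?k # v @ w) * rtv (last v) ?k * rtv (last w) ?k = - (cyc p v * cyc p w)"
            using dp True lv ow by (intro cyc_split) (auto simp: vw)
          finally have "?T (us ! q) = - spin_coeff r' n (prodcyc p (v # w # D))"
            unfolding last by (simp add: spin_coeff_uminus mult.assoc)
          \<comment> \<open>Without \<open>?k\<close> and with one cycle more the excess has dropped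
            by two, as required for \<open>r'\<close>.\<close>
          also have "spin_coeff r' n (prodcyc p (v # w # D))
            = (\<Prod>c\<leftarrow>v # w # D. - int (catalan (length c div 2)))"
            using d(1) dn odd True lv ow total r s q Suc.prems(5)
            by (intro Suc.IH) (auto simp: vw lw)
          also have "\<dots> = (- int (catalan (q div 2)) * - int (catalan ((2 * s - 1 - q) div 2))) * ?PD"
            using True by (simp add: lv lw)
          finally show ?thesis using True by simp
        qed
      qed
      also have "\<dots> = - int (catalan s) * ?PD"
        unfolding sum_distrib_right [symmetric] catalan_sum_even[OF s(2)] ..
      finally show ?thesis unfolding goal s_def .
    qed
  qed
qed


section \<open>Integral group rings of finite groups\<close>

locale finite_group_ring = group G for G (structure) +
  assumes finite_carrier: "finite (carrier G)"
begin

abbreviation R where "R \<equiv> group_ring G"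

lemma carrier_R_iff: "f \<in> carrier R \<longleftrightarrow> (\<forall>x. x \<notin> carrier G \<longrightarrow> f x = 0)"
  using finite_carrier by (auto simp: group_ring_def intro: finite_subset)

lemma carrier_R_outside: "f \<in> carrier R \<Longrightarrow> x \<notin> carrier G \<Longrightarrow> f x = 0"
  by (simp add: carrier_R_iff)

lemma add_R: "f \<oplus>\<^bsub>R\<^esub> h = (\<lambda>x. f x + h x)" and zero_R: "\<zero>\<^bsub>R\<^esub> = (\<lambda>x. 0)"
  and one_R: "\<one>\<^bsub>R\<^esub> = (\<lambda>x. of_bool (x = \<one>))"
  by (simp_all add: group_ring_def)

lemma mult_R:
  assumes f: "f \<in> carrier R" and h: "h \<in> carrier R"
  shows "f \<otimes>\<^bsub>R\<^esub> h = (\<lambda>x. if x \<in> carrier G then \<Sum>u\<in>carrier G. f u * h (inv u \<otimes> x) else 0)"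
proof
  fix x
  let ?S = "{(u, v). f u \<noteq> 0 \<and> h v \<noteq> 0 \<and> u \<otimes> v = x}"
  have S: "u \<in> carrier G \<and> v \<in> carrier G" if "(u, v) \<in> ?S" for u v
    using that carrier_R_outside[OF f] carrier_R_outside[OF h] by auto
  have "(f \<otimes>\<^bsub>R\<^esub> h) x = (\<Sum>(u, v)\<in>?S. f u * h v)" by (simp add: group_ring_def)
  also have "\<dots> = (if x \<in> carrier G then \<Sum>u\<in>carrier G. f u * h (inv u \<otimes> x) else 0)"
  proof (cases "x \<in> carrier G")
    case True
    let ?U = "{u \<in> carrier G. f u \<noteq> 0 \<and> h (inv u \<otimes> x) \<noteq> 0}"
    have "?S = (\<lambda>u. (u, inv u \<otimes> x)) ` ?U"
    proof
      show "?S \<subseteq> (\<lambda>u. (u, inv u \<otimes> x)) ` ?U"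
      proof
        fix w assume w: "w \<in> ?S"
        obtain u v where uv: "w = (u, v)" by fastforce
        have "inv u \<otimes> x = v" using w uv S[of u v] by (auto simp: m_assoc[symmetric])
        then show "w \<in> (\<lambda>u. (u, inv u \<otimes> x)) ` ?U" using w uv S[of u v] by auto
      qed
      show "(\<lambda>u. (u, inv u \<otimes> x)) ` ?U \<subseteq> ?S" using True by (auto simp: m_assoc[symmetric])
    qed
    then have "(\<Sum>(u, v)\<in>?S. f u * h v) = (\<Sum>u\<in>?U. f u * h (inv u \<otimes> x))"
      by (simp add: sum.reindex inj_on_def)
    also have "\<dots> = (\<Sum>u\<in>carrier G. f u * h (inv u \<otimes> x))"
      using finite_carrier by (intro sum.mono_neutral_left) auto
    finally show ?thesis using True by simp
  next
    case False
    then have "?S = {}" using S m_closed by blast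
    then show ?thesis using False by (simp only: sum.empty if_False)
  qed
  finally show "(f \<otimes>\<^bsub>R\<^esub> h) x = \<dots>" .
qed

lemma mult_R_apply:
  "f \<in> carrier R \<Longrightarrow> h \<in> carrier R \<Longrightarrow> x \<in> carrier G \<Longrightarrow>
    (f \<otimes>\<^bsub>R\<^esub> h) x = (\<Sum>u\<in>carrier G. f u * h (inv u \<otimes> x))"
  by (simp add: mult_R)

lemma sum_translate: "y \<in> carrier G \<Longrightarrow> (\<Sum>u\<in>carrier G. F (y \<otimes> u)) = (\<Sum>u\<in>carrier G. F u)"
  by (rule sum.reindex_bij_witness[of _ "\<lambda>u. inv y \<otimes> u" "\<lambda>u. y \<otimes> u"]) (auto simp: m_assoc[symmetric])

lemma mult_R_closed: "f \<in> carrier R \<Longrightarrow> h \<in> carrier R \<Longrightarrow> f \<otimes>\<^bsub>R\<^esub> h \<in> carrier R"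
  by (simp add: mult_R) (simp add: carrier_R_iff)

lemma one_R_closed: "\<one>\<^bsub>R\<^esub> \<in> carrier R"
  by (auto simp: carrier_R_iff one_R)

lemma mult_R_assoc:
  assumes f: "f \<in> carrier R" and h: "h \<in> carrier R" and k: "k \<in> carrier R"
  shows "f \<otimes>\<^bsub>R\<^esub> h \<otimes>\<^bsub>R\<^esub> k = f \<otimes>\<^bsub>R\<^esub> (h \<otimes>\<^bsub>R\<^esub> k)"
proof
  fix x
  show "(f \<otimes>\<^bsub>R\<^esub> h \<otimes>\<^bsub>R\<^esub> k) x = (f \<otimes>\<^bsub>R\<^esub> (h \<otimes>\<^bsub>R\<^esub> k)) x"
  proof (cases "x \<in> carrier G")
    case True
    have "(f \<otimes>\<^bsub>R\<^esub> h \<otimes>\<^bsub>R\<^esub> k) x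
      = (\<Sum>w\<in>carrier G. (\<Sum>u\<in>carrier G. f u * h (inv u \<otimes> w)) * k (inv w \<otimes> x))"
      using True by (simp add: mult_R_apply mult_R_closed f h k)
    also have "\<dots> = (\<Sum>u\<in>carrier G. f u * (\<Sum>w\<in>carrier G. h (inv u \<otimes> w) * k (inv w \<otimes> x)))"
      unfolding sum_distrib_right sum_distrib_left by (subst sum.swap) (simp add: mult.assoc)
    also have "\<dots> = (\<Sum>u\<in>carrier G. f u * (\<Sum>v\<in>carrier G. h v * k (inv v \<otimes> (inv u \<otimes> x))))"
    proof (rule sum.cong [OF refl])
      fix u assume u: "u \<in> carrier G"
      have "(\<Sum>w\<in>carrier G. h (inv u \<otimes> w) * k (inv w \<otimes> x))
        = (\<Sum>v\<in>carrier G. h (inv u \<otimes> (u \<otimes> v)) * k (inv (u \<otimes> v) \<otimes> x))"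
        by (rule sum_translate[OF u, symmetric])
      also have "\<dots> = (\<Sum>v\<in>carrier G. h v * k (inv v \<otimes> (inv u \<otimes> x)))"
      proof (rule sum.cong [OF refl])
        fix v assume v: "v \<in> carrier G"
        have "inv u \<otimes> (u \<otimes> v) = v" using u v by (simp add: m_assoc[symmetric])
        moreover have "inv (u \<otimes> v) \<otimes> x = inv v \<otimes> (inv u \<otimes> x)"
          using u v True by (simp add: inv_mult_group m_assoc)
        ultimately show "h (inv u \<otimes> (u \<otimes> v)) * k (inv (u \<otimes> v) \<otimes> x) = h v * k (inv v \<otimes> (inv u \<otimes> x))"
          by simp
      qed
      finally show "f u * (\<Sum>w\<in>carrier G. h (inv u \<otimes> w) * k (inv w \<otimes> x))
        = f u * (\<Sum>v\<in>carrier G. h v * k (inv v \<otimes> (inv u \<otimes> x)))" by simp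
    qed
    also have "\<dots> = (f \<otimes>\<^bsub>R\<^esub> (h \<otimes>\<^bsub>R\<^esub> k)) x"
      using True by (simp add: mult_R_apply mult_R_closed f h k)
    finally show ?thesis .
  next
    case False
    then show ?thesis using f h k by (simp add: carrier_R_outside mult_R_closed)
  qed
qed

lemma mult_R_one_left:
  assumes f: "f \<in> carrier R"
  shows "\<one>\<^bsub>R\<^esub> \<otimes>\<^bsub>R\<^esub> f = f"
proof
  fix x
  show "(\<one>\<^bsub>R\<^esub> \<otimes>\<^bsub>R\<^esub> f) x = f x"
  proof (cases "x \<in> carrier G")
    case True
    have "(\<one>\<^bsub>R\<^esub> \<otimes>\<^bsub>R\<^esub> f) x = (\<Sum>u\<in>carrier G. if u = \<one> then f (inv u \<otimes> x) else 0)"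
      unfolding mult_R_apply[OF one_R_closed f True] by (auto simp: one_R intro!: sum.cong)
    then show ?thesis using finite_carrier True by simp
  qed (simp add: f carrier_R_outside mult_R one_R_closed)
qed

lemma set_sum_closed: "D \<subseteq> carrier G \<Longrightarrow> set_sum D \<in> carrier R"
  by (auto simp: carrier_R_iff set_sum_def)

lemma mult_R_single:
  assumes f: "f \<in> carrier R" and y: "y \<in> carrier G"
  shows "f \<otimes>\<^bsub>R\<^esub> set_sum {y} = (\<lambda>x. if x \<in> carrier G then f (x \<otimes> inv y) else 0)"
proof
  fix x
  show "(f \<otimes>\<^bsub>R\<^esub> set_sum {y}) x = (if x \<in> carrier G then f (x \<otimes> inv y) else 0)"
  proof (cases "x \<in> carrier G")
    case True
    have iff: "inv u \<otimes> x = y \<longleftrightarrow> u = x \<otimes> inv y" if "u \<in> carrier G" for u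
      using that True y by (metis inv_solve_left inv_solve_right)
    have "(f \<otimes>\<^bsub>R\<^esub> set_sum {y}) x = (\<Sum>u\<in>carrier G. if u = x \<otimes> inv y then f u else 0)"
      using True iff y f
      by (auto simp: mult_R_apply set_sum_closed) (auto simp: set_sum_def intro!: sum.cong)
    then show ?thesis using finite_carrier True y by simp
  qed (use f y in \<open>simp add: carrier_R_outside mult_R_closed set_sum_closed\<close>)
qed

lemma one_R_single: "\<one>\<^bsub>R\<^esub> = set_sum {\<one>}"
  by (auto simp: one_R set_sum_def)

lemma ring_R: "ring R"
proof (rule ringI)
  show "abelian_group R"
  proof (rule abelian_groupI)
    fix f assume f: "f \<in> carrier R"
    show "\<exists>h\<in>carrier R. h \<oplus>\<^bsub>R\<^esub> f = \<zero>\<^bsub>R\<^esub>"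
      using f by (intro bexI[of _ "\<lambda>x. - f x"]) (auto simp: add_R zero_R carrier_R_iff)
  qed (auto simp: add_R zero_R carrier_R_iff)
  show "monoid R"
  proof (rule monoidI)
    fix f assume f: "f \<in> carrier R"
    show "\<one>\<^bsub>R\<^esub> \<otimes>\<^bsub>R\<^esub> f = f" by (rule mult_R_one_left[OF f])
    have "f \<otimes>\<^bsub>R\<^esub> \<one>\<^bsub>R\<^esub> = (\<lambda>x. if x \<in> carrier G then f (x \<otimes> inv \<one>) else 0)"
      unfolding one_R_single by (rule mult_R_single[OF f]) simp
    then show "f \<otimes>\<^bsub>R\<^esub> \<one>\<^bsub>R\<^esub> = f"
      using carrier_R_outside[OF f] by (auto simp: fun_eq_iff)
  qed (use mult_R_closed one_R_closed mult_R_assoc in auto)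
  fix f h k assume fhk: "f \<in> carrier R" "h \<in> carrier R" "k \<in> carrier R"
  then have "f \<oplus>\<^bsub>R\<^esub> h \<in> carrier R" by (auto simp: add_R carrier_R_iff)
  then show "(f \<oplus>\<^bsub>R\<^esub> h) \<otimes>\<^bsub>R\<^esub> k = f \<otimes>\<^bsub>R\<^esub> k \<oplus>\<^bsub>R\<^esub> h \<otimes>\<^bsub>R\<^esub> k"
    "k \<otimes>\<^bsub>R\<^esub> (f \<oplus>\<^bsub>R\<^esub> h) = k \<otimes>\<^bsub>R\<^esub> f \<oplus>\<^bsub>R\<^esub> k \<otimes>\<^bsub>R\<^esub> h"
    using fhk by (simp_all add: mult_R) (auto simp: add_R fun_eq_iff sum.distrib algebra_simps)
qed

lemma minus_R:
  assumes "f \<in> carrier R" "h \<in> carrier R"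
  shows "f \<ominus>\<^bsub>R\<^esub> h = (\<lambda>x. f x - h x)"
proof -
  interpret ring R by (rule ring_R)
  define d where "d = (\<lambda>x. f x - h x)"
  have d: "d \<in> carrier R" and "f = d \<oplus>\<^bsub>R\<^esub> h"
    using assms by (auto simp: d_def add_R carrier_R_iff)
  then have "f \<ominus>\<^bsub>R\<^esub> h = (d \<oplus>\<^bsub>R\<^esub> h) \<ominus>\<^bsub>R\<^esub> h" by (simp only:)
  also have "\<dots> = d" using d assms(2) by (simp add: minus_eq a_assoc r_neg)
  finally show ?thesis by (simp add: d_def)
qed

text \<open>Multiples of z + 1 are invariant under translation by the central element z. Conversely,
  an invariant function is \<open>z + 1\<close> times its restriction to one representative of each
  pair \<open>{x, z x}\<close>; the pairs have two elements because z is not 1.\<close>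

lemma mem_genideal_iff:
  assumes z: "z \<in> carrier G" "z \<otimes> z = \<one>" "z \<noteq> \<one>" "\<And>x. x \<in> carrier G \<Longrightarrow> z \<otimes> x = x \<otimes> z"
  shows "f \<in> genideal R {set_sum {z} \<oplus>\<^bsub>R\<^esub> \<one>\<^bsub>R\<^esub>} \<longleftrightarrow>
    f \<in> carrier R \<and> (\<forall>x\<in>carrier G. f (z \<otimes> x) = f x)"
proof -
  interpret RR: ring R by (rule ring_R)
  let ?e = "set_sum {z} \<oplus>\<^bsub>R\<^esub> \<one>\<^bsub>R\<^esub>"
  let ?J = "{f \<in> carrier R. \<forall>x\<in>carrier G. f (z \<otimes> x) = f x}"
  have e: "?e \<in> carrier R" using z(1) set_sum_closed[of "{z}"] by simp
  have zinv: "inv z = z" using z(1,2) by (simp add: inv_equality)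
  have zz: "z \<otimes> (z \<otimes> x) = x" if "x \<in> carrier G" for x
    using that z(1,2) by (simp add: m_assoc[symmetric])
  have mult_e: "h \<otimes>\<^bsub>R\<^esub> ?e = (\<lambda>x. if x \<in> carrier G then h (z \<otimes> x) + h x else 0)"
    if h: "h \<in> carrier R" for h
  proof -
    have "h \<otimes>\<^bsub>R\<^esub> ?e = h \<otimes>\<^bsub>R\<^esub> set_sum {z} \<oplus>\<^bsub>R\<^esub> h"
      using h z(1) set_sum_closed[of "{z}"] by (simp add: RR.r_distr)
    then show ?thesis
      using mult_R_single[OF h z(1)] z(4) zinv carrier_R_outside[OF h] by (auto simp: add_R fun_eq_iff)
  qed
  have "ideal ?J R"
  proof (rule idealI[OF ring_R])
    show "subgroup ?J (add_monoid R)"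
    proof (rule RR.add.subgroupI)
      fix f assume f: "f \<in> ?J"
      then have fc: "f \<in> carrier R" by simp
      have "\<ominus>\<^bsub>R\<^esub> f = \<zero>\<^bsub>R\<^esub> \<ominus>\<^bsub>R\<^esub> f" using fc by (simp add: RR.minus_eq)
      then have "\<ominus>\<^bsub>R\<^esub> f = (\<lambda>x. - f x)"
        using minus_R[OF RR.zero_closed fc] by (simp add: zero_R)
      then show "\<ominus>\<^bsub>R\<^esub> f \<in> ?J" using f by (auto simp: carrier_R_iff)
    qed (auto simp: add_R carrier_R_iff intro!: exI[of _ "\<lambda>x. 0"])
  next
    fix f h assume f: "f \<in> ?J" and h: "h \<in> carrier R"
    then have fc: "f \<in> carrier R" by simp
    show "h \<otimes>\<^bsub>R\<^esub> f \<in> ?J"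
    proof -
      have "h u * f (inv u \<otimes> (z \<otimes> x)) = h u * f (inv u \<otimes> x)"
        if "u \<in> carrier G" "x \<in> carrier G" for u x
      proof -
        have "inv u \<otimes> (z \<otimes> x) = z \<otimes> (inv u \<otimes> x)"
          using that z(1) z(4)[of "inv u"] by (simp add: m_assoc[symmetric])
        then show ?thesis using f that by simp
      qed
      then show ?thesis
        using mult_R_closed[OF h fc] z(1) by (auto simp: mult_R_apply h fc intro!: sum.cong)
    qed
    show "f \<otimes>\<^bsub>R\<^esub> h \<in> ?J"
    proof -
      have "(\<Sum>u\<in>carrier G. f u * h (inv u \<otimes> (z \<otimes> x))) = (\<Sum>u\<in>carrier G. f u * h (inv u \<otimes> x))"
        if x: "x \<in> carrier G" for x
      proof -
        have "(\<Sum>u\<in>carrier G. f u * h (inv u \<otimes> (z \<otimes> x)))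
          = (\<Sum>u\<in>carrier G. f (z \<otimes> u) * h (inv (z \<otimes> u) \<otimes> (z \<otimes> x)))"
          by (rule sum_translate[OF z(1), symmetric])
        also have "\<dots> = (\<Sum>u\<in>carrier G. f u * h (inv u \<otimes> x))"
        proof (rule sum.cong [OF refl])
          fix u assume u: "u \<in> carrier G"
          have "inv (z \<otimes> u) \<otimes> (z \<otimes> x) = inv u \<otimes> (z \<otimes> (z \<otimes> x))"
            using u x z(1) zinv by (simp add: inv_mult_group m_assoc)
          then show "f (z \<otimes> u) * h (inv (z \<otimes> u) \<otimes> (z \<otimes> x)) = f u * h (inv u \<otimes> x)"
            using f u zz[OF x] by simp
        qed
        finally show ?thesis .
      qed
      then show ?thesis
        using mult_R_closed[OF fc h] z(1) by (simp add: mult_R[OF fc h])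
    qed
  qed
  moreover have "?e \<in> ?J"
  proof -
    have "?e (z \<otimes> x) = ?e x" if x: "x \<in> carrier G" for x
    proof -
      have "z \<otimes> x = z \<longleftrightarrow> x = \<one>" "z \<otimes> x = \<one> \<longleftrightarrow> x = z"
        using x z(1,2) zz[OF x] by auto
      then show ?thesis by (auto simp: add_R one_R set_sum_def)
    qed
    then show ?thesis using e by simp
  qed
  ultimately have sub: "genideal R {?e} \<subseteq> ?J" by (intro RR.genideal_minimal) auto
  have "f \<in> genideal R {?e}" if f: "f \<in> ?J" for f
  proof -
    \<comment> \<open>The predicate is the same for \<open>x\<close> and for
      \<open>z \<otimes> x\<close>, so both get the same representative.\<close>
    define rep where "rep x = (SOME y. y = x \<or> y = z \<otimes> x)" for x
    define h where "h x = (if x \<in> carrier G \<and> rep x = x then f x else 0)" for x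
    have h: "h \<in> carrier R" by (auto simp: carrier_R_iff h_def)
    have rep: "h (z \<otimes> x) + h x = f x" if x: "x \<in> carrier G" for x
    proof -
      have "(\<lambda>y. y = z \<otimes> x \<or> y = z \<otimes> (z \<otimes> x)) = (\<lambda>y. y = x \<or> y = z \<otimes> x)"
        using zz[OF x] by auto
      then have "rep (z \<otimes> x) = rep x" by (simp add: rep_def)
      moreover have "rep x = x \<or> rep x = z \<otimes> x"
        unfolding rep_def by (rule someI[of _ x]) simp
      moreover have "z \<otimes> x \<noteq> x" using x z(1,3) r_cancel_one[of x z] by simp
      moreover have "f (z \<otimes> x) = f x" using f x by simp
      ultimately show ?thesis using x z(1) by (auto simp: h_def)
    qed
    have "h \<otimes>\<^bsub>R\<^esub> ?e = f"
      unfolding mult_e[OF h] using rep f carrier_R_outside[of f] by (auto simp: fun_eq_iff)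
    moreover have "ideal (genideal R {?e}) R" "?e \<in> genideal R {?e}"
      using e by (auto intro: RR.genideal_ideal RR.genideal_self')
    ultimately show ?thesis using ideal.I_l_closed h by fastforce
  qed
  then show ?thesis using sub by blast
qed

end


section \<open>The spin group algebra\<close>

lemma finite_pin: "finite (pin n)"
proof (rule finite_subset)
  let ?P = "{\<sigma>. \<sigma> permutes {1..n}}"
  show "pin n \<subseteq> (\<Union>\<sigma>\<in>?P. {g \<in> pin n. \<exists>s. lifts g s \<sigma>})"
  proof
    fix g assume g: "g \<in> pin n"
    obtain s \<sigma> where "lifts g s \<sigma>" "\<sigma> permutes {1..n}" using pin_lifts[OF g] by metis
    then show "g \<in> (\<Union>\<sigma>\<in>?P. {g \<in> pin n. \<exists>s. lifts g s \<sigma>})" using g by auto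
  qed
  show "finite (\<Union>\<sigma>\<in>?P. {g \<in> pin n. \<exists>s. lifts g s \<sigma>})"
  proof (rule finite_UN_I)
    show "finite ?P" by (rule finite_permutations) simp
    fix \<sigma> assume "\<sigma> \<in> ?P"
    show "finite {g \<in> pin n. \<exists>s. lifts g s \<sigma>}"
    proof (cases "\<exists>g0 s0. g0 \<in> pin n \<and> lifts g0 s0 \<sigma>")
      case True
      then obtain g0 s0 where g0: "g0 \<in> pin n" "lifts g0 s0 \<sigma>" by metis
      have "{g \<in> pin n. \<exists>s. lifts g s \<sigma>} \<subseteq> {g0, - g0}"
        using pin_lifts_unique[OF _ g0(1) _ g0(2)] by auto
      then show ?thesis by (rule finite_subset) simp
    next
      case False
      then have "{g \<in> pin n. \<exists>s. lifts g s \<sigma>} = {}" by auto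
      then show ?thesis by (simp only: finite.emptyI)
    qed
  qed
qed

lemma (in monoid) list_mult_closed': "set xs \<subseteq> carrier G \<Longrightarrow> list_mult G xs \<in> carrier G"
  by (induction xs) (auto simp: list_mult_def)

lemma (in monoid) list_mult_snoc:
  "set xs \<subseteq> carrier G \<Longrightarrow> x \<in> carrier G \<Longrightarrow> list_mult G (xs @ [x]) = list_mult G xs \<otimes> x"
proof (induction xs)
  case (Cons y xs)
  then have IH: "list_mult G (xs @ [x]) = list_mult G xs \<otimes> x" by simp
  have "list_mult G (y # xs @ [x]) = y \<otimes> list_mult G (xs @ [x])" by (simp add: list_mult_def)
  also have "\<dots> = y \<otimes> list_mult G xs \<otimes> x"
    using Cons.prems list_mult_closed'[of xs] by (simp add: IH m_assoc)
  finally show ?case by (simp add: list_mult_def)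
qed (simp add: list_mult_def)

lemma sorted_list_of_set_insert_last:
  assumes "I \<subseteq> {1..k}"
  shows "sorted_list_of_set (insert (Suc k) I) = sorted_list_of_set I @ [Suc k]"
proof -
  have fin: "finite I" using assms finite_subset by blast
  have "sorted (sorted_list_of_set I @ [Suc k])" "distinct (sorted_list_of_set I @ [Suc k])"
    using assms fin by (auto simp: sorted_append)
  then have "sorted_list_of_set (set (sorted_list_of_set I @ [Suc k])) = sorted_list_of_set I @ [Suc k]"
    by (rule sorted_list_of_set.idem_if_sorted_distinct)
  then show ?thesis using fin by simp
qed

context ring
begin

text \<open>The shape of \<open>e_elem\<close> with the range \<open>k\<close> detached from the
  algebra, so that an induction on \<open>k\<close> can stay in one and the same spin
  algebra.\<close>

definition elem_sum :: "(nat \<Rightarrow> 'a) \<Rightarrow> nat \<Rightarrow> nat \<Rightarrow> 'a" where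
  "elem_sum q r k = (\<Oplus>I\<in>{I. I \<subseteq> {1..k} \<and> card I = r}. list_mult R (map q (sorted_list_of_set I)))"

lemma elem_sum_0: "elem_sum q 0 k = \<one>"
proof -
  have "{I. I \<subseteq> {1..k} \<and> card I = 0} = {{}}" by (auto dest: finite_subset)
  then show ?thesis by (simp add: elem_sum_def list_mult_def)
qed

lemma elem_sum_empty: "elem_sum q (Suc r) 0 = \<zero>"
proof -
  have "{I::nat set. I \<subseteq> {1..0} \<and> card I = Suc r} = {}" by auto
  then show ?thesis unfolding elem_sum_def by (simp only: finsum_empty)
qed

text \<open>Index sets are split by whether they contain the last index, whose factor then stands at
  the right end of the ordered product.\<close>

lemma elem_sum_Suc:
  assumes q: "\<And>i. i \<in> {1..Suc k} \<Longrightarrow> q i \<in> carrier R"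
  shows "elem_sum q (Suc r) (Suc k) = elem_sum q (Suc r) k \<oplus> elem_sum q r k \<otimes> q (Suc k)"
proof -
  let ?f = "\<lambda>I. list_mult R (map q (sorted_list_of_set I))"
  let ?A = "{I. I \<subseteq> {1..k} \<and> card I = Suc r}" and ?B = "{I. I \<subseteq> {1..k} \<and> card I = r}"
  have fin: "finite I" if "I \<subseteq> {1..j}" for I and j :: nat using that finite_subset by blast
  have f: "?f I \<in> carrier R" if "I \<subseteq> {1..Suc k}" for I
    using that q fin[OF that] by (intro list_mult_closed') auto
  have fA: "?f I \<in> carrier R" if "I \<subseteq> {1..k}" for I
    using that by (intro f) auto
  have fB: "?f (insert (Suc k) I) \<in> carrier R" if "I \<subseteq> {1..k}" for I
    using that by (intro f) auto
  have finAB: "finite ?A" "finite ?B" by (auto intro: finite_subset[of _ "Pow {1..k}"])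
  have split: "{I. I \<subseteq> {1..Suc k} \<and> card I = Suc r} = ?A \<union> insert (Suc k) ` ?B"
  proof
    show "{I. I \<subseteq> {1..Suc k} \<and> card I = Suc r} \<subseteq> ?A \<union> insert (Suc k) ` ?B"
    proof
      fix I assume I: "I \<in> {I. I \<subseteq> {1..Suc k} \<and> card I = Suc r}"
      show "I \<in> ?A \<union> insert (Suc k) ` ?B"
      proof (cases "Suc k \<in> I")
        case True
        have "I - {Suc k} \<in> ?B" using I True fin[of I "Suc k"] by (auto simp: le_Suc_eq)
        moreover have "I = insert (Suc k) (I - {Suc k})" using True by auto
        ultimately show ?thesis by blast
      next
        case False
        then have "I \<subseteq> {1..k}" using I subset_atLeastAtMost_Suc[of I k] by blast
        then show ?thesis using I by simp
      qed
    qed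
    show "?A \<union> insert (Suc k) ` ?B \<subseteq> {I. I \<subseteq> {1..Suc k} \<and> card I = Suc r}"
    proof
      fix I assume "I \<in> ?A \<union> insert (Suc k) ` ?B"
      then consider "I \<in> ?A" | J where "J \<in> ?B" "I = insert (Suc k) J" by blast
      then show "I \<in> {I. I \<subseteq> {1..Suc k} \<and> card I = Suc r}"
      proof cases
        case 1
        then show ?thesis by auto
      next
        case 2
        then have "Suc k \<notin> J" "finite J" using fin[of J k] by auto
        then show ?thesis using 2 by auto
      qed
    qed
  qed
  have "elem_sum q (Suc r) (Suc k) = (\<Oplus>I\<in>?A. ?f I) \<oplus> (\<Oplus>I\<in>insert (Suc k) ` ?B. ?f I)"
    unfolding elem_sum_def split
  proof (rule finsum_Un_disjoint)
    show "?A \<inter> insert (Suc k) ` ?B = {}" by auto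
  qed (use finAB fA fB in \<open>auto simp del: sorted_list_of_set_insert_remove\<close>)
  also have "(\<Oplus>I\<in>insert (Suc k) ` ?B. ?f I) = (\<Oplus>I\<in>?B. ?f (insert (Suc k) I))"
  proof (rule finsum_reindex)
    show "inj_on (insert (Suc k)) ?B"
    proof (rule inj_onI)
      fix I J assume "I \<in> ?B" "J \<in> ?B" and eq: "insert (Suc k) I = insert (Suc k) J"
      then have "Suc k \<notin> I" "Suc k \<notin> J" by auto
      then show "I = J" using eq by (simp add: insert_ident)
    qed
  qed (use fB in auto)
  also have "\<dots> = (\<Oplus>I\<in>?B. ?f I \<otimes> q (Suc k))"
  proof (rule finsum_cong')
    fix I assume I: "I \<in> ?B"
    show "?f (insert (Suc k) I) = ?f I \<otimes> q (Suc k)"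
    proof -
      have "I \<subseteq> {1..k}" using I by simp
      then have "set (map q (sorted_list_of_set I)) \<subseteq> carrier R" using q fin[of I k] by auto
      then have "list_mult R (map q (sorted_list_of_set I) @ [q (Suc k)]) = ?f I \<otimes> q (Suc k)"
        using q by (intro list_mult_snoc) auto
      then show ?thesis
        by (simp only: sorted_list_of_set_insert_last[OF \<open>I \<subseteq> {1..k}\<close>] map_append list.map)
    qed
  qed (use fA q in auto)
  also have "\<dots> = (\<Oplus>I\<in>?B. ?f I) \<otimes> q (Suc k)"
    by (rule finsum_ldistr [symmetric]) (use finAB fA q in auto)
  finally show ?thesis by (simp add: elem_sum_def)
qed

end

lemma rtv_eq_cyc_pair:
  assumes "distinct [p, i, j]"
  shows "cyc p [i, j] = rtv i j"
  using cyc_snoc[of p i "[]" j] cyc_singleton[of p i] assms by simp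

section \<open>The quotient of the group ring by z + 1\<close>

context spin_cover
begin

lemma finite_carrier_cover: "finite (carrier (cover n))"
proof -
  have "finite (rho ` carrier (cover n))" unfolding rho_image by (rule finite_pin)
  then show ?thesis by (rule finite_imageD) (rule rho_inj)
qed

sublocale GR: finite_group_ring "cover n"
  by unfold_locales (rule finite_carrier_cover)

sublocale RR: ring "group_ring (cover n)"
  by (rule GR.ring_R)

abbreviation "R \<equiv> group_ring (cover n)"
abbreviation "S \<equiv> spin_algebra n"

lemma z_neq_one: "z_elem n \<noteq> \<one>\<^bsub>cover n\<^esub>"
  using rho_z rho_one clif_double[of 1] by force

lemma ideal_spin_ideal: "ideal (spin_ideal n) R"
  unfolding spin_ideal_def using GR.set_sum_closed[of "{z_elem n}"] by (intro RR.genideal_ideal) auto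

lemma mem_spin_ideal_iff: "f \<in> spin_ideal n \<longleftrightarrow>
    f \<in> carrier R \<and> (\<forall>x\<in>carrier (cover n). f (z_elem n \<otimes>\<^bsub>cover n\<^esub> x) = f x)"
  unfolding spin_ideal_def
  by (rule GR.mem_genideal_iff[OF z_closed z_square z_neq_one z_central])

sublocale SS: ring "spin_algebra n"
  unfolding spin_algebra_def by (rule ideal.quotient_is_ring[OF ideal_spin_ideal])

lemma spin_proj_hom: "spin_proj n \<in> ring_hom R S"
  using ideal.rcos_ring_hom[OF ideal_spin_ideal]
  unfolding spin_algebra_def spin_proj_def[abs_def] .

text \<open>Calculations take place with functions on the Clifford ring; these are pulled back along
  \<open>rho\<close> to the group ring and then, by \<open>pe\<close>, projected to the
  quotient.\<close>

definition emb :: "(clif \<Rightarrow> int) \<Rightarrow> gen word set \<Rightarrow> int" where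
  "emb F = (\<lambda>x. if x \<in> carrier (cover n) then F (rho x) else 0)"

definition pe :: "(clif \<Rightarrow> int) \<Rightarrow> (gen word set \<Rightarrow> int) set" where
  "pe F = spin_proj n (emb F)"

lemma emb_closed [simp]: "emb F \<in> carrier R"
  by (auto simp: GR.carrier_R_iff emb_def)

lemma pe_closed [simp]: "pe F \<in> carrier S"
  unfolding pe_def using ring_hom_closed[OF spin_proj_hom] by simp

text \<open>The difference lies in the ideal iff it is invariant under z, which acts as negation on
  the Clifford side.\<close>

lemma pe_eq_iff: "pe F = pe F' \<longleftrightarrow> (\<forall>g\<in>pin n. F g - F (- g) = F' g - F' (- g))"
proof -
  have z: "rho (z_elem n \<otimes>\<^bsub>cover n\<^esub> x) = - rho x" if "x \<in> carrier (cover n)" for x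
    using that by (simp add: rho_mult)
  have "pe F = pe F' \<longleftrightarrow> emb F \<ominus>\<^bsub>R\<^esub> emb F' \<in> spin_ideal n"
    unfolding pe_def spin_proj_def by (rule RR.quotient_eq_iff_same_a_r_cos[OF ideal_spin_ideal, symmetric]) auto
  also have "\<dots> \<longleftrightarrow> (\<forall>x\<in>carrier (cover n). F (- rho x) - F' (- rho x) = F (rho x) - F' (rho x))"
  proof -
    have mem: "emb F \<ominus>\<^bsub>R\<^esub> emb F' \<in> carrier R" by simp
    have val: "emb F \<ominus>\<^bsub>R\<^esub> emb F' = (\<lambda>x. emb F x - emb F' x)" by (rule GR.minus_R) auto
    have "emb F \<ominus>\<^bsub>R\<^esub> emb F' \<in> spin_ideal n \<longleftrightarrow> (\<forall>x\<in>carrier (cover n).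
      (emb F \<ominus>\<^bsub>R\<^esub> emb F') (z_elem n \<otimes>\<^bsub>cover n\<^esub> x) = (emb F \<ominus>\<^bsub>R\<^esub> emb F') x)"
      using mem by (simp only: mem_spin_ideal_iff simp_thms)
    also have "\<dots> \<longleftrightarrow> (\<forall>x\<in>carrier (cover n). F (- rho x) - F' (- rho x) = F (rho x) - F' (rho x))"
      unfolding val by (rule ball_cong) (auto simp: emb_def z)
    finally show ?thesis .
  qed
  also have "\<dots> \<longleftrightarrow> (\<forall>g\<in>pin n. F (- g) - F' (- g) = F g - F' g)"
    unfolding rho_image [symmetric] by auto
  also have "\<dots> \<longleftrightarrow> (\<forall>g\<in>pin n. F g - F (- g) = F' g - F' (- g))"
    by (rule ball_cong) auto
  finally show ?thesis .
qed

lemma emb_add: "emb F \<oplus>\<^bsub>R\<^esub> emb F' = emb (\<lambda>g. F g + F' g)"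
  by (auto simp: GR.add_R emb_def)

lemma pe_add: "pe F \<oplus>\<^bsub>S\<^esub> pe F' = pe (\<lambda>g. F g + F' g)"
  unfolding pe_def using ring_hom_add[OF spin_proj_hom, of "emb F" "emb F'"] by (simp add: emb_add)

lemma set_sum_emb:
  assumes "D \<subseteq> carrier (cover n)"
  shows "set_sum D = emb (\<lambda>g. of_bool (g \<in> rho ` D))"
proof
  fix x
  have "rho x \<in> rho ` D \<longleftrightarrow> x \<in> D" if "x \<in> carrier (cover n)"
    using that assms rho_eq_iff by blast
  then show "set_sum D x = emb (\<lambda>g. of_bool (g \<in> rho ` D)) x"
    using assms by (auto simp: set_sum_def emb_def)
qed

lemma pe_one: "pe delta = \<one>\<^bsub>S\<^esub>"
proof -
  have "(\<lambda>g. of_bool (g \<in> rho ` {\<one>\<^bsub>cover n\<^esub>})) = (delta :: clif \<Rightarrow> int)"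
    by (simp add: fun_eq_iff delta_def)
  then have "\<one>\<^bsub>R\<^esub> = emb delta"
    using set_sum_emb[of "{\<one>\<^bsub>cover n\<^esub>}"] by (simp only: GR.one_R_single) simp
  then show ?thesis unfolding pe_def using ring_hom_one[OF spin_proj_hom] by simp
qed

lemma pe_zero: "pe (\<lambda>g. 0) = \<zero>\<^bsub>S\<^esub>"
proof -
  have "pe (\<lambda>g. 0) \<oplus>\<^bsub>S\<^esub> pe (\<lambda>g. 0) = pe (\<lambda>g. 0)" by (simp add: pe_add)
  then show ?thesis using SS.add.r_cancel_one[of "pe (\<lambda>g. 0)" "pe (\<lambda>g. 0)"] by simp
qed

lemma pe_sum: "finite A \<Longrightarrow> (\<Oplus>\<^bsub>S\<^esub>i\<in>A. pe (F i)) = pe (\<lambda>g. \<Sum>i\<in>A. F i g)"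
proof (induction A rule: finite_induct)
  case empty
  then show ?case by (simp add: pe_zero)
next
  case (insert a A)
  then show ?case by (simp add: SS.finsum_insert Pi_def pe_add)
qed

lemma pe_add_pow_nat: "[k] \<cdot>\<^bsub>S\<^esub> pe F = pe (\<lambda>g. int k * F g)"
proof (induction k)
  case 0
  show ?case by (simp add: pe_zero)
next
  case (Suc k)
  then show ?case by (simp add: pe_add algebra_simps)
qed

lemma pe_uminus: "\<ominus>\<^bsub>S\<^esub> pe F = pe (\<lambda>g. - F g)"
proof -
  have "pe (\<lambda>g. - F g) \<oplus>\<^bsub>S\<^esub> pe F = \<zero>\<^bsub>S\<^esub>" by (simp add: pe_add pe_zero)
  then show ?thesis by (intro SS.minus_equality) auto
qed

lemma pe_add_pow: "[k] \<cdot>\<^bsub>S\<^esub> pe F = pe (\<lambda>g. k * F g)" for k :: int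
proof (cases "0 \<le> k")
  case True
  then show ?thesis by (simp add: add_pow_int_ge pe_add_pow_nat)
next
  case False
  then show ?thesis by (simp add: add_pow_int_lt pe_add_pow_nat pe_uminus)
qed

lemma pe_mult_single:
  assumes y: "y \<in> carrier (cover n)" and inv: "h * rho y = 1" "rho y * h = 1"
  shows "pe F \<otimes>\<^bsub>S\<^esub> spin_proj n (set_sum {y}) = pe (\<lambda>g. F (g * h))"
proof -
  have "rho (inv\<^bsub>cover n\<^esub> y) * rho y = 1" using y by (simp flip: rho_mult)
  then have "rho (inv\<^bsub>cover n\<^esub> y) = h"
    using inv by (metis mult.assoc mult_1_left mult_1_right)
  then have "emb F \<otimes>\<^bsub>R\<^esub> set_sum {y} = emb (\<lambda>g. F (g * h))"
    unfolding GR.mult_R_single[OF emb_closed y] using y by (auto simp: emb_def rho_mult fun_eq_iff)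
  moreover have "set_sum {y} \<in> carrier R" using y by (intro GR.set_sum_closed) simp
  ultimately show ?thesis
    unfolding pe_def using ring_hom_mult[OF spin_proj_hom, of "emb F" "set_sum {y}"] by simp
qed

lemma odd_JM_closed:
  assumes "k \<le> n"
  shows "odd_JM n k \<in> carrier S"
  unfolding odd_JM_def
proof (rule SS.finsum_closed, rule funcsetI)
  fix i assume "i \<in> {1..<k}"
  then have "cycle_elem n [i, k] \<in> carrier (cover n)" using assms by (intro rho_cycle_elem) auto
  then have "set_sum {cycle_elem n [i, k]} \<in> carrier R" by (intro GR.set_sum_closed) simp
  then show "spin_proj n (set_sum {cycle_elem n [i, k]}) \<in> carrier S"
    by (rule ring_hom_closed[OF spin_proj_hom])
qed

lemma pe_mult_odd_JM:
  assumes "k \<le> n"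
  shows "pe F \<otimes>\<^bsub>S\<^esub> odd_JM n k = pe (neg (jm k F))"
proof -
  have cyc: "cycle_elem n [i, k] \<in> carrier (cover n)" "rho (cycle_elem n [i, k]) = rtv i k"
    if "i \<in> {1..<k}" for i
    using that assms rho_cycle_elem[of "[i, k]" n] rtv_eq_cyc_pair[of "n + 1" i k] by auto
  have single: "spin_proj n (set_sum {cycle_elem n [i, k]}) \<in> carrier S" if "i \<in> {1..<k}" for i
    using cyc(1)[OF that] by (intro ring_hom_closed[OF spin_proj_hom] GR.set_sum_closed) simp
  have "pe F \<otimes>\<^bsub>S\<^esub> odd_JM n k
    = (\<Oplus>\<^bsub>S\<^esub>i\<in>{1..<k}. pe F \<otimes>\<^bsub>S\<^esub> spin_proj n (set_sum {cycle_elem n [i, k]}))"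
    unfolding odd_JM_def using single by (intro SS.finsum_rdistr) auto
  also have "\<dots> = (\<Oplus>\<^bsub>S\<^esub>i\<in>{1..<k}. pe (\<lambda>g. F (g * - rtv i k)))"
  proof (rule SS.finsum_cong')
    fix i assume i: "i \<in> {1..<k}"
    show "pe F \<otimes>\<^bsub>S\<^esub> spin_proj n (set_sum {cycle_elem n [i, k]}) = pe (\<lambda>g. F (g * - rtv i k))"
      using cyc[OF i] i rtv_square[of i k] by (intro pe_mult_single) auto
  qed auto
  also have "\<dots> = pe (neg (jm k F))"
    by (simp add: pe_sum neg_def jm_def)
  finally show ?thesis .
qed

lemma pe_mult_odd_JM_square:
  assumes "k \<le> n"
  shows "pe F \<otimes>\<^bsub>S\<^esub> odd_JM n k [^]\<^bsub>S\<^esub> (2::nat) = pe (jm k (jm k F))"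
proof -
  have "odd_JM n k [^]\<^bsub>S\<^esub> (2::nat) = odd_JM n k \<otimes>\<^bsub>S\<^esub> odd_JM n k"
    using odd_JM_closed[OF assms] by (simp add: numeral_2_eq_2)
  then have "pe F \<otimes>\<^bsub>S\<^esub> odd_JM n k [^]\<^bsub>S\<^esub> (2::nat) = pe F \<otimes>\<^bsub>S\<^esub> odd_JM n k \<otimes>\<^bsub>S\<^esub> odd_JM n k"
    using odd_JM_closed[OF assms] by (simp add: SS.m_assoc)
  then show ?thesis
    using assms by (simp add: pe_mult_odd_JM neg_commutes neg_linear)
qed

text \<open>Both recursions multiply by the square for the largest index last and from the right.
  The unwanted sign in \<open>pe_mult_odd_JM\<close> is squared away.\<close>

lemma elem_sum_odd_JM:
  assumes "k \<le> n"
  shows "SS.elem_sum (\<lambda>k. odd_JM n k [^]\<^bsub>S\<^esub> (2::nat)) r k = pe (\<lambda>g. coeff (epoly k g) r)"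
  using assms
proof (induction k arbitrary: r)
  case 0
  then show ?case
  proof (cases r)
    case 0
    have "(\<lambda>g. coeff (epoly 0 g) 0) = delta" by (simp add: fun_eq_iff epoly_0 delta_def)
    then show ?thesis using 0 by (simp add: SS.elem_sum_0 pe_one)
  next
    case (Suc r')
    have "(\<lambda>g. coeff (epoly 0 g) r) = (\<lambda>g. 0)" using Suc by (simp add: fun_eq_iff epoly_0)
    then show ?thesis using Suc by (simp add: SS.elem_sum_empty pe_zero)
  qed
next
  case (Suc k)
  show ?case
  proof (cases r)
    case 0
    then show ?thesis
      using Suc.IH[of 0] Suc.prems by (simp add: SS.elem_sum_0 coeff_epoly_Suc)
  next
    case (Suc r')
    have closed: "odd_JM n i [^]\<^bsub>S\<^esub> (2::nat) \<in> carrier S" if "i \<in> {1..Suc k}" for i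
      using that Suc.prems odd_JM_closed by auto
    have "SS.elem_sum (\<lambda>k. odd_JM n k [^]\<^bsub>S\<^esub> (2::nat)) r (Suc k)
      = pe (\<lambda>g. coeff (epoly k g) (Suc r')) \<oplus>\<^bsub>S\<^esub> pe (jm (Suc k) (jm (Suc k) (\<lambda>g. coeff (epoly k g) r')))"
      using Suc.IH Suc.prems \<open>r = Suc r'\<close> SS.elem_sum_Suc[where k = k and r = r', OF closed]
      by (simp add: pe_mult_odd_JM_square)
    also have "\<dots> = pe (\<lambda>g. coeff (epoly (Suc k) g) r)"
      using \<open>r = Suc r'\<close>
      by (simp add: pe_add coeff_epoly_Suc jm_def atLeastLessThanSuc_atLeastAtMost)
    finally show ?thesis .
  qed
qed

lemma e_elem_eq: "e_elem r n = pe (\<lambda>g. coeff (epoly n g) r)"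
  using elem_sum_odd_JM[of n r] by (simp add: e_elem_def SS.elem_sum_def)

end


section \<open>The classes \<open>D\<^sub>\<nu>(n)\<close> and the expansion of \<open>e\<^sub>r\<^sub>;\<^sub>n\<close>\<close>

lemma cycles_of_permutation:
  assumes "cycle_decomp S \<sigma>"
  shows "(\<forall>x. x \<notin> S \<longrightarrow> \<sigma> x = x) \<and>
    (\<exists>css. distinct (concat css) \<and> set (concat css) = S \<and> (\<forall>c\<in>set css. c \<noteq> [] \<and> map \<sigma> c = rotate1 c))"
  using assms
proof (induction rule: cycle_decomp.induct)
  case empty
  have "distinct (concat []) \<and> set (concat []) = {} \<and> (\<forall>c\<in>set []. c \<noteq> [] \<and> map id c = rotate1 c)" by simp
  then show ?case by (metis id_apply)
next
  case (comp I p cs)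
  then obtain css where css: "distinct (concat css)" "set (concat css) = I"
    "\<forall>c\<in>set css. c \<noteq> [] \<and> map p c = rotate1 c" and p: "\<And>x. x \<notin> I \<Longrightarrow> p x = x" by blast
  let ?\<tau> = "cycle_of_list cs \<circ> p"
  have \<tau>css: "map ?\<tau> d = rotate1 d" if "d \<in> set css" for d
  proof -
    have "map ?\<tau> d = map (cycle_of_list cs) (rotate1 d)" using css(3) that by (metis map_map)
    also have "\<dots> = rotate1 d"
      using comp.hyps(3) css(2) that by (intro map_idI id_outside_supp) auto
    finally show ?thesis .
  qed
  have \<tau>cs: "map ?\<tau> cs = rotate1 cs"
  proof -
    have "map p cs = cs" using comp.hyps(3) by (intro map_idI p) auto
    then have "map ?\<tau> cs = map (cycle_of_list cs) cs" by (metis map_map)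
    also have "\<dots> = rotate1 cs" using cyclic_rotation[OF comp.hyps(2), of 1] by simp
    finally show ?thesis .
  qed
  have "?\<tau> x = x" if "x \<notin> set cs \<union> I" for x
    using that p id_outside_supp[of x cs] by simp
  moreover have "\<exists>css'. distinct (concat css') \<and> set (concat css') = set cs \<union> I \<and>
      (\<forall>c\<in>set css'. c \<noteq> [] \<and> map ?\<tau> c = rotate1 c)"
  proof (cases "cs = []")
    case True
    then have "set (concat css) = set cs \<union> I" using css(2) by simp
    then show ?thesis using css(1,3) \<tau>css by blast
  next
    case False
    have "distinct (concat (cs # css))" "set (concat (cs # css)) = set cs \<union> I"
      using css(1,2) comp.hyps(2,3) by auto
    moreover have "\<forall>c\<in>set (cs # css). c \<noteq> [] \<and> map ?\<tau> c = rotate1 c"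
      using False css(3) \<tau>css \<tau>cs by (metis set_ConsD)
    ultimately show ?thesis by blast
  qed
  ultimately show ?case by blast
qed

lemma funpow_rotates:
  assumes "map \<sigma> c = rotate1 c" "i < length c"
  shows "(\<sigma> ^^ k) (c ! i) = c ! ((i + k) mod length c)"
proof (induction k)
  case (Suc k)
  have lt: "(i + k) mod length c < length c" using assms(2) by (intro mod_less_divisor) auto
  have "\<sigma> (c ! j) = c ! (Suc j mod length c)" if "j < length c" for j
    using nth_rotate1[OF that] assms(1) that by (metis nth_map)
  then show ?case using Suc lt by (simp add: mod_Suc_eq)
qed (use assms in simp)

lemma orbit_of_cycle:
  assumes "map \<sigma> c = rotate1 c" "x \<in> set c"
  shows "range (\<lambda>k. (\<sigma> ^^ k) x) = set c"
proof -
  obtain i where i: "i < length c" "x = c ! i" using assms(2) by (metis in_set_conv_nth)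
  show ?thesis
  proof
    show "range (\<lambda>k. (\<sigma> ^^ k) x) \<subseteq> set c"
    proof
      fix y assume "y \<in> range (\<lambda>k. (\<sigma> ^^ k) x)"
      then obtain k where "y = c ! ((i + k) mod length c)" using funpow_rotates[OF assms(1) i(1)] i(2) by auto
      moreover have "(i + k) mod length c < length c" using i(1) by (intro mod_less_divisor) auto
      ultimately show "y \<in> set c" by simp
    qed
    show "set c \<subseteq> range (\<lambda>k. (\<sigma> ^^ k) x)"
    proof
      fix y assume "y \<in> set c"
      then obtain j where j: "j < length c" "y = c ! j" by (metis in_set_conv_nth)
      have "(i + (length c - i + j)) mod length c = j" using i(1) j(1) by simp
      then have "y = (\<sigma> ^^ (length c - i + j)) x"
        using funpow_rotates[OF assms(1) i(1), of "length c - i + j"] i(2) j(2) by simp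
      then show "y \<in> range (\<lambda>k. (\<sigma> ^^ k) x)" by blast
    qed
  qed
qed

text \<open>The right-hand side mentions \<open>\<sigma>\<close> only: the listed cycles are its
  nontrivial orbits. Thus the cycle type can be recovered from the permutation.\<close>

lemma cycle_type_unique:
  assumes "distinct (concat css)" "\<forall>c\<in>set css. 1 < length c \<and> map \<sigma> c = rotate1 c"
    "\<And>x. x \<notin> set (concat css) \<Longrightarrow> \<sigma> x = x"
  shows "mset (map length css) = image_mset card (mset_set ((\<lambda>x. range (\<lambda>k. (\<sigma> ^^ k) x)) ` {x. \<sigma> x \<noteq> x}))"
proof -
  let ?o = "\<lambda>x. range (\<lambda>k. (\<sigma> ^^ k) x)"
  have ne: "c \<noteq> []" if "c \<in> set css" for c using assms(2) that by auto
  have moves: "\<sigma> x \<noteq> x" if c: "c \<in> set css" "x \<in> set c" for c x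
  proof
    assume fx: "\<sigma> x = x"
    have "(\<sigma> ^^ k) x = x" for k by (induction k) (simp_all add: fx)
    then have "?o x = {x}" by auto
    then have "set c = {x}" using orbit_of_cycle[of \<sigma> c x] assms(2) c by auto
    then have "length c = 1" using distinct_card[of c] assms(1) c(1) by (auto simp: distinct_concat_iff)
    then show False using assms(2) c(1) by auto
  qed
  have "?o ` {x. \<sigma> x \<noteq> x} = set ` set css"
  proof
    show "?o ` {x. \<sigma> x \<noteq> x} \<subseteq> set ` set css"
    proof
      fix O' assume "O' \<in> ?o ` {x. \<sigma> x \<noteq> x}"
      then obtain x where x: "\<sigma> x \<noteq> x" "O' = ?o x" by blast
      then obtain c where "c \<in> set css" "x \<in> set c" using assms(3) by fastforce
      then show "O' \<in> set ` set css" using orbit_of_cycle[of \<sigma> c x] assms(2) x(2) by auto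
    qed
    show "set ` set css \<subseteq> ?o ` {x. \<sigma> x \<noteq> x}"
    proof
      fix O' assume "O' \<in> set ` set css"
      then obtain c where c: "c \<in> set css" "O' = set c" by blast
      then have "hd c \<in> set c" using ne by simp
      then show "O' \<in> ?o ` {x. \<sigma> x \<noteq> x}"
        using orbit_of_cycle[of \<sigma> c "hd c"] moves[of c "hd c"] assms(2) c by blast
    qed
  qed
  moreover have "mset (map set css) = mset_set (set ` set css)"
  proof -
    have "distinct (map set css)"
      using assms(1) ne
    proof (induction css)
      case (Cons c css)
      have "set c \<noteq> set d" if "d \<in> set css" for d
      proof
        assume eq: "set c = set d"
        have "hd c \<in> set c" using Cons.prems(2)[of c] by simp
        moreover have "set c \<inter> set (concat css) = {}" using Cons.prems(1) by simp
        ultimately show False using eq that by auto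
      qed
      moreover have "distinct (map set css)" using Cons.prems by (intro Cons.IH) auto
      ultimately show ?case by auto
    qed simp
    then have "mset_set (set (map set css)) = mset (map set css)" by (rule mset_set_set)
    then show ?thesis by (simp only: set_map)
  qed
  moreover have "mset (map length css) = image_mset card (mset (map set css))"
  proof -
    have "map length css = map (card \<circ> set) css"
      using assms(1) by (auto simp: distinct_concat_iff distinct_card)
    then show ?thesis by (metis map_map mset_map)
  qed
  ultimately show ?thesis by simp
qed

lemma chunks:
  "sum_list ls \<le> length xs \<Longrightarrow> \<exists>cs. map length cs = ls \<and> concat cs = take (sum_list ls) xs"
proof (induction ls arbitrary: xs)
  case (Cons l ls)
  then have "sum_list ls \<le> length (drop l xs)" by simp
  then obtain cs where "map length cs = ls" "concat cs = take (sum_list ls) (drop l xs)"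
    using Cons.IH by blast
  then show ?case
    using Cons.prems by (intro exI[of _ "take l xs # cs"]) (simp add: take_add)
qed simp

lemma extend_to_permutation:
  fixes n :: nat
  assumes "distinct xs" "distinct ys" "length xs = length ys" "set xs \<subseteq> {1..n}" "set ys \<subseteq> {1..n}"
  shows "\<exists>\<tau>. \<tau> permutes {1..n} \<and> map \<tau> xs = ys"
proof -
  let ?xs = "xs @ sorted_list_of_set ({1..n} - set xs)" and ?ys = "ys @ sorted_list_of_set ({1..n} - set ys)"
  have dx: "distinct ?xs" and dy: "distinct ?ys" using assms by auto
  have sx: "set ?xs = {1..n}" and sy: "set ?ys = {1..n}" using assms by auto
  have lx: "length ?xs = n" using distinct_card[OF dx] sx by simp
  have ly: "length ?ys = n" using distinct_card[OF dy] sy by simp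
  have bx: "bij_betw ((!) ?xs) {..<n} {1..n}" by (rule bij_betw_nth[OF dx]) (use lx sx in auto)
  have b_ys: "bij_betw ((!) ?ys) {..<n} {1..n}" by (rule bij_betw_nth[OF dy]) (use ly sy in auto)
  define f where "f = (!) ?ys \<circ> inv_into {..<n} ((!) ?xs)"
  define \<tau> where "\<tau> i = (if i \<in> {1..n} then f i else i)" for i
  have "bij_betw f {1..n} {1..n}"
    unfolding f_def by (rule bij_betw_trans[OF bij_betw_inv_into[OF bx] b_ys])
  then have "bij_betw \<tau> {1..n} {1..n}"
    by (subst bij_betw_cong[of _ \<tau> f]) (auto simp: \<tau>_def)
  then have "\<tau> permutes {1..n}" by (rule bij_imp_permutes) (auto simp: \<tau>_def)
  moreover have "map \<tau> xs = ys"
  proof (rule nth_equalityI)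
    fix i assume "i < length (map \<tau> xs)"
    then have i: "i < length xs" "i < n" using lx by auto
    then have "inv_into {..<n} ((!) ?xs) (?xs ! i) = i"
      using bij_betw_imp_inj_on[OF bx] by (intro inv_into_f_f) auto
    then have "f (?xs ! i) = ?ys ! i" by (simp add: f_def)
    moreover have "?xs ! i = xs ! i" "?ys ! i = ys ! i" using i assms(3) by (simp_all add: nth_append)
    moreover have "xs ! i \<in> {1..n}" using i assms(4) nth_mem by blast
    ultimately show "map \<tau> xs ! i = ys ! i" using i by (simp add: \<tau>_def)
  qed (use assms in simp)
  ultimately show ?thesis by blast
qed

section \<open>The classes inside the Clifford ring\<close>

definition cycle_lists :: "nat multiset \<Rightarrow> nat \<Rightarrow> nat list list set" where
  "cycle_lists \<nu> n = {cs. map length cs = map Suc (rev (sorted_list_of_multiset \<nu>)) \<and>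
     distinct (concat cs) \<and> set (concat cs) \<subseteq> {1..n}}"

definition clif_class :: "nat multiset \<Rightarrow> nat \<Rightarrow> clif set" where
  "clif_class \<nu> n = prodcyc (n + 1) ` cycle_lists \<nu> n"

lemma mset_lengths:
  assumes "cs \<in> cycle_lists \<nu> n"
  shows "image_mset length (mset cs) = image_mset Suc \<nu>"
proof -
  have "mset (map length cs) = mset (map Suc (rev (sorted_list_of_multiset \<nu>)))"
    using assms by (simp only: cycle_lists_def mem_Collect_eq)
  then show ?thesis by simp
qed

lemma cycle_lists_length:
  assumes "cs \<in> cycle_lists \<nu> n" "\<nu> \<in> \<E>\<P>" "c \<in> set cs"
  shows "odd (length c)" "1 < length c"
proof -
  have "length c \<in># image_mset Suc \<nu>" using assms(3) by (simp flip: mset_lengths[OF assms(1)])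
  then show "odd (length c)" "1 < length c" using assms(2) by (auto simp: even_partitions_def)
qed

lemma lifts_cycle_list:
  assumes "cs \<in> cycle_lists \<nu> n" "\<nu> \<in> \<E>\<P>"
  shows "\<exists>\<sigma>. lifts (prodcyc (n + 1) cs) 1 \<sigma> \<and> (\<forall>c\<in>set cs. map \<sigma> c = rotate1 c) \<and> \<sigma> permutes set (concat cs)"
  using assms cycle_lists_length[OF assms] by (intro lifts_prodcyc) (auto simp: cycle_lists_def)

lemma prodcyc_in_pin:
  assumes "distinct (concat cs)" "set (concat cs) \<subseteq> {1..n}" "\<forall>c\<in>set cs. c \<noteq> []"
  shows "prodcyc (n + 1) cs \<in> pin n"
  using assms
proof (induction cs)
  case (Cons c cs)
  then have "cyc (n + 1) c \<in> pin n" by (intro cyc_in_pin) auto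
  then show ?case using Cons by (auto intro: pin_mult)
qed simp

lemma clif_class_in_pin: "\<nu> \<in> \<E>\<P> \<Longrightarrow> g \<in> clif_class \<nu> n \<Longrightarrow> g \<in> pin n"
proof -
  assume \<nu>: "\<nu> \<in> \<E>\<P>" and "g \<in> clif_class \<nu> n"
  then obtain cs where cs: "cs \<in> cycle_lists \<nu> n" "g = prodcyc (n + 1) cs"
    unfolding clif_class_def by blast
  have "c \<noteq> []" if "c \<in> set cs" for c
    using cycle_lists_length(2)[OF cs(1) \<nu> that] by auto
  then show "g \<in> pin n"
    unfolding cs(2) using cs(1) by (intro prodcyc_in_pin) (simp_all add: cycle_lists_def)
qed

lemma clif_class_nonempty:
  assumes "sum_mset \<nu> + size \<nu> \<le> n"
  shows "clif_class \<nu> n \<noteq> {}"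
proof -
  let ?ls = "map Suc (rev (sorted_list_of_multiset \<nu>))"
  have sum: "sum_list ?ls = sum_mset \<nu> + size \<nu>"
  proof -
    have "sum_list ?ls = sum_mset (image_mset Suc \<nu>)"
      by (simp flip: sum_mset_sum_list)
    also have "\<dots> = sum_mset \<nu> + size \<nu>" by (induction \<nu>) auto
    finally show ?thesis .
  qed
  define xs where "xs = [1..<n + 1]"
  have "length xs = n" by (simp add: xs_def)
  then have "sum_list ?ls \<le> length xs" using assms sum by simp
  then obtain cs where cs: "map length cs = ?ls" "concat cs = take (sum_list ?ls) xs"
    using chunks by blast
  have "distinct xs" "set xs = {1..n}" by (auto simp: xs_def)
  then have "distinct (concat cs)" "set (concat cs) \<subseteq> {1..n}"
    unfolding cs(2) using set_take_subset by (auto dest: in_set_takeD)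
  then have "cs \<in> cycle_lists \<nu> n" unfolding cycle_lists_def using cs(1) by blast
  then show ?thesis by (auto simp: clif_class_def)
qed

lemma epoly_conj: "h \<in> pin n \<Longrightarrow> h * g = g' * h \<Longrightarrow> epoly n g = epoly n g'"
  unfolding epoly_def by (rule esym_delta_conj)

text \<open>A permutation matching the points of the two lists of cycles has a lift, and conjugation
  by this lift takes one product to the other. No sign arises, since for odd length the exponent in
  \<open>cyc_conj\<close> is even.\<close>

lemma spin_coeff_clif_class_constant:
  assumes \<nu>: "\<nu> \<in> \<E>\<P>" and g: "g \<in> clif_class \<nu> n" and g': "g' \<in> clif_class \<nu> n"
  shows "spin_coeff r n g = spin_coeff r n g'"
proof -
  obtain cs cs' where cs: "cs \<in> cycle_lists \<nu> n" "g = prodcyc (n + 1) cs"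
    and cs': "cs' \<in> cycle_lists \<nu> n" "g' = prodcyc (n + 1) cs'"
    using g g' by (auto simp: clif_class_def)
  have lens: "map length cs = map length cs'" using cs(1) cs'(1) by (simp add: cycle_lists_def)
  then have "length (concat cs) = length (concat cs')" by (simp add: length_concat)
  then obtain \<tau> where \<tau>: "\<tau> permutes {1..n}" "map \<tau> (concat cs) = concat cs'"
    using extend_to_permutation[of "concat cs" "concat cs'" n] cs(1) cs'(1)
    by (auto simp: cycle_lists_def)
  have map\<tau>: "map (map \<tau>) cs = cs'"
  proof -
    have lens': "length (map (map \<tau>) cs) = length cs'" using lens by (metis length_map)
    have "length (map \<tau> c) = length c'" if "(map \<tau> c, c') \<in> set (zip (map (map \<tau>) cs) cs')" for c c'
      using that lens by (auto simp: set_zip) (metis nth_map length_map)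
    then have "\<forall>(x, y)\<in>set (zip (map (map \<tau>) cs) cs'). length x = length y"
      using lens lens' by (auto simp: set_zip) (metis nth_map length_map)
    then show ?thesis using concat_eq_concat_iff[OF _ lens'] \<tau>(2) by (simp add: map_concat)
  qed
  obtain h s where h: "h \<in> pin n" "lifts h s \<tau>" using pin_lift[OF \<tau>(1)] by blast
  have fix_p: "\<tau> (n + 1) = n + 1" using permutes_not_in[OF \<tau>(1)] by auto
  have "h * prodcyc (n + 1) ds = prodcyc (n + 1) (map (map \<tau>) ds) * h"
    if "\<forall>c\<in>set ds. odd (length c)" for ds
    using that
  proof (induction ds)
    case (Cons c ds)
    have "c \<noteq> []" "s ^ Suc (length c) = 1"
      using Cons.prems lifts_sign[OF h(2)] by auto
    then have "h * cyc (n + 1) c = cyc (n + 1) (map \<tau> c) * h"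
      using cyc_conj[OF h(2) fix_p, of c] by simp
    then have "h * prodcyc (n + 1) (c # ds) = cyc (n + 1) (map \<tau> c) * (h * prodcyc (n + 1) ds)"
      by (simp flip: mult.assoc)
    then show ?case using Cons by (simp add: mult.assoc)
  qed simp
  then have "h * g = g' * h" using cycle_lists_length(1)[OF cs(1) \<nu>] cs(2) cs'(2) map\<tau> by blast
  then have "epoly n g = epoly n g'" "epoly n (- g) = epoly n (- g')"
    using h(1) by (auto intro!: epoly_conj[of h])
  then show ?thesis by (simp add: spin_coeff_def)
qed

lemma spin_coeff_clif_class:
  assumes \<nu>: "\<nu> \<in> \<E>\<P>" and g: "g \<in> clif_class \<nu> n" and r: "sum_mset \<nu> = 2 * r"
  shows "spin_coeff r n g = (\<Prod>i\<in>#\<nu>. - int (catalan (i div 2)))"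
proof -
  obtain cs where cs: "cs \<in> cycle_lists \<nu> n" "g = prodcyc (n + 1) cs" using g by (auto simp: clif_class_def)
  have "(\<Sum>c\<leftarrow>cs. length c - 1) = sum_mset (image_mset (\<lambda>l. l - 1) (image_mset length (mset cs)))"
    by (simp add: multiset.map_comp comp_def flip: sum_mset_sum_list)
  also have "\<dots> = 2 * r" unfolding mset_lengths[OF cs(1)] by (simp add: multiset.map_comp comp_def r)
  finally have "spin_coeff r n g = (\<Prod>c\<leftarrow>cs. - int (catalan (length c div 2)))"
    unfolding cs(2) using cs(1) cycle_lists_length(1)[OF cs(1) \<nu>]
    by (intro spin_coeff_top) (auto simp: cycle_lists_def)
  also have "\<dots> = prod_mset (image_mset (\<lambda>l. - int (catalan (l div 2))) (image_mset length (mset cs)))"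
    by (simp add: multiset.map_comp comp_def flip: prod_mset_prod_list)
  also have "\<dots> = (\<Prod>i\<in>#\<nu>. - int (catalan (i div 2)))"
    unfolding mset_lengths[OF cs(1)] multiset.map_comp comp_def
    by (intro arg_cong[of _ _ prod_mset] image_mset_cong) (use \<nu> in \<open>auto simp: even_partitions_def\<close>)
  finally show ?thesis .
qed

lemma catalan_pos: "0 < catalan n"
proof (induction n rule: less_induct)
  case (less n)
  show ?case
  proof (cases n)
    case (Suc m)
    have "0 < catalan 0 * catalan (m - 0)" using less Suc by simp
    also have "\<dots> \<le> (\<Sum>i\<le>m. catalan i * catalan (m - i))"
      by (rule member_le_sum[where f = "\<lambda>i. catalan i * catalan (m - i)"]) auto
    also have "\<dots> = catalan n" by (simp only: Suc catalan.simps(2))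
    finally show ?thesis .
  qed simp
qed

text \<open>The top coefficient takes one value on the whole class and changes sign under negation;
  being a product of nonzero Catalan numbers up to sign, it cannot be its own negative.\<close>

lemma clif_class_uminus:
  assumes \<nu>: "\<nu> \<in> \<E>\<P>" and g: "g \<in> clif_class \<nu> n"
  shows "- g \<notin> clif_class \<nu> n"
proof
  assume ng: "- g \<in> clif_class \<nu> n"
  have "even (sum_mset \<nu>)" using \<nu> by (induction \<nu>) (auto simp: even_partitions_def)
  then obtain r where r: "sum_mset \<nu> = 2 * r" by blast
  let ?v = "\<Prod>i\<in>#\<nu>. - int (catalan (i div 2))"
  have "?v = - ?v"
    using spin_coeff_clif_class[OF \<nu> g r] spin_coeff_clif_class[OF \<nu> ng r] by (simp add: spin_coeff_uminus)
  moreover have "?v \<noteq> 0"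
  proof -
    have "catalan j \<noteq> 0" for j using catalan_pos[of j] by simp
    note nonzero = this
    show ?thesis by (simp add: prod_mset_zero_iff nonzero image_iff)
  qed
  ultimately show False by simp
qed

text \<open>Neither negation nor the choice of a list changes the permutation below, and its cycle
  type determines the partition.\<close>

lemma clif_class_type:
  assumes \<nu>: "\<nu> \<in> \<E>\<P>" and \<mu>: "\<mu> \<in> \<E>\<P>" and g: "g \<in> clif_class \<nu> n"
    and g': "g \<in> clif_class \<mu> n \<or> - g \<in> clif_class \<mu> n"
  shows "\<nu> = \<mu>"
proof -
  have type: "image_mset Suc \<kappa> = image_mset card (mset_set ((\<lambda>x. range (\<lambda>k. (\<sigma> ^^ k) x)) ` {x. \<sigma> x \<noteq> x}))"
    if \<kappa>: "\<kappa> \<in> \<E>\<P>" "f \<in> clif_class \<kappa> n" "lifts f s \<sigma>" for \<kappa> f s \<sigma>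
  proof -
    obtain cs where cs: "cs \<in> cycle_lists \<kappa> n" "f = prodcyc (n + 1) cs"
      using \<kappa>(2) by (auto simp: clif_class_def)
    obtain \<rho> where \<rho>: "lifts f 1 \<rho>" "\<forall>c\<in>set cs. map \<rho> c = rotate1 c" "\<rho> permutes set (concat cs)"
      using lifts_cycle_list[OF cs(1) \<kappa>(1)] cs(2) by blast
    have "\<sigma> = \<rho>" using lifts_unique(1)[OF \<kappa>(3) \<rho>(1)] .
    then have "mset (map length cs)
      = image_mset card (mset_set ((\<lambda>x. range (\<lambda>k. (\<sigma> ^^ k) x)) ` {x. \<sigma> x \<noteq> x}))"
      using cs(1) cycle_lists_length(2)[OF cs(1) \<kappa>(1)] \<rho>(2) permutes_not_in[OF \<rho>(3)]
      by (intro cycle_type_unique) (auto simp: cycle_lists_def)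
    then show ?thesis using mset_lengths[OF cs(1)] by simp
  qed
  obtain s \<sigma> where \<sigma>: "lifts g s \<sigma>" using pin_lifts[OF clif_class_in_pin[OF \<nu> g]] by blast
  have "image_mset Suc \<nu> = image_mset Suc \<mu>"
    using type[OF \<nu> g \<sigma>] g' type[OF \<mu> _ \<sigma>] type[OF \<mu> _ lifts_uminus[OF \<sigma>]] by auto
  then have "image_mset (\<lambda>i. i - 1) (image_mset Suc \<nu>) = image_mset (\<lambda>i. i - 1) (image_mset Suc \<mu>)" by simp
  then show ?thesis by (simp add: multiset.map_comp comp_def)
qed

text \<open>An even cycle would make the coefficient vanish. When all cycles are odd, the product of
  the nontrivial ones belongs to a class and lies over the same permutation as \<open>g\<close>,
  hence equals \<open>g\<close> up to sign.\<close>

lemma spin_coeff_support: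
  assumes "g \<in> pin n" "spin_coeff r n g \<noteq> 0"
  shows "\<exists>\<nu>\<in>basis_index n. g \<in> clif_class \<nu> n \<or> - g \<in> clif_class \<nu> n"
proof -
  obtain s \<sigma> where \<sigma>: "lifts g s \<sigma>" "\<sigma> permutes {1..n}" using pin_lifts[OF assms(1)] by blast
  have "cycle_decomp {1..n} \<sigma>" by (rule cycle_decomposition[OF \<sigma>(2)]) simp
  then obtain css where css: "distinct (concat css)" "set (concat css) = {1..n}"
    "\<forall>c\<in>set css. c \<noteq> [] \<and> map \<sigma> c = rotate1 c" using cycles_of_permutation by blast
  have dc: "distinct c" if "c \<in> set css" for c
    using css(1) that by (auto simp: distinct_concat_iff)
  have odd: "odd (length c)" if c: "c \<in> set css" for c
  proof (rule ccontr)
    assume "\<not> odd (length c)"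
    moreover have "set c \<subseteq> {1..n}" using css(2) c by auto
    ultimately have "spin_coeff r n g = 0"
      using css(3) c dc[OF c] by (intro spin_coeff_even_cycle[OF \<sigma>(1)]) auto
    then show False using assms(2) by simp
  qed
  define ds where "ds = filter (\<lambda>c. length c \<noteq> 1) css"
  \<comment> \<open>Cycles are listed by decreasing length, the order required in
    \<open>cycle_lists\<close>.\<close>
  define cs where "cs = rev (sort_key length ds)"
  define \<nu> where "\<nu> = mset (map (\<lambda>c. length c - 1) ds)"
  have set_cs: "set cs = set ds" by (simp add: cs_def)
  have ds_css: "set ds \<subseteq> set css" by (auto simp: ds_def)
  have mset_ds: "mset ds \<subseteq># mset css" by (simp add: ds_def mset_filter)
  have distinct_ds: "distinct (concat ds)"
    using css(1) unfolding ds_def by (induction css) auto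
  have distinct_cs: "distinct (concat cs)"
  proof -
    have "mset (concat cs) = mset (concat ds)"
      by (simp add: mset_concat cs_def flip: sum_mset_sum_list)
    then show ?thesis using distinct_ds mset_eq_imp_distinct_iff by blast
  qed
  have lens: "length c = Suc (length c - 1)" "0 < length c - 1" "even (length c - 1)" if "c \<in> set ds" for c
  proof -
    have "odd (length c)" "length c \<noteq> 1" using that odd by (auto simp: ds_def)
    then have "1 < length c" by (metis even_zero less_one nat_neq_iff)
    then show "length c = Suc (length c - 1)" "0 < length c - 1" "even (length c - 1)"
      using \<open>odd (length c)\<close> by auto
  qed
  have \<nu>EP: "\<nu> \<in> \<E>\<P>" using lens by (auto simp: \<nu>_def even_partitions_def)
  have "sorted_list_of_multiset \<nu> = map (\<lambda>c. length c - 1) (sort_key length ds)"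
  proof -
    have "sorted (map (\<lambda>c. length c - 1) (sort_key length ds))"
    proof -
      have "sorted (map (\<lambda>l. l - 1) (map length (sort_key length ds)))"
        by (rule sorted_map_mono) (auto intro: monoI simp: mono_on_def)
      then show ?thesis by (simp add: comp_def)
    qed
    then have "sort (map (\<lambda>c. length c - 1) ds) = map (\<lambda>c. length c - 1) (sort_key length ds)"
      by (intro properties_for_sort) auto
    then show ?thesis by (simp only: \<nu>_def sorted_list_of_multiset_mset)
  qed
  then have "map Suc (rev (sorted_list_of_multiset \<nu>)) = map length cs"
    using lens(1) by (auto simp: cs_def rev_map)
  then have mem: "cs \<in> cycle_lists \<nu> n"
    using distinct_cs css(2) ds_css by (auto simp: cycle_lists_def set_cs)
  have "sum_mset \<nu> + size \<nu> \<le> n"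
  proof -
    have "sum_mset \<nu> + size \<nu> = (\<Sum>c\<leftarrow>ds. length c)"
    proof -
      have "sum_list (map (\<lambda>c. length c - 1) xss) + length xss = (\<Sum>c\<leftarrow>xss. length c)"
        if "\<forall>c\<in>set xss. 0 < length c" for xss :: "nat list list"
        using that
      proof (induction xss)
        case (Cons c xss)
        then show ?case by (cases c) auto
      qed simp
      moreover have "\<forall>c\<in>set ds. 0 < length c" using lens(1) by (metis zero_less_Suc)
      ultimately show ?thesis by (simp add: \<nu>_def sum_mset_sum_list del: mset_map)
    qed
    also have "\<dots> = card (set (concat ds))" using distinct_card[OF distinct_ds] by (simp add: length_concat)
    also have "\<dots> \<le> card {1..n}" using ds_css css(2) by (intro card_mono) auto
    finally show ?thesis by simp
  qed
  then have \<nu>: "\<nu> \<in> basis_index n" using \<nu>EP by (simp add: basis_index_def)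
  obtain \<rho> where \<rho>: "lifts (prodcyc (n + 1) cs) 1 \<rho>" "\<forall>c\<in>set cs. map \<rho> c = rotate1 c"
    "\<rho> permutes set (concat cs)" using lifts_cycle_list[OF mem \<nu>EP] by blast
  have "\<rho> x = \<sigma> x" for x
  proof (cases "x \<in> {1..n}")
    case False
    then have "x \<notin> set (concat cs)" using mem by (auto simp: cycle_lists_def)
    then show ?thesis using False permutes_not_in[OF \<rho>(3)] permutes_not_in[OF \<sigma>(2)] by simp
  next
    case True
    then have "x \<in> set (concat css)" by (simp only: css(2))
    then obtain c where c: "c \<in> set css" "x \<in> set c" by auto
    show ?thesis
    proof (cases "length c = 1")
      case True
      then obtain y where "c = [y]" by (metis One_nat_def length_0_conv length_Suc_conv)
      then have cx: "c = [x]" using c(2) by simp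
      then have "\<sigma> x = x" using css(3) c(1) by auto
      moreover have "x \<notin> set (concat cs)"
      proof
        assume "x \<in> set (concat cs)"
        then obtain d where d: "d \<in> set ds" "x \<in> set d" by (auto simp: set_cs)
        then have "d = c \<or> set d \<inter> set c = {}"
          using css(1) ds_css c(1) unfolding distinct_concat_iff by blast
        then show False using d cx by (auto simp: ds_def)
      qed
      ultimately show ?thesis using permutes_not_in[OF \<rho>(3)] by simp
    next
      case False
      then have "map \<rho> c = map \<sigma> c" using \<rho>(2) css(3) c(1) by (simp add: set_cs ds_def)
      then show ?thesis using c(2) by simp
    qed
  qed
  then have "\<rho> = \<sigma>" by auto
  then have "g = prodcyc (n + 1) cs \<or> g = - prodcyc (n + 1) cs"
    using pin_lifts_unique[OF assms(1) _ \<sigma>(1)] \<rho>(1) clif_class_in_pin[OF \<nu>EP] mem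
    by (auto simp: clif_class_def)
  moreover have "prodcyc (n + 1) cs \<in> clif_class \<nu> n" using mem by (simp add: clif_class_def)
  ultimately show ?thesis using \<nu> by auto
qed

lemma finite_basis_index: "finite (basis_index n)"
proof (rule finite_subset)
  show "basis_index n \<subseteq> mset ` {xs. set xs \<subseteq> {..n} \<and> length xs \<le> n}"
  proof
    fix \<mu> assume \<mu>: "\<mu> \<in> basis_index n"
    obtain xs where xs: "mset xs = \<mu>" by (meson ex_mset)
    then have "sum_list xs + length xs \<le> n" using \<mu> by (auto simp: basis_index_def sum_mset_sum_list)
    then have "xs \<in> {xs. set xs \<subseteq> {..n} \<and> length xs \<le> n}"
      using member_le_sum_list[of _ xs] by fastforce
    then show "\<mu> \<in> mset ` {xs. set xs \<subseteq> {..n} \<and> length xs \<le> n}" using xs by blast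
  qed
  show "finite (mset ` {xs. set xs \<subseteq> {..n} \<and> length xs \<le> n})"
    by (simp add: finite_lists_length_le)
qed

section \<open>Coordinates with respect to the class sums\<close>

context spin_cover
begin

lemma D_class_subset:
  assumes "\<nu> \<in> \<E>\<P>"
  shows "D_class \<nu> n \<subseteq> carrier (cover n)" "rho ` D_class \<nu> n = clif_class \<nu> n"
proof -
  have D: "D_class \<nu> n = (\<lambda>cs. list_mult (cover n) (map (cycle_elem n) cs)) ` cycle_lists \<nu> n"
    by (auto simp: D_class_def cycle_lists_def)
  have elem: "set (map (cycle_elem n) cs) \<subseteq> carrier (cover n)"
      "map rho (map (cycle_elem n) cs) = map (cyc (n + 1)) cs" if cs: "cs \<in> cycle_lists \<nu> n" for cs
  proof -
    have "cycle_elem n c \<in> carrier (cover n) \<and> rho (cycle_elem n c) = cyc (n + 1) c" if c: "c \<in> set cs" for c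
    proof -
      have "distinct c" "set c \<subseteq> {1..n}" using cs c by (auto simp: cycle_lists_def distinct_concat_iff)
      moreover have "c \<noteq> []" using cycle_lists_length(2)[OF cs assms c] by auto
      ultimately show ?thesis using rho_cycle_elem by blast
    qed
    then show "set (map (cycle_elem n) cs) \<subseteq> carrier (cover n)"
      "map rho (map (cycle_elem n) cs) = map (cyc (n + 1)) cs" by auto
  qed
  show "D_class \<nu> n \<subseteq> carrier (cover n)"
    unfolding D using elem(1) list_mult_closed by auto
  have "rho (list_mult (cover n) (map (cycle_elem n) cs)) = prodcyc (n + 1) cs"
    if cs: "cs \<in> cycle_lists \<nu> n" for cs
    unfolding rho_list_mult[OF elem(1)[OF cs]] elem(2)[OF cs] prodcyc_def ..
  then show "rho ` D_class \<nu> n = clif_class \<nu> n"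
    unfolding D clif_class_def image_image by (intro image_cong) auto
qed

lemma d_elem_eq: "\<nu> \<in> \<E>\<P> \<Longrightarrow> d_elem \<nu> n = pe (\<lambda>g. of_bool (g \<in> clif_class \<nu> n))"
  using set_sum_emb[OF D_class_subset(1)] D_class_subset(2) by (simp add: d_elem_def pe_def)

lemma expansion_iff:
  "e_elem r n = (\<Oplus>\<^bsub>S\<^esub>\<mu>\<in>basis_index n. [c \<mu>] \<cdot>\<^bsub>S\<^esub> d_elem \<mu> n) \<longleftrightarrow>
    (\<forall>g\<in>pin n. spin_coeff r n g = (\<Sum>\<mu>\<in>basis_index n.
      c \<mu> * (of_bool (g \<in> clif_class \<mu> n) - of_bool (- g \<in> clif_class \<mu> n))))"
proof -
  have "(\<Oplus>\<^bsub>S\<^esub>\<mu>\<in>basis_index n. [c \<mu>] \<cdot>\<^bsub>S\<^esub> d_elem \<mu> n)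
    = (\<Oplus>\<^bsub>S\<^esub>\<mu>\<in>basis_index n. pe (\<lambda>g. c \<mu> * of_bool (g \<in> clif_class \<mu> n)))"
    by (rule SS.finsum_cong') (auto simp: basis_index_def d_elem_eq pe_add_pow)
  also have "\<dots> = pe (\<lambda>g. \<Sum>\<mu>\<in>basis_index n. c \<mu> * of_bool (g \<in> clif_class \<mu> n))"
    by (rule pe_sum[OF finite_basis_index])
  finally show ?thesis
    unfolding e_elem_eq pe_eq_iff
    by (simp add: pe_eq_iff spin_coeff_def right_diff_distrib sum_subtractf)
qed

text \<open>Neither \<open>g\<close> nor \<open>- g\<close> lies in a class of another type, and
  \<open>- g\<close> does not lie in the class of \<open>g\<close>; so exactly one summand survives,
  with factor one.\<close>

lemma sum_basis_at_class:
  assumes "\<nu> \<in> basis_index n" "g \<in> clif_class \<nu> n"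
  shows "(\<Sum>\<mu>\<in>basis_index n. c \<mu> * (of_bool (g \<in> clif_class \<mu> n) - of_bool (- g \<in> clif_class \<mu> n)))
    = (c \<nu> :: int)"
proof -
  have \<nu>: "\<nu> \<in> \<E>\<P>" using assms(1) by (simp add: basis_index_def)
  have "(\<Sum>\<mu>\<in>basis_index n. c \<mu> * (of_bool (g \<in> clif_class \<mu> n) - of_bool (- g \<in> clif_class \<mu> n)))
    = (\<Sum>\<mu>\<in>{\<nu>}. c \<mu> * (of_bool (g \<in> clif_class \<mu> n) - of_bool (- g \<in> clif_class \<mu> n)))"
  proof (rule sum.mono_neutral_right)
    show "\<forall>\<mu>\<in>basis_index n - {\<nu>}. c \<mu> * (of_bool (g \<in> clif_class \<mu> n) - of_bool (- g \<in> clif_class \<mu> n)) = 0"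
    proof
      fix \<mu> assume \<mu>: "\<mu> \<in> basis_index n - {\<nu>}"
      then have "g \<notin> clif_class \<mu> n" "- g \<notin> clif_class \<mu> n"
        using clif_class_type[OF \<nu> _ assms(2), of \<mu>] by (auto simp: basis_index_def)
      then show "c \<mu> * (of_bool (g \<in> clif_class \<mu> n) - of_bool (- g \<in> clif_class \<mu> n)) = 0" by simp
    qed
  qed (use assms finite_basis_index in auto)
  then show ?thesis using assms(2) clif_class_uminus[OF \<nu> assms(2)] by simp
qed

text \<open>Evaluation at one element of each class forces the coefficients. The function so
  obtained does give an expansion, because \<open>spin_coeff\<close> is constant on classes and
  vanishes away from them and their negatives. The definite description needs both.\<close>

lemma d_coeff_e_elem:
  assumes \<nu>: "\<nu> \<in> basis_index n" and g: "g \<in> clif_class \<nu> n"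
  shows "d_coeff n (e_elem r n) \<nu> = spin_coeff r n g"
proof -
  \<comment> \<open>The value 0 outside \<open>basis_index n\<close> is the normalisation demanded
    by \<open>d_coeff\<close>.\<close>
  define c where "c \<mu> = (if \<mu> \<in> basis_index n then spin_coeff r n (SOME g. g \<in> clif_class \<mu> n) else 0)" for \<mu>
  have c: "spin_coeff r n f = c \<mu>" if "\<mu> \<in> basis_index n" "f \<in> clif_class \<mu> n" for f \<mu>
    using spin_coeff_clif_class_constant[OF _ that(2) someI[of "\<lambda>g. g \<in> clif_class \<mu> n", OF that(2)], of r] that(1)
    by (simp add: c_def basis_index_def)
  have "spin_coeff r n f = (\<Sum>\<mu>\<in>basis_index n.
      c \<mu> * (of_bool (f \<in> clif_class \<mu> n) - of_bool (- f \<in> clif_class \<mu> n)))" if f: "f \<in> pin n" for f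
  proof (cases "\<exists>\<mu>\<in>basis_index n. f \<in> clif_class \<mu> n \<or> - f \<in> clif_class \<mu> n")
    case False
    then have "spin_coeff r n f = 0" using spin_coeff_support[OF f] by blast
    moreover have "(\<Sum>\<mu>\<in>basis_index n.
      c \<mu> * (of_bool (f \<in> clif_class \<mu> n) - of_bool (- f \<in> clif_class \<mu> n))) = 0"
      using False by (intro sum.neutral) auto
    ultimately show ?thesis by simp
  next
    case True
    then obtain \<mu> where \<mu>: "\<mu> \<in> basis_index n" "f \<in> clif_class \<mu> n \<or> - f \<in> clif_class \<mu> n" by blast
    show ?thesis
    proof (cases "f \<in> clif_class \<mu> n")
      case True
      then show ?thesis using sum_basis_at_class[OF \<mu>(1) True, of c] c[OF \<mu>(1) True] by simp
    next
      case False
      then have nf: "- f \<in> clif_class \<mu> n" using \<mu>(2) by blast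
      have "(\<Sum>\<mu>\<in>basis_index n. c \<mu> * (of_bool (f \<in> clif_class \<mu> n) - of_bool (- f \<in> clif_class \<mu> n)))
        = - (\<Sum>\<mu>\<in>basis_index n. c \<mu> * (of_bool (- f \<in> clif_class \<mu> n) - of_bool (- (- f) \<in> clif_class \<mu> n)))"
        unfolding sum_negf [symmetric] by (intro sum.cong) (auto simp: algebra_simps)
      also have "\<dots> = spin_coeff r n f"
        using sum_basis_at_class[OF \<mu>(1) nf, of c] c[OF \<mu>(1) nf] by (simp add: spin_coeff_uminus)
      finally show ?thesis by simp
    qed
  qed
  then have exp: "e_elem r n = (\<Oplus>\<^bsub>S\<^esub>\<mu>\<in>basis_index n. [c \<mu>] \<cdot>\<^bsub>S\<^esub> d_elem \<mu> n)"
    unfolding expansion_iff by blast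
  have "c' = c" if c': "\<forall>\<mu>. \<mu> \<notin> basis_index n \<longrightarrow> c' \<mu> = 0"
    "e_elem r n = (\<Oplus>\<^bsub>S\<^esub>\<mu>\<in>basis_index n. [c' \<mu>] \<cdot>\<^bsub>S\<^esub> d_elem \<mu> n)" for c'
  proof
    fix \<mu>
    show "c' \<mu> = c \<mu>"
    proof (cases "\<mu> \<in> basis_index n")
      case True
      then obtain f where f: "f \<in> clif_class \<mu> n"
        using clif_class_nonempty[of \<mu> n] by (auto simp: basis_index_def)
      have "f \<in> pin n" using True f by (intro clif_class_in_pin) (auto simp: basis_index_def)
      then have "spin_coeff r n f = c' \<mu>"
        using c'(2) sum_basis_at_class[OF True f, of c'] unfolding expansion_iff by auto
      then show ?thesis using c[OF True f] by simp
    qed (use c' in \<open>simp add: c_def\<close>)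
  qed
  then have "d_coeff n (e_elem r n) = c"
    unfolding d_coeff_def using exp by (intro the_equality) (auto simp: c_def)
  then show ?thesis using c[OF \<nu> g] by simp
qed

end

text \<open>The value given by \<open>spin_coeff_clif_class\<close> does not involve
  \<open>n\<close>, so the common value exists; the smallest admissible \<open>n\<close> shows that
  it is unique.\<close>

lemma A_coeff_eq:
  assumes "\<nu> \<in> even_partitions_of (2 * r)"
  shows "A_coeff \<nu> = (\<Prod>i\<in>#\<nu>. - int (catalan (i div 2)))"
proof -
  have \<nu>: "\<nu> \<in> \<E>\<P>" "sum_mset \<nu> = 2 * r" using assms by (auto simp: even_partitions_of_def)
  have val: "d_coeff n (e_elem (sum_mset \<nu> div 2) n) \<nu> = (\<Prod>i\<in>#\<nu>. - int (catalan (i div 2)))"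
    if n: "n \<ge> sum_mset \<nu> + size \<nu>" for n
  proof -
    obtain g where g: "g \<in> clif_class \<nu> n" using clif_class_nonempty[OF n] by blast
    have "\<nu> \<in> basis_index n" using \<nu> n by (simp add: basis_index_def)
    then show ?thesis
      using spin_cover.d_coeff_e_elem[OF _ g, of r] spin_coeff_clif_class[OF \<nu>(1) g \<nu>(2)] \<nu>(2) by simp
  qed
  show ?thesis unfolding A_coeff_def
  proof (rule the_equality)
    fix a assume "\<forall>n\<ge>sum_mset \<nu> + size \<nu>. d_coeff n (e_elem (sum_mset \<nu> div 2) n) \<nu> = a"
    then show "a = (\<Prod>i\<in>#\<nu>. - int (catalan (i div 2)))" using val by (metis order_refl)
  qed (use val in blast)
qed

theorem theorem5p3:
  fixes m r :: nat
  assumes "m = 2 * r" and "0 < m"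
  shows "(\<Sum>\<nu>\<in>even_partitions_of m. of_int (A_coeff \<nu>) * poly (P_poly \<nu>) (- of_nat m))
    = 2 * (- 1) ^ r"
proof -
  have "(\<Sum>\<nu>\<in>even_partitions_of m. of_int (A_coeff \<nu>) * poly (P_poly \<nu>) (- of_nat m))
    = (\<Sum>\<nu>\<in>even_partitions_of m.
        of_int (\<Prod>i\<in>#\<nu>. - int (catalan (i div 2))) * poly (P_poly \<nu>) (- of_nat m))"
    using A_coeff_eq assms(1) by (intro sum.cong) auto
  then show ?thesis using even_partition_sum[OF assms] by simp
qed

end
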